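(* Let $\epsilon \leq 0.01$. For any choice of $\Delta$ with $\log^4 n \leq \Delta \leq n^{\epsilon}$, there is an $n$-vertex bipartite graph $G$ of maximum degree $\Delta$ such that any local computation algorithm (LCA) that, with probability at least $0.51$, computes a $(1,\epsilon n)$-approximate maximum matching of $G$ must make at least $\Delta^{\Omega(1/\epsilon)}$ queries to $G$.
   Context: Graph access is via adjacency-list queries: given a vertex $v$ and an integer $i$, the query returns the $i$-th neighbor of $v$, or $\perp$ if $v$ has fewer than $i$ neighbors. A local computation algorithm (LCA) for matching, when asked about a vertex $v$, makes such queries (and may use a shared random tape) and must answer whether $v$ is matched and, if so, to which neighbor. Its answers must be consistent with one fixed matching regardless of the order in which vertices are asked. Its complexity is the worst-case number of queries it makes to answer a single question. A matching $M$ in $G$ is a $(1,\epsilon n)$-approximate maximum matching if $|M| \geq \mu(G) - \epsilon n$, where $\mu(G)$ denotes the size of a maximum matching of $G$ and $n$ is the number of vertices. *)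

theory Defs
  imports "HOL-Probability.Probability"
begin

subsection \<open>Graphs on the vertex set \<open>{..<n}\<close>, given by their edge sets\<close>

definition simple_graph :: "nat \<Rightarrow> nat set set \<Rightarrow> bool" where
  "simple_graph n E \<longleftrightarrow> (\<forall>e\<in>E. e \<subseteq> {..<n} \<and> card e = 2)"

definition bipartite :: "nat \<Rightarrow> nat set set \<Rightarrow> bool" where
  "bipartite n E \<longleftrightarrow>
     (\<exists>L R. L \<union> R = {..<n} \<and> L \<inter> R = {} \<and> (\<forall>e\<in>E. \<exists>u\<in>L. \<exists>v\<in>R. e = {u, v}))"

definition neighbors :: "nat set set \<Rightarrow> nat \<Rightarrow> nat set" where
  "neighbors E v = {u. {v, u} \<in> E}"

definition max_degree :: "nat \<Rightarrow> nat set set \<Rightarrow> nat" where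
  "max_degree n E = Max ((\<lambda>v. card (neighbors E v)) ` {..<n})"

definition graph_iso :: "nat \<Rightarrow> nat set set \<Rightarrow> nat set set \<Rightarrow> bool" where
  "graph_iso n E E' \<longleftrightarrow> (\<exists>\<pi>. bij_betw \<pi> {..<n} {..<n} \<and> E' = (\<lambda>e. \<pi> ` e) ` E)"

definition matching :: "nat set set \<Rightarrow> nat set set \<Rightarrow> bool" where
  "matching E M \<longleftrightarrow> M \<subseteq> E \<and> disjoint M"

definition matching_number :: "nat set set \<Rightarrow> nat" where
  "matching_number E = Max (card ` {M. matching E M})"

definition approx_max_matching :: "nat \<Rightarrow> real \<Rightarrow> nat set set \<Rightarrow> nat set set \<Rightarrow> bool" where
  "approx_max_matching n \<epsilon> E M \<longleftrightarrow>
     matching E M \<and> real (card M) \<ge> real (matching_number E) - \<epsilon> * real n"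

subsection \<open>Adjacency-list access\<close>

definition adjacency_lists :: "nat \<Rightarrow> nat set set \<Rightarrow> (nat \<Rightarrow> nat list) \<Rightarrow> bool" where
  "adjacency_lists n E adj \<longleftrightarrow>
     (\<forall>v<n. distinct (adj v) \<and> set (adj v) = neighbors E v) \<and> (\<forall>v\<ge>n. adj v = [])"

text \<open>The indices of neighbors start at 1; \<open>None\<close> is the answer \<open>\<bottom>\<close>.\<close>

definition adj_query :: "(nat \<Rightarrow> nat list) \<Rightarrow> nat \<Rightarrow> nat \<Rightarrow> nat option" where
  "adj_query adj v i = (if 1 \<le> i \<and> i \<le> length (adj v) then Some (adj v ! (i - 1)) else None)"

text \<open>
  An adaptive query strategy is a decision tree: \<open>Query v i k\<close> asks for the \<open>i\<close>-th neighbor of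
  \<open>v\<close> and continues as \<open>k\<close> prescribes for the reply, and \<open>Answer x\<close> stops.  The answer \<open>None\<close>
  means unmatched, and \<open>Some u\<close> means matched to \<open>u\<close>.
\<close>

datatype strategy = Answer "nat option" | Query nat nat "nat option \<Rightarrow> strategy"

primrec run :: "(nat \<Rightarrow> nat list) \<Rightarrow> strategy \<Rightarrow> nat option" where
  "run adj (Answer x) = x"
| "run adj (Query v i k) = run adj (k (adj_query adj v i))"

primrec query_count :: "(nat \<Rightarrow> nat list) \<Rightarrow> strategy \<Rightarrow> nat" where
  "query_count adj (Answer x) = 0"
| "query_count adj (Query v i k) = Suc (query_count adj (k (adj_query adj v i)))"

subsection \<open>Local computation algorithms for matching\<close>

text \<open>
  An LCA maps the shared random tape and the vertex asked about to a strategy.  It keeps no state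
  between questions, so its answers cannot depend on the order in which vertices are asked.
\<close>

type_synonym lca = "bool stream \<Rightarrow> nat \<Rightarrow> strategy"

definition random_tape :: "bool stream measure" where
  "random_tape = stream_space (measure_pmf (pmf_of_set UNIV))"

text \<open>For a fixed tape, the answers at all vertices describe precisely the matching \<open>M\<close>.\<close>

definition answers_matching ::
    "nat \<Rightarrow> (nat \<Rightarrow> nat list) \<Rightarrow> (nat \<Rightarrow> strategy) \<Rightarrow> nat set set \<Rightarrow> bool" where
  "answers_matching n adj S M \<longleftrightarrow> (\<forall>v<n. \<forall>u. run adj (S v) = Some u \<longleftrightarrow> {v, u} \<in> M)"

text \<open>
  A graph is accessible only through its adjacency lists: neither the names of its vertices nor
  the order of the lists is fixed in advance.  (Otherwise an algorithm could have a matching of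
  the graph hardwired and would need no queries.)  An input for \<open>E\<close> is thus any labelled copy of
  \<open>E\<close> together with any adjacency lists of that copy.
\<close>

definition presentation :: "nat \<Rightarrow> nat set set \<Rightarrow> nat set set \<Rightarrow> (nat \<Rightarrow> nat list) \<Rightarrow> bool" where
  "presentation n E E' adj \<longleftrightarrow> graph_iso n E E' \<and> adjacency_lists n E' adj"

text \<open>Sets that are not measurable have \<^const>\<open>measure\<close> 0, so measurability of the success event
  is implied by the bound.\<close>

definition computes_approx_matching ::
    "nat \<Rightarrow> real \<Rightarrow> nat set set \<Rightarrow> real \<Rightarrow> lca \<Rightarrow> bool" where
  "computes_approx_matching n \<epsilon> E p A \<longleftrightarrow>
     (\<forall>E' adj. presentation n E E' adj \<longrightarrow>
        measure random_tape
          {r \<in> space random_tape.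
             \<exists>M. approx_max_matching n \<epsilon> E' M \<and> answers_matching n adj (A r) M} \<ge> p)"

text \<open>The number of queries is the worst case over inputs for \<open>E\<close>, tapes and questions.\<close>

definition makes_queries :: "nat \<Rightarrow> nat set set \<Rightarrow> lca \<Rightarrow> real \<Rightarrow> bool" where
  "makes_queries n E A q \<longleftrightarrow>
     (\<exists>E' adj r v. presentation n E E' adj \<and> r \<in> space random_tape \<and> v < n
        \<and> real (query_count adj (A r v)) \<ge> q)"

end

theory Submission
  imports Defs "HOL-Probability.Product_PMF" "HOL-Computational_Algebra.Polynomial" "HOL-Computational_Algebra.Primes"
    "HOL-Real_Asymp.Real_Asymp"
begin

text \<open>
  The hard graph is a bipartite lift of a small multigraph, the gadget, in which the vertices
  \<open>U j x\<close>, \<open>W j x\<close> (\<open>j \<le> h\<close>) form paths ending in the centre edge at \<open>U h x\<close>.  The \<open>W j x\<close> and the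
  few vertices \<open>C i\<close> cover all other edges, so a nearly maximum matching must use a constant
  fraction of the lifts of the centre edges.  To an explorer that
  starts over \<open>U h x\<close>, the centre edge and the \<open>s\<close> edges to \<open>C (h - 1)\<close> look alike: the trees
  behind them differ only by children of smaller depth, each hidden among many children with nearly
  the same tree, and a coupling that swaps such a child with a random one of these shows that every
  level of depth multiplies the number of queries needed by \<open>z\<close>.  Hence finding the centre edge
  takes about \<open>z ^ (h - 1) = \<Delta> powr \<Omega>(1 / \<epsilon>)\<close> queries.

  The lift must have few short closed walks, so that after a random relabelling the explored part
  of the graph is distributed like a random tree.  The edges of colour \<open>t\<close> act on pairs over the
  field with \<open>p\<close> elements by an involution with parameter \<open>q * t\<close>; a closed walk is then a zero of
  a nonzero polynomial in \<open>q\<close> (a continuant), whose degree is bounded by the length of the walk.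
\<close>

subsection \<open>Adaptive explorers of labelled trees\<close>

text \<open>A single visit shows only a degree and a label, so the one clue about an edge is the
  tree behind it. What shapes the proof is adaptivity: an explorer that meets a suspicious child
  could spend all its visits there. Indistinguishability is therefore measured against the visits
  made: one bijection of the port orders serves all explorers, and the orders on which it fails
  number at most 1 / u of the total visits. A child coupled only at strength z ^ m among siblings
  coupled at z ^ (m + 1) does no harm, since it cannot be told at strength z ^ m from about s of its
  siblings and so draws no more visits than they do, up to a constant. The explored forest has
  independent labels, orders and root positions; the real graph does not. The two are compared
  transcript by transcript: in a transcript without repeated labels or places, drawing without
  replacement only makes each entry more likely, so the real graph produces it at least as often.
  The centre edge is a loop of the gadget; a Boolean side in the lift makes it an edge and the graph
  bipartite.\<close>

datatype 'o explorer = Stop "nat option" | Visit "nat list" "'o \<Rightarrow> 'o explorer"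

primrec result :: "'o explorer \<Rightarrow> (nat list \<Rightarrow> 'o) \<Rightarrow> nat option" where
  "result (Stop x) ob = x"
| "result (Visit p c) ob = result (c (ob p)) ob"

primrec visits :: "'o explorer \<Rightarrow> (nat list \<Rightarrow> 'o) \<Rightarrow> nat" where
  "visits (Stop x) ob = 0"
| "visits (Visit p c) ob = Suc (visits (c (ob p)) ob)"

primrec visited :: "'o explorer \<Rightarrow> (nat list \<Rightarrow> 'o) \<Rightarrow> nat list set" where
  "visited (Stop x) ob = {}"
| "visited (Visit p c) ob = insert p (visited (c (ob p)) ob)"

text \<open>The run follows \<open>ob\<close>. Up to the first disagreement the run on
  \<open>ob'\<close> is the same, so it makes no difference which of the two is followed to find
  it.\<close>

primrec differs :: "'o explorer \<Rightarrow> (nat list \<Rightarrow> 'o) \<Rightarrow> (nat list \<Rightarrow> 'o) \<Rightarrow> bool" where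
  "differs (Stop x) ob ob' = False"
| "differs (Visit p c) ob ob' = (ob p \<noteq> ob' p \<or> differs (c (ob p)) ob ob')"

primrec depth_le :: "nat \<Rightarrow> 'o explorer \<Rightarrow> bool" where
  "depth_le L (Stop x) = True"
| "depth_le L (Visit p c) = (length p \<le> L \<and> (\<forall>y. depth_le L (c y)))"

definition in_port :: "nat \<Rightarrow> nat list \<Rightarrow> bool" where
  "in_port k p \<longleftrightarrow> (\<exists>q. p = k # q)"

text \<open>The view of an explorer from inside the subtree at port \<open>k\<close>, the rest of the tree being fixed.\<close>

primrec restr :: "nat \<Rightarrow> 'o explorer \<Rightarrow> (nat list \<Rightarrow> 'o) \<Rightarrow> 'o explorer" where
  "restr k (Stop x) ob = Stop x"
| "restr k (Visit p c) ob =
     (if in_port k p then Visit (tl p) (\<lambda>y. restr k (c y) ob) else restr k (c (ob p)) ob)"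

primrec port_visits :: "nat \<Rightarrow> 'o explorer \<Rightarrow> (nat list \<Rightarrow> 'o) \<Rightarrow> nat" where
  "port_visits k (Stop x) ob = 0"
| "port_visits k (Visit p c) ob = (if in_port k p then 1 else 0) + port_visits k (c (ob p)) ob"

primrec cap :: "nat \<Rightarrow> 'o explorer \<Rightarrow> 'o explorer" where
  "cap K (Stop x) = Stop x"
| "cap K (Visit p c) = (if K = 0 then Stop None else Visit p (\<lambda>y. cap (K - 1) (c y)))"

text \<open>The budget is shared by the ports \<open>i\<close> and \<open>j\<close>, and visits
  elsewhere are free: the two trees to be compared differ only below these ports.\<close>

primrec cap2 :: "nat \<Rightarrow> nat \<Rightarrow> 'o explorer \<Rightarrow> nat \<Rightarrow> 'o explorer" where
  "cap2 i j (Stop x) K = Stop x"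
| "cap2 i j (Visit p c) K = (if in_port i p \<or> in_port j p
     then (if K = 0 then Stop None else Visit p (\<lambda>y. cap2 i j (c y) (K - 1)))
     else Visit p (\<lambda>y. cap2 i j (c y) K))"

lemma in_port_simps [simp]: "\<not> in_port k []" "in_port k (j # q) \<longleftrightarrow> j = k"
  by (auto simp: in_port_def)

lemma visits_restr: "visits (restr k e ob) (\<lambda>q. ob (k # q)) = port_visits k e ob"
  by (induction e) (auto simp: in_port_def)

lemma depth_le_restr: "depth_le (Suc L) e \<Longrightarrow> depth_le L (restr k e ob)"
  by (induction e) (auto simp: in_port_def)

lemma depth_le_cap: "depth_le L e \<Longrightarrow> depth_le L (cap K e)"
  by (induction e arbitrary: K) auto

lemma depth_le_cap2: "depth_le L e \<Longrightarrow> depth_le L (cap2 i j e K)"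
  by (induction e arbitrary: K) auto

lemma restr_cong: "(\<And>p. \<not> in_port k p \<Longrightarrow> ob p = ob' p) \<Longrightarrow> restr k e ob = restr k e ob'"
  by (induction e) auto

lemma sum_port_visits_le:
  assumes "finite A" shows "(\<Sum>k\<in>A. port_visits k e ob) \<le> visits e ob"
proof (induction e)
  case (Visit p c)
  have "(\<Sum>k\<in>A. if in_port k p then 1 else 0 :: nat) \<le> 1"
  proof (cases p)
    case (Cons j q)
    then show ?thesis using assms by (simp add: sum.delta)
  qed simp
  then show ?case using Visit[of "c (ob p)"] by (simp add: sum.distrib)
qed simp

text \<open>A visited address lies at the root or below a single port, and \<open>restr\<close>
  replays the same run, supplying the observations outside that port. Differences can thus be
  charged to single ports.\<close>

lemma differs_imp_restr:
  "differs e ob ob' \<Longrightarrow> ob [] \<noteq> ob' [] \<or>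
     (\<exists>k. differs (restr k e ob) (\<lambda>q. ob (k # q)) (\<lambda>q. ob' (k # q)))"
proof (induction e)
  case (Visit p c)
  show ?case
  proof (cases "ob p = ob' p")
    case True
    then have "differs (c (ob p)) ob ob'" using Visit.prems by simp
    from Visit.IH[OF _ this] consider "ob [] \<noteq> ob' []"
      | k where "differs (restr k (c (ob p)) ob) (\<lambda>q. ob (k # q)) (\<lambda>q. ob' (k # q))" by blast
    then show ?thesis
    proof cases
      case 2
      have "differs (restr k (Visit p c) ob) (\<lambda>q. ob (k # q)) (\<lambda>q. ob' (k # q))"
        using 2 by (auto simp: in_port_def)
      then show ?thesis by blast
    qed simp
  next
    case False
    show ?thesis
    proof (cases p)
      case (Cons k q)
      have "differs (restr k (Visit p c) ob) (\<lambda>q. ob (k # q)) (\<lambda>q. ob' (k # q))"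
        using False Cons by simp
      then show ?thesis by blast
    qed (use False in simp)
  qed
qed simp

lemma result_eq: "\<not> differs e ob ob' \<Longrightarrow> result e ob = result e ob'"
  by (induction e) auto

lemma visits_cap: "visits (cap K e) ob = min (visits e ob) K"
  by (induction e arbitrary: K) (auto simp: min_def split: nat.splits)

text \<open>Splits a failure into an early one, to which the coupling bound of the capped explorer
  applies, and a long run, which Markov's inequality handles.\<close>

lemma differs_cap: "differs e ob ob' \<Longrightarrow> differs (cap K e) ob ob' \<or> K \<le> visits e ob"
proof (induction e arbitrary: K)
  case (Visit p c)
  show ?case using Visit.IH[of "c (ob p)" "K - 1"] Visit.prems by (cases K) auto
qed simp

lemma differs_visits: "differs e ob ob' \<Longrightarrow> 1 \<le> visits e ob"
  by (cases e) auto

lemma port_visits_cap2_le: "port_visits k (cap2 i j e K) ob \<le> port_visits k e ob"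
  by (induction e arbitrary: K) auto

lemma port_visits_cap2_cap:
  "i \<noteq> j \<Longrightarrow> port_visits i (cap2 i j e K) ob + port_visits j (cap2 i j e K) ob \<le> K"
proof (induction e arbitrary: K)
  case (Visit p c)
  show ?case using Visit.IH[of "c (ob p)" "K - 1"] Visit.IH[of "c (ob p)" K] Visit.prems
    by (cases p; cases K) auto
qed simp

text \<open>As long as the capped explorer cannot tell the two trees apart, it either finishes in both
  with the same counts or uses up the budget \<open>K\<close> in both.\<close>

lemma port_visits_swap:
  assumes "i \<noteq> j" "\<And>p. \<not> in_port i p \<Longrightarrow> \<not> in_port j p \<Longrightarrow> ob p = ob' p"
    "\<not> differs (cap2 i j e K) ob ob'"
  shows "min (port_visits i e ob) (Suc K) \<le> port_visits i e ob' + port_visits j e ob"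
  using assms(3)
proof (induction e arbitrary: K)
  case (Visit p c)
  show ?case
  proof (cases "in_port i p \<or> in_port j p")
    case True
    show ?thesis
    proof (cases K)
      \<comment> \<open>With no budget left the left side is at most 1, and the visit about to
        happen is counted on the right: by the first summand below \<open>i\<close>, by the second
        below \<open>j\<close>.\<close>
      case 0 then show ?thesis using True assms(1) by (auto simp: in_port_def)
    next
      case (Suc K')
      then have "ob p = ob' p" "\<not> differs (cap2 i j (c (ob p)) K') ob ob'"
        using Visit.prems True by auto
      then show ?thesis using Visit.IH[of "c (ob p)" K'] True Suc by auto
    qed
  next
    case False
    then have "ob p = ob' p" "\<not> differs (cap2 i j (c (ob p)) K) ob ob'"
      using Visit.prems by auto
    then show ?thesis using Visit.IH[of "c (ob p)" K] False by auto
  qed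
qed simp

subsection \<open>Random port orders\<close>

type_synonym port_orders = "nat list \<Rightarrow> nat \<Rightarrow> nat"

definition paths :: "nat \<Rightarrow> nat \<Rightarrow> nat list set" where
  "paths d L = {p. set p \<subseteq> {..<d} \<and> length p < L}"

text \<open>The default \<open>id\<close> off the paths of length below \<open>L\<close> makes this
  a finite set of total functions, so uniform probabilities become ratios of cardinalities.\<close>

definition orders :: "nat \<Rightarrow> nat \<Rightarrow> port_orders set" where
  "orders d L = PiE_dflt (paths d L) id (\<lambda>_. {s. s permutes {..<d}})"

definition sub :: "(nat list \<Rightarrow> 'a) \<Rightarrow> nat \<Rightarrow> nat list \<Rightarrow> 'a" where
  "sub f k = (\<lambda>q. f (k # q))"

definition upd :: "(nat list \<Rightarrow> 'a) \<Rightarrow> nat \<Rightarrow> (nat list \<Rightarrow> 'a) \<Rightarrow> nat list \<Rightarrow> 'a" where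
  "upd f k h = (\<lambda>p. if in_port k p then h (tl p) else f p)"

lemma sub_upd: "sub (upd f k h) j = (if j = k then h else sub f j)"
  by (auto simp: sub_def upd_def)

lemma upd_root [simp]: "upd f k h [] = f []"
  by (simp add: upd_def)

lemma upd_sub [simp]: "upd (upd f k h) k (sub f k) = f"
  by (auto simp: upd_def sub_def in_port_def fun_eq_iff)

lemma finite_paths: "finite (paths d L)"
proof -
  have "paths d L \<subseteq> {p. set p \<subseteq> {..<d} \<and> length p \<le> L}" by (auto simp: paths_def)
  then show ?thesis using finite_lists_length_le[of "{..<d}" L] finite_subset by blast
qed

lemma finite_orders: "finite (orders d L)"
  unfolding orders_def by (intro finite_PiE_dflt finite_paths) (simp add: finite_permutations)

lemma orders_memI:
  assumes "\<And>p. p \<in> paths d L \<Longrightarrow> f p permutes {..<d}" "\<And>p. p \<notin> paths d L \<Longrightarrow> f p = id"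
  shows "f \<in> orders d L"
  using assms by (auto simp: orders_def PiE_dflt_def)

lemma orders_permutes: "f \<in> orders d L \<Longrightarrow> f p permutes {..<d}"
  by (cases "p \<in> paths d L") (auto simp: orders_def PiE_dflt_def permutes_id)

lemma orders_id: "f \<in> orders d L \<Longrightarrow> p \<notin> paths d L \<Longrightarrow> f p = id"
  by (auto simp: orders_def PiE_dflt_def)

lemma paths_Cons: "k # q \<in> paths d (Suc L) \<longleftrightarrow> k < d \<and> q \<in> paths d L"
  by (auto simp: paths_def)

lemma sub_orders: "f \<in> orders d (Suc L) \<Longrightarrow> k < d \<Longrightarrow> sub f k \<in> orders d L"
  by (rule orders_memI) (auto simp: sub_def orders_permutes intro!: orders_id simp: paths_Cons)

lemma upd_orders: "f \<in> orders d (Suc L) \<Longrightarrow> k < d \<Longrightarrow> h \<in> orders d L \<Longrightarrow> upd f k h \<in> orders d (Suc L)"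
  by (rule orders_memI)
    (auto simp: upd_def in_port_def orders_permutes paths_Cons intro: orders_id)

text \<open>Redrawing the subtree of \<open>f\<close> at the port \<open>\<kappa> f\<close>
  preserves the uniform distribution, because exchanging the old subtree with the new one is an
  involution on pairs. Hence the sums need only be compared with the rest of the tree held
  fixed.\<close>

lemma resample_sum_le:
  fixes F H :: "(nat list \<Rightarrow> 'a) \<Rightarrow> nat"
  assumes fin: "finite X" "finite Y" and ne: "Y \<noteq> {}"
    and upd: "\<And>f h. f \<in> X \<Longrightarrow> h \<in> Y \<Longrightarrow> upd f (\<kappa> f) h \<in> X \<and> \<kappa> (upd f (\<kappa> f) h) = \<kappa> f"
    and sub: "\<And>f. f \<in> X \<Longrightarrow> sub f (\<kappa> f) \<in> Y"
    and le: "\<And>f. f \<in> X \<Longrightarrow> (\<Sum>h\<in>Y. F (upd f (\<kappa> f) h)) \<le> (\<Sum>h\<in>Y. H (upd f (\<kappa> f) h))"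
  shows "(\<Sum>f\<in>X. F f) \<le> (\<Sum>f\<in>X. H f)"
proof -
  have eq: "(\<Sum>f\<in>X. \<Sum>h\<in>Y. G (upd f (\<kappa> f) h)) = card Y * (\<Sum>f\<in>X. G f)" for G :: "_ \<Rightarrow> nat"
  proof -
    have "(\<Sum>f\<in>X. \<Sum>h\<in>Y. G (upd f (\<kappa> f) h)) = (\<Sum>(f, h)\<in>X \<times> Y. G (upd f (\<kappa> f) h))"
      by (rule sum.cartesian_product)
    also have "\<dots> = (\<Sum>(f, h)\<in>X \<times> Y. G f)"
      by (rule sum.reindex_bij_witness[where i = "\<lambda>(f, h). (upd f (\<kappa> f) h, sub f (\<kappa> f))"
            and j = "\<lambda>(f, h). (upd f (\<kappa> f) h, sub f (\<kappa> f))"])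
        (auto simp: upd sub sub_upd)
    also have "\<dots> = (\<Sum>f\<in>X. \<Sum>h\<in>Y. G f)"
      by (rule sum.cartesian_product[symmetric])
    finally show ?thesis by (simp add: sum_distrib_left)
  qed
  have "card Y * (\<Sum>f\<in>X. F f) \<le> card Y * (\<Sum>f\<in>X. H f)"
    unfolding eq[symmetric] by (intro sum_mono le)
  then show ?thesis using fin ne by (simp add: card_gt_0_iff)
qed

section \<open>Random trees generated by states, and couplings of their port orders\<close>

locale tree_process =
  fixes d :: nat and ch :: "'st \<Rightarrow> nat \<Rightarrow> 'st" and ar :: "'st \<Rightarrow> nat" and dead :: 'st
  assumes ch_ge: "d \<le> k \<Longrightarrow> ch x k = dead" and ch_dead: "ch dead k = dead"
begin

text \<open>\<open>f [] k\<close> is the item behind port \<open>k\<close>. The child map speaks of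
  items, while an explorer sees ports only.\<close>

primrec state_at :: "nat list \<Rightarrow> 'st \<Rightarrow> port_orders \<Rightarrow> 'st" where
  "state_at [] x f = x"
| "state_at (k # p) x f = state_at p (ch x (f [] k)) (sub f k)"

definition obs :: "'st \<Rightarrow> port_orders \<Rightarrow> nat list \<Rightarrow> nat" where
  "obs x f p = ar (state_at p x f)"

lemma obs_Nil [simp]: "obs x f [] = ar x"
  by (simp add: obs_def)

lemma obs_Cons: "obs x f (k # q) = obs (ch x (f [] k)) (sub f k) q"
  by (simp add: obs_def)

lemma state_at_dead: "state_at p dead f = dead"
  by (induction p arbitrary: f) (auto simp: ch_dead)

lemma obs_dead: "obs dead f p = ar dead"
  by (simp add: obs_def state_at_dead)

definition port :: "nat \<Rightarrow> port_orders \<Rightarrow> nat" where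
  "port a f = inv (f []) a"

lemma port_upd [simp]: "port a (upd f k h) = port a f"
  by (simp add: port_def)

lemma port_props:
  assumes "f \<in> orders d L" "a < d"
  shows "port a f < d" "f [] (port a f) = a"
proof -
  have p: "f [] permutes {..<d}" using assms(1) by (rule orders_permutes)
  then show "f [] (port a f) = a" by (simp add: port_def permutes_inverses)
  show "port a f < d" using permutes_in_image[OF permutes_inv[OF p], of a] assms(2)
    by (simp add: port_def)
qed

lemma port_eqI:
  assumes "f \<in> orders d L" "f [] k = a"
  shows "port a f = k"
  using permutes_inverses(2)[OF orders_permutes[OF assms(1)], of "[]" k] assms(2)
  by (simp add: port_def)

lemma order_lt_iff: "f \<in> orders d L \<Longrightarrow> f [] k < d \<longleftrightarrow> k < d"
  using permutes_in_image[OF orders_permutes, of f d L "[]" k] by simp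

text \<open>Renames the items at the root by \<open>\<beta>\<close> and transforms the subtree
  behind each port by the map belonging to the item that used to be there. Ports from
  \<open>d\<close> on are reset to \<open>id\<close>, as membership in \<open>orders\<close>
  demands.\<close>

definition reorder :: "(nat \<Rightarrow> nat) \<Rightarrow> (nat \<Rightarrow> port_orders \<Rightarrow> port_orders) \<Rightarrow> port_orders \<Rightarrow> port_orders" where
  "reorder \<beta> \<Phi> f = (\<lambda>p. case p of [] \<Rightarrow> \<beta> \<circ> f []
     | k # q \<Rightarrow> if k < d then \<Phi> (f [] k) (sub f k) q else id)"

lemma reorder_Nil [simp]: "reorder \<beta> \<Phi> f [] = \<beta> \<circ> f []"
  by (simp add: reorder_def)

lemma sub_reorder: "k < d \<Longrightarrow> sub (reorder \<beta> \<Phi> f) k = \<Phi> (f [] k) (sub f k)"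
  by (simp add: reorder_def sub_def)

lemma reorder_bij:
  assumes \<beta>: "\<beta> permutes {..<d}" and \<Phi>: "\<And>a. a < d \<Longrightarrow> bij_betw (\<Phi> a) (orders d L) (orders d L)"
  shows "bij_betw (reorder \<beta> \<Phi>) (orders d (Suc L)) (orders d (Suc L))"
proof -
  have into: "reorder \<beta> \<Phi> f \<in> orders d (Suc L)" if f: "f \<in> orders d (Suc L)" for f
  proof (rule orders_memI)
    have S: "\<Phi> (f [] k) (sub f k) \<in> orders d L" if "k < d" for k
      using bij_betwE[OF \<Phi>[of "f [] k"]] sub_orders[OF f that] order_lt_iff[OF f, of k] that by blast
    fix p
    { assume "p \<in> paths d (Suc L)"
      then show "reorder \<beta> \<Phi> f p permutes {..<d}"
        using S orders_permutes[OF f, of "[]"] \<beta>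
        by (cases p) (auto simp: reorder_def paths_Cons orders_permutes permutes_compose permutes_id
            intro: orders_permutes) }
    { assume "p \<notin> paths d (Suc L)"
      then show "reorder \<beta> \<Phi> f p = id"
      proof (cases p)
        case (Cons k q)
        show ?thesis
        proof (cases "k < d")
          case True
          then have "q \<notin> paths d L" using \<open>p \<notin> _\<close> Cons by (simp add: paths_Cons)
          then show ?thesis using orders_id[OF S[OF True]] True Cons by (simp add: reorder_def)
        qed (use Cons in \<open>simp add: reorder_def\<close>)
      qed (simp add: paths_def) }
  qed
  have "inj_on (reorder \<beta> \<Phi>) (orders d (Suc L))"
  proof (rule inj_onI)
    fix f g assume fg: "f \<in> orders d (Suc L)" "g \<in> orders d (Suc L)" "reorder \<beta> \<Phi> f = reorder \<beta> \<Phi> g"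
    have "\<beta> \<circ> f [] = \<beta> \<circ> g []" using fun_cong[OF fg(3), of "[]"] by simp
    then have r: "f [] = g []" using permutes_inj[OF \<beta>] by (simp add: fun.inj_map_strong inj_def fun_eq_iff)
    have s: "sub f k = sub g k" if "k < d" for k
    proof -
      have "\<Phi> (f [] k) (sub f k) = \<Phi> (f [] k) (sub g k)"
        using arg_cong[OF fg(3), of "\<lambda>x. sub x k"] r that by (simp add: sub_reorder)
      then show ?thesis
        using \<Phi>[of "f [] k"] order_lt_iff[OF fg(1)] sub_orders[OF fg(1) that] sub_orders[OF fg(2) that] that
        by (auto simp: bij_betw_def inj_on_def)
    qed
    show "f = g"
    proof
      fix p show "f p = g p"
      proof (cases p)
        case (Cons k q)
        show ?thesis
        proof (cases "k < d")
          case True then show ?thesis using fun_cong[OF s[OF True], of q] Cons by (simp add: sub_def)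
        next
          case False
          then have "p \<notin> paths d (Suc L)" using Cons by (simp add: paths_Cons)
          then show ?thesis using orders_id fg by metis
        qed
      qed (use r in simp)
    qed
  qed
  then show ?thesis using into finite_orders
    by (metis bij_betw_def endo_inj_surj image_subsetI)
qed

text \<open>The failure probability is at most the expected number of visits divided by
  \<open>u\<close>. One \<open>\<Phi>\<close> has to serve all explorers: in the induction the
  explorer of a subtree depends on the orders outside of it, and the coupling of the subtree must
  not.\<close>

definition coupled_by :: "nat \<Rightarrow> nat \<Rightarrow> 'st \<Rightarrow> 'st \<Rightarrow> (port_orders \<Rightarrow> port_orders) \<Rightarrow> bool" where
  "coupled_by u L x y \<Phi> \<longleftrightarrow> bij_betw \<Phi> (orders d L) (orders d L) \<and>
     (\<forall>e. depth_le L e \<longrightarrow> u * card {f \<in> orders d L. differs e (obs x f) (obs y (\<Phi> f))}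
        \<le> (\<Sum>f\<in>orders d L. visits e (obs x f)))"

lemma coupled_by_bij: "coupled_by u L x y \<Phi> \<Longrightarrow> bij_betw \<Phi> (orders d L) (orders d L)"
  by (simp add: coupled_by_def)

lemma orders_ne: "orders d L \<noteq> {}"
  unfolding orders_def by (auto simp: PiE_dflt_def fun_eq_iff intro!: exI[of _ "\<lambda>_. id"] permutes_id)

lemma card_Collect_sum: "finite A \<Longrightarrow> u * card {f \<in> A. P f} = (\<Sum>f\<in>A. if P f then u else 0)"
  for u :: nat
  by (simp add: sum.inter_filter[symmetric])

text \<open>With the orders outside the subtree fixed, \<open>E f\<close> is a single explorer and
  the coupling of the subtree applies to it; resampling averages over the outside.\<close>

lemma subtree_coupling:
  assumes c: "coupled_by u L (ch x a) y' \<Phi>" and a: "a < d"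
    and E: "\<And>f h. f \<in> orders d (Suc L) \<Longrightarrow> h \<in> orders d L \<Longrightarrow> E (upd f (port a f) h) = E f"
    and dp: "\<And>f. f \<in> orders d (Suc L) \<Longrightarrow> depth_le L (E f)"
  shows "u * card {f \<in> orders d (Suc L).
             differs (E f) (obs (ch x a) (sub f (port a f))) (obs y' (\<Phi> (sub f (port a f))))}
    \<le> (\<Sum>f\<in>orders d (Suc L). visits (E f) (obs (ch x a) (sub f (port a f))))"
  unfolding card_Collect_sum[OF finite_orders]
proof (rule resample_sum_le[where \<kappa> = "port a" and Y = "orders d L"])
  fix f assume f: "f \<in> orders d (Suc L)"
  have "(\<Sum>h\<in>orders d L. if differs (E f) (obs (ch x a) h) (obs y' (\<Phi> h)) then u else 0)
     \<le> (\<Sum>h\<in>orders d L. visits (E f) (obs (ch x a) h))"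
    using c dp[OF f] unfolding coupled_by_def card_Collect_sum[OF finite_orders] by blast
  then show "(\<Sum>h\<in>orders d L. if differs (E (upd f (port a f) h))
         (obs (ch x a) (sub (upd f (port a f) h) (port a (upd f (port a f) h))))
         (obs y' (\<Phi> (sub (upd f (port a f) h) (port a (upd f (port a f) h))))) then u else 0)
     \<le> (\<Sum>h\<in>orders d L. visits (E (upd f (port a f) h))
         (obs (ch x a) (sub (upd f (port a f) h) (port a (upd f (port a f) h)))))"
    using E[OF f] by (simp add: sub_upd cong: sum.cong_simp)
qed (auto simp: finite_orders orders_ne upd_orders sub_orders a port_props(1)[OF _ a])

lemma obs_port: "f \<in> orders d L \<Longrightarrow> a < d \<Longrightarrow>
    (\<lambda>q. obs x f (port a f # q)) = obs (ch x a) (sub f (port a f))"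
  by (auto simp: obs_Cons port_props)

lemma obs_upd: "f \<in> orders d L \<Longrightarrow> \<not> in_port (port a f) p \<Longrightarrow> obs x (upd f (port a f) h) p = obs x f p"
  by (cases p) (auto simp: obs_Cons sub_upd)

lemma restr_upd: "f \<in> orders d L \<Longrightarrow>
    restr (port a f) e (obs x (upd f (port a f) h)) = restr (port a f) e (obs x f)"
  by (rule restr_cong) (rule obs_upd)

text \<open>The explorer may depend on the order at the root, which lies outside every proper
  subtree. This freedom serves explorers capped at the ports of two given items.\<close>

lemma port_differs:
  assumes c: "coupled_by u L (ch x a) y' \<Phi>" and a: "a < d"
    and dp: "\<And>s. depth_le (Suc L) (e s)"
  shows "u * card {f \<in> orders d (Suc L).
             differs (restr (port a f) (e (f [])) (obs x f)) (\<lambda>q. obs x f (port a f # q))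
                (obs y' (\<Phi> (sub f (port a f))))}
    \<le> (\<Sum>f\<in>orders d (Suc L). port_visits (port a f) (e (f [])) (obs x f))"
proof -
  have "u * card {f \<in> orders d (Suc L).
             differs (restr (port a f) (e (f [])) (obs x f)) (obs (ch x a) (sub f (port a f)))
                (obs y' (\<Phi> (sub f (port a f))))}
    \<le> (\<Sum>f\<in>orders d (Suc L). visits (restr (port a f) (e (f [])) (obs x f)) (obs (ch x a) (sub f (port a f))))"
    by (rule subtree_coupling[OF c a]) (auto simp: restr_upd intro: depth_le_restr dp)
  moreover have "visits (restr (port a f) (e (f [])) (obs x f)) (obs (ch x a) (sub f (port a f)))
      = port_visits (port a f) (e (f [])) (obs x f)" if "f \<in> orders d (Suc L)" for f
    using visits_restr[of "port a f" "e (f [])" "obs x f"] obs_port[OF that a] by metis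
  moreover have "{f \<in> orders d (Suc L). differs (restr (port a f) (e (f [])) (obs x f)) (obs (ch x a) (sub f (port a f)))
                (obs y' (\<Phi> (sub f (port a f))))} = {f \<in> orders d (Suc L).
             differs (restr (port a f) (e (f [])) (obs x f)) (\<lambda>q. obs x f (port a f # q))
                (obs y' (\<Phi> (sub f (port a f))))}"
    using obs_port[OF _ a] by (auto; metis)
  ultimately show ?thesis by (simp cong: sum.cong_simp)
qed


text \<open>After the exchange the port of \<open>a\<close> leads to \<open>c\<close>, and the
  coupling makes the tree found there resemble the previous one. An explorer sees nearly the same
  tree although the two items have traded places.\<close>

definition swap :: "nat \<Rightarrow> nat \<Rightarrow> (port_orders \<Rightarrow> port_orders) \<Rightarrow> (port_orders \<Rightarrow> port_orders)
    \<Rightarrow> port_orders \<Rightarrow> port_orders" where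
  "swap a c \<Phi> \<Psi> = reorder (Transposition.transpose a c) (\<lambda>b. if b = a then \<Phi> else if b = c then \<Psi> else id)"

context
  fixes u L x a c \<Phi> \<Psi>
  assumes ac: "a < d" "c < d" "a \<noteq> c"
    and \<Phi>: "coupled_by u L (ch x a) (ch x c) \<Phi>" and \<Psi>: "coupled_by u L (ch x c) (ch x a) \<Psi>"
begin

lemma swap_bij: "bij_betw (swap a c \<Phi> \<Psi>) (orders d (Suc L)) (orders d (Suc L))"
  unfolding swap_def
  using coupled_by_bij[OF \<Phi>] coupled_by_bij[OF \<Psi>] ac
  by (intro reorder_bij permutes_swap_id) auto

lemma swap_port:
  assumes "f \<in> orders d (Suc L)"
  shows "port c (swap a c \<Phi> \<Psi> f) = port a f" "port a (swap a c \<Phi> \<Psi> f) = port c f"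
proof -
  have S: "swap a c \<Phi> \<Psi> f \<in> orders d (Suc L)" using bij_betwE[OF swap_bij] assms by blast
  show "port c (swap a c \<Phi> \<Psi> f) = port a f"
    by (rule port_eqI[OF S]) (simp add: swap_def port_props[OF assms] ac)
  show "port a (swap a c \<Phi> \<Psi> f) = port c f"
    by (rule port_eqI[OF S]) (simp add: swap_def port_props[OF assms] ac)
qed

lemma swap_obs:
  assumes f: "f \<in> orders d (Suc L)" and p: "\<not> in_port (port a f) p" "\<not> in_port (port c f) p"
  shows "obs x f p = obs x (swap a c \<Phi> \<Psi> f) p"
proof (cases p)
  case (Cons k q)
  show ?thesis
  proof (cases "k < d")
    case True
    have "f [] k \<noteq> a" "f [] k \<noteq> c" using p Cons port_eqI[OF f] by auto
    then show ?thesis using True Cons by (simp add: obs_Cons swap_def sub_reorder Transposition.transpose_def)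
  next
    case False
    then have "\<not> f [] k < d" "\<not> swap a c \<Phi> \<Psi> f [] k < d"
      using order_lt_iff f bij_betwE[OF swap_bij] by blast+
    then show ?thesis using Cons by (simp add: obs_Cons ch_ge obs_dead)
  qed
qed simp

lemma swap_obs_port:
  assumes f: "f \<in> orders d (Suc L)"
  shows "(\<lambda>q. obs x (swap a c \<Phi> \<Psi> f) (port a f # q)) = obs (ch x c) (\<Phi> (sub f (port a f)))"
    "(\<lambda>q. obs x (swap a c \<Phi> \<Psi> f) (port c f # q)) = obs (ch x a) (\<Psi> (sub f (port c f)))"
  using port_props[OF f] ac by (auto simp: obs_Cons swap_def sub_reorder)

lemma swap_differs:
  assumes dp: "\<And>s. depth_le (Suc L) (e s)"
  shows "u * card {f \<in> orders d (Suc L). differs (e (f [])) (obs x f) (obs x (swap a c \<Phi> \<Psi> f))}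
    \<le> (\<Sum>f\<in>orders d (Suc L). port_visits (port a f) (e (f [])) (obs x f))
      + (\<Sum>f\<in>orders d (Suc L). port_visits (port c f) (e (f [])) (obs x f))"
proof -
  let ?X = "orders d (Suc L)"
  define D where "D b \<theta> y = {f \<in> ?X. differs (restr (port b f) (e (f [])) (obs x f))
     (\<lambda>q. obs x f (port b f # q)) (obs (ch x y) (\<theta> (sub f (port b f))))}" for b \<theta> y
  have finite_D: "finite (D b \<theta> y)" for b \<theta> y
    by (simp add: D_def finite_orders)
  have "{f \<in> ?X. differs (e (f [])) (obs x f) (obs x (swap a c \<Phi> \<Psi> f))} \<subseteq> D a \<Phi> c \<union> D c \<Psi> a"
  proof clarify
    fix f assume f: "f \<in> ?X" "differs (e (f [])) (obs x f) (obs x (swap a c \<Phi> \<Psi> f))" "f \<notin> D c \<Psi> a"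
    obtain k where k: "differs (restr k (e (f [])) (obs x f)) (\<lambda>q. obs x f (k # q))
        (\<lambda>q. obs x (swap a c \<Phi> \<Psi> f) (k # q))"
      using differs_imp_restr[OF f(2)] by auto
    have "\<not> differs e' o1 o1" for e' :: "nat explorer" and o1 by (induction e') auto
    have "k = port a f \<or> k = port c f"
    proof (rule ccontr)
      assume n: "\<not> ?thesis"
      have "(\<lambda>q. obs x f (k # q)) = (\<lambda>q. obs x (swap a c \<Phi> \<Psi> f) (k # q))"
        by (rule ext, rule swap_obs[OF f(1)]) (use n in auto)
      then show False using k \<open>\<And>o1 e'. \<not> differs e' o1 o1\<close> by metis
    qed
    then show "f \<in> D a \<Phi> c"
    proof
      assume "k = port a f"
      from k[unfolded this swap_obs_port(1)[OF f(1)]] f(1) show ?thesis by (simp add: D_def)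
    next
      assume "k = port c f"
      from k[unfolded this swap_obs_port(2)[OF f(1)]] f(1,3) show ?thesis by (simp add: D_def)
    qed
  qed
  then have "card {f \<in> ?X. differs (e (f [])) (obs x f) (obs x (swap a c \<Phi> \<Psi> f))}
      \<le> card (D a \<Phi> c) + card (D c \<Psi> a)"
    using card_mono[OF finite_UnI[OF finite_D finite_D], of _ a \<Phi> c c \<Psi> a]
      card_Un_le[of "D a \<Phi> c" "D c \<Psi> a"] order_trans by blast
  then have "u * card {f \<in> ?X. differs (e (f [])) (obs x f) (obs x (swap a c \<Phi> \<Psi> f))}
      \<le> u * card (D a \<Phi> c) + u * card (D c \<Psi> a)"
    unfolding distrib_left[symmetric] by (rule mult_le_mono2)
  also have "\<dots> \<le> (\<Sum>f\<in>?X. port_visits (port a f) (e (f [])) (obs x f))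
      + (\<Sum>f\<in>?X. port_visits (port c f) (e (f [])) (obs x f))"
    unfolding D_def by (intro add_mono port_differs \<Phi> \<Psi> ac dp)
  finally show ?thesis .
qed

text \<open>Up to a constant, the subtrees of two hardly distinguishable items get equally many visits,
  as long as these are too few for telling the items apart.\<close>

lemma swap_visits:
  assumes dp: "depth_le (Suc L) e" and K: "K = 0 \<or> 2 * Suc K \<le> u" "1 \<le> u"
  shows "(\<Sum>f\<in>orders d (Suc L). min (port_visits (port a f) e (obs x f)) (Suc K))
    \<le> 5 * (\<Sum>f\<in>orders d (Suc L). min (port_visits (port c f) e (obs x f)) (Suc K))"
proof -
  let ?X = "orders d (Suc L)" and ?S = "swap a c \<Phi> \<Psi>"
  define e' where "e' s = cap2 (inv s a) (inv s c) e K" for s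
  have e': "e' (f []) = cap2 (port a f) (port c f) e K" for f by (simp add: e'_def port_def)
  define A where "A = (\<Sum>f\<in>?X. min (port_visits (port a f) e (obs x f)) (Suc K))"
  define C where "C = (\<Sum>f\<in>?X. min (port_visits (port c f) e (obs x f)) (Suc K))"
  define D where "D = {f \<in> ?X. differs (e' (f [])) (obs x f) (obs x (?S f))}"
  have ne: "port a f \<noteq> port c f" if "f \<in> ?X" for f using port_props[OF that] ac by metis
  have uD: "u * card D \<le> (\<Sum>f\<in>?X. port_visits (port a f) (e' (f [])) (obs x f))
      + (\<Sum>f\<in>?X. port_visits (port c f) (e' (f [])) (obs x f))"
    unfolding D_def by (rule swap_differs) (simp add: e'_def depth_le_cap2 dp)
  have le: "port_visits (port a f) (e' (f [])) (obs x f) \<le> min (port_visits (port a f) e (obs x f)) K"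
    "port_visits (port c f) (e' (f [])) (obs x f) \<le> min (port_visits (port c f) e (obs x f)) K"
    if "f \<in> ?X" for f
    using port_visits_cap2_cap[OF ne[OF that], of e K "obs x f"]
    by (auto simp: e' port_visits_cap2_le)
  \<comment> \<open>For \<open>K = 0\<close> the capped explorer never enters the two subtrees, so
    it cannot notice the exchange even if \<open>u\<close> is 1. Otherwise the factor 2 comes from
    \<open>2 * Suc K \<le> u\<close>.\<close>
  have D: "Suc K * card D * 2 \<le> A + C"
  proof (cases "K = 0")
    case True
    have "(\<Sum>f\<in>?X. port_visits (port a f) (e' (f [])) (obs x f)) = 0"
      "(\<Sum>f\<in>?X. port_visits (port c f) (e' (f [])) (obs x f)) = 0"
      using le True by fastforce+
    then have "card D = 0" using uD K(2) by simp
    then show ?thesis by simp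
  next
    case False
    have "Suc K * card D * 2 \<le> u * card D" using mult_le_mono1[of "2 * Suc K" u "card D"] K(1) False by (simp add: algebra_simps)
    also have "\<dots> \<le> (\<Sum>f\<in>?X. min (port_visits (port a f) e (obs x f)) (Suc K))
      + (\<Sum>f\<in>?X. min (port_visits (port c f) e (obs x f)) (Suc K))"
      using le by (intro order_trans[OF uD] add_mono sum_mono)
        (meson le_SucI min.boundedE min.boundedI)+
    finally show ?thesis by (simp add: A_def C_def)
  qed
  \<comment> \<open>By \<open>port_visits_swap\<close>, an unnoticed exchange turns visits at
    \<open>a\<close> into visits at \<open>c\<close> in the exchanged tree; a noticed one costs at
    most \<open>Suc K\<close>.\<close>
  have "A \<le> (\<Sum>f\<in>?X. min (port_visits (port c (?S f)) e (obs x (?S f))) (Suc K)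
      + min (port_visits (port c f) e (obs x f)) (Suc K) + (if f \<in> D then Suc K else 0))"
    unfolding A_def
  proof (rule sum_mono)
    fix f assume f: "f \<in> ?X"
    show "min (port_visits (port a f) e (obs x f)) (Suc K) \<le>
      min (port_visits (port c (?S f)) e (obs x (?S f))) (Suc K)
      + min (port_visits (port c f) e (obs x f)) (Suc K) + (if f \<in> D then Suc K else 0)"
    proof (cases "f \<in> D")
      case False
      then have "\<not> differs (cap2 (port a f) (port c f) e K) (obs x f) (obs x (?S f))"
        using f e' by (auto simp: D_def)
      from port_visits_swap[OF ne[OF f] swap_obs[OF f] this] show ?thesis
        by (auto simp: swap_port[OF f])
    qed simp
  qed
  also have "\<dots> = (\<Sum>f\<in>?X. min (port_visits (port c (?S f)) e (obs x (?S f))) (Suc K)) + C + Suc K * card D"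
    by (simp add: sum.distrib C_def D_def card_Collect_sum[OF finite_orders] cong: sum.cong_simp)
  also have "(\<Sum>f\<in>?X. min (port_visits (port c (?S f)) e (obs x (?S f))) (Suc K)) = C"
    unfolding C_def by (rule sum.reindex_bij_betw[OF swap_bij])
  finally have "A \<le> 2 * C + Suc K * card D" by simp
  \<comment> \<open>The failures contribute \<open>A\<close> on the right, which is absorbed on the
    left and leaves the constant 5.\<close>
  then have "2 * A \<le> 4 * C + (A + C)" using D by linarith
  then show ?thesis unfolding A_def C_def by simp
qed

end

end


text \<open>The items in \<open>B\<close> are coupled a factor z too weakly. Each is charged to the
  visits at all of \<open>G\<close>: summing \<open>bad\<close> over at least 60 z items gives 4 z ^
  (m + 1) D a \<le> S for the total S of these visits. The at most two items of \<open>B\<close>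
  thus take half of S, and the other half covers the failures in \<open>G\<close>, where the
  stronger coupling and z \<ge> 2 gain a factor 2.\<close>

lemma balance_visits:
  fixes N D :: "'a \<Rightarrow> nat"
  assumes "finite A" "B \<subseteq> A" "G \<subseteq> A - B" "card B \<le> 2" "60 * z \<le> s" "2 \<le> z"
    and G: "B \<noteq> {} \<Longrightarrow> s \<le> card G"
    and rest: "\<And>a. a \<in> A - B - G \<Longrightarrow> z ^ Suc m * D a \<le> N a"
    and good: "\<And>c. c \<in> G \<Longrightarrow> z ^ Suc (Suc m) * D c \<le> N c"
    and bad: "\<And>a c. a \<in> B \<Longrightarrow> c \<in> G \<Longrightarrow> z ^ m * D a \<le> 15 * N c"
  shows "z ^ Suc m * (\<Sum>a\<in>A. D a) \<le> (\<Sum>a\<in>A. N a)"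
proof -
  let ?u = "z ^ Suc m"
  have fin: "finite B" "finite G" using assms(1-3) finite_subset by blast+
  have split: "(\<Sum>a\<in>A. F a) = (\<Sum>a\<in>A - B - G. F a) + (\<Sum>a\<in>B. F a) + (\<Sum>a\<in>G. F a)" for F :: "'a \<Rightarrow> nat"
    using sum.subset_diff[of B A F] sum.subset_diff[of G "A - B" F] assms(1-3) by simp
  define S where "S = (\<Sum>c\<in>G. N c)"
  have "4 * (?u * D a) \<le> S" if a: "a \<in> B" for a
  proof -
    have "60 * z * (z ^ m * D a) \<le> card G * (z ^ m * D a)"
      using G a order_trans[OF assms(5)] by (intro mult_le_mono1) blast
    also have "\<dots> \<le> 15 * S"
      using sum_bounded_below[of G "z ^ m * D a" "\<lambda>c. 15 * N c"] bad[OF a]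
      by (simp add: S_def sum_distrib_left)
    finally show ?thesis by (simp add: ac_simps)
  qed
  then have "(\<Sum>a\<in>B. 4 * (?u * D a)) \<le> card B * S" by (metis sum_bounded_above of_nat_id)
  then have "(\<Sum>a\<in>B. 4 * (?u * D a)) \<le> 2 * S" using mult_le_mono1[OF assms(4)] order_trans by blast
  moreover have "(\<Sum>a\<in>B. 4 * (?u * D a)) = 4 * (?u * (\<Sum>a\<in>B. D a))" by (simp add: sum_distrib_left)
  ultimately have b: "2 * (?u * (\<Sum>a\<in>B. D a)) \<le> S" by linarith
  have "2 * (?u * (\<Sum>a\<in>G. D a)) \<le> z * (?u * (\<Sum>a\<in>G. D a))" using assms(6) by (rule mult_le_mono1)
  also have "\<dots> = (\<Sum>a\<in>G. z ^ Suc (Suc m) * D a)" unfolding sum_distrib_left by (intro sum.cong refl) simp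
  also have "\<dots> \<le> S" unfolding S_def by (intro sum_mono good)
  finally have g: "2 * (?u * (\<Sum>a\<in>G. D a)) \<le> S" .
  have "?u * (\<Sum>a\<in>A - B - G. D a) \<le> (\<Sum>a\<in>A - B - G. N a)"
    unfolding sum_distrib_left by (intro sum_mono rest)
  then show ?thesis using b g unfolding split[of D] split[of N] S_def distrib_left by linarith
qed

section \<open>Induction over the depth of the tree\<close>

lemma root_not_differs: "depth_le 0 e \<Longrightarrow> ob [] = ob' [] \<Longrightarrow> \<not> differs e ob ob'"
  by (induction e) auto

text \<open>\<open>R m\<close> is meant to give a coupling at strength z ^ m. In
  \<open>step\<close>, \<open>B\<close> collects the children that lose a level and \<open>G\<close>
  those that gain one; by the last condition a losing child resembles each gaining sibling at the
  lower level, which prevents it from attracting many more visits than they do. Evenness of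
  \<open>z\<close> lets its powers be halved exactly.\<close>

locale indistinguishability = tree_process +
  fixes z s :: nat and R :: "nat \<Rightarrow> 'a \<Rightarrow> 'a \<Rightarrow> bool"
  assumes z: "even z" "2 \<le> z" "60 * z \<le> s"
    and ar_eq: "R (Suc m) x y \<Longrightarrow> ar x = ar y"
    and step: "R (Suc m) x y \<Longrightarrow> \<exists>\<beta> B G. \<beta> permutes {..<d} \<and> B \<subseteq> {..<d} \<and> card B \<le> 2 \<and> G \<subseteq> {..<d} - B
      \<and> (B \<noteq> {} \<longrightarrow> s \<le> card G)
      \<and> (\<forall>a\<in>{..<d} - B. R (Suc m) (ch x a) (ch y (\<beta> a)))
      \<and> (\<forall>a\<in>B. R m (ch x a) (ch y (\<beta> a)))
      \<and> (\<forall>c\<in>G. R (Suc (Suc m)) (ch x c) (ch y (\<beta> c)))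
      \<and> (\<forall>a\<in>B. \<forall>c\<in>G. R m (ch x a) (ch x c) \<and> R m (ch x c) (ch x a))"
begin

text \<open>The induction on \<open>L\<close> treats all \<open>m\<close> at once, because children
  may be coupled at a higher level than their parents. Level 0 is free: any difference takes at
  least one visit.\<close>

theorem indistinguishable: "m = 0 \<or> R m x y \<Longrightarrow> \<exists>\<Phi>. coupled_by (z ^ m) L x y \<Phi>"
proof (induction L arbitrary: m x y)
  have triv: "coupled_by (z ^ 0) L x y id" for L x y
  proof -
    show ?thesis
      unfolding coupled_by_def card_Collect_sum[OF finite_orders]
      using differs_visits by (force intro!: sum_mono)
  qed
  {
    case 0
    show ?case
    proof (cases m)
      case (Suc n)
      then have "ar x = ar y" using 0 ar_eq by auto
      then have "coupled_by (z ^ m) 0 x y id"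
        using root_not_differs unfolding coupled_by_def by fastforce
      then show ?thesis by blast
    qed (use triv in auto)
  next
    case (Suc L)
    show ?case
    proof (cases m)
      case 0 then show ?thesis using triv by auto
    next
      case m: (Suc n)
      with Suc.prems have R: "R (Suc n) x y" by auto
      obtain \<beta> B G where \<beta>: "\<beta> permutes {..<d}" and B: "B \<subseteq> {..<d}" "card B \<le> 2" and G: "G \<subseteq> {..<d} - B"
        and s: "B \<noteq> {} \<Longrightarrow> s \<le> card G"
        and rest: "\<forall>a\<in>{..<d} - B. R (Suc n) (ch x a) (ch y (\<beta> a))"
        and bad: "\<forall>a\<in>B. R n (ch x a) (ch y (\<beta> a))"
        and good: "\<forall>c\<in>G. R (Suc (Suc n)) (ch x c) (ch y (\<beta> c))"
        and cross: "\<forall>a\<in>B. \<forall>c\<in>G. R n (ch x a) (ch x c) \<and> R n (ch x c) (ch x a)"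
        using step[OF R] by metis
      define \<mu> where "\<mu> a = (if a \<in> B then n else if a \<in> G then Suc (Suc n) else Suc n)" for a
      have "\<exists>\<Phi>. coupled_by (z ^ \<mu> a) L (ch x a) (ch y (\<beta> a)) \<Phi>" if "a < d" for a
        by (rule Suc.IH) (use that rest bad good in \<open>auto simp: \<mu>_def\<close>)
      then obtain \<Phi> where \<Phi>: "\<And>a. a < d \<Longrightarrow> coupled_by (z ^ \<mu> a) L (ch x a) (ch y (\<beta> a)) (\<Phi> a)"
        by metis
      let ?X = "orders d (Suc L)" and ?F = "reorder \<beta> \<Phi>"
      have bij: "bij_betw ?F ?X ?X" by (rule reorder_bij[OF \<beta> coupled_by_bij[OF \<Phi>]])
      have "z ^ Suc n * card {f \<in> ?X. differs e (obs x f) (obs y (?F f))} \<le> (\<Sum>f\<in>?X. visits e (obs x f))"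
        if e: "depth_le (Suc L) e" for e
      proof -
        define D where "D a = {f \<in> ?X. differs (restr (port a f) e (obs x f)) (\<lambda>q. obs x f (port a f # q))
          (obs (ch y (\<beta> a)) (\<Phi> a (sub f (port a f))))}" for a
        define N where "N a = (\<Sum>f\<in>?X. port_visits (port a f) e (obs x f))" for a
        have "{f \<in> ?X. differs e (obs x f) (obs y (?F f))} \<subseteq> (\<Union>a<d. D a)"
        proof clarify
          fix f assume f: "f \<in> ?X" "differs e (obs x f) (obs y (?F f))"
          obtain k where k: "differs (restr k e (obs x f)) (\<lambda>q. obs x f (k # q)) (\<lambda>q. obs y (?F f) (k # q))"
            using differs_imp_restr[OF f(2)] ar_eq[OF R] by auto
          have "k < d"
          proof (rule ccontr)
            assume "\<not> k < d"
            then have "\<not> f [] k < d" "\<not> ?F f [] k < d"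
              using order_lt_iff f(1) bij_betwE[OF bij] by blast+
            then have "(\<lambda>q. obs x f (k # q)) = (\<lambda>q. obs y (?F f) (k # q))"
              by (simp add: obs_Cons ch_ge obs_dead)
            moreover have "\<not> differs e' o1 o1" for e' :: "nat explorer" and o1 by (induction e') auto
            ultimately show False using k by metis
          qed
          define a where "a = f [] k"
          have a: "a < d" "port a f = k" using \<open>k < d\<close> order_lt_iff[OF f(1)] port_eqI[OF f(1)]
            by (auto simp: a_def)
          have "(\<lambda>q. obs y (?F f) (k # q)) = obs (ch y (\<beta> a)) (\<Phi> a (sub f k))"
            using \<open>k < d\<close> by (auto simp: obs_Cons sub_reorder a_def)
          from k[unfolded this] have "f \<in> D a" using f(1) a(2) by (simp add: D_def)
          then show "f \<in> (\<Union>a<d. D a)" using a by blast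
        qed
        then have "card {f \<in> ?X. differs e (obs x f) (obs y (?F f))} \<le> card (\<Union>a<d. D a)"
          by (intro card_mono) (auto simp: D_def finite_orders)
        also have "\<dots> \<le> (\<Sum>a<d. card (D a))" by (rule card_UN_le) simp
        finally have le: "card {f \<in> ?X. differs e (obs x f) (obs y (?F f))} \<le> (\<Sum>a<d. card (D a))" .
        have pd: "z ^ \<mu> a * card (D a) \<le> N a" if "a < d" for a
          using port_differs[OF \<Phi>[OF that] that, of "\<lambda>_. e"] e by (simp add: D_def N_def)
        \<comment> \<open>The constant is 3 * 5. Failures within \<open>Suc K\<close> visits cost
          the capped visits at \<open>a\<close> once, runs with more visits cost them twice, and the
          capped visits at \<open>a\<close> are at most 5 times those at \<open>c\<close>.\<close>
        have "z ^ n * card (D a) \<le> 15 * N c" if a: "a \<in> B" and c: "c \<in> G" for a c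
        proof -
          let ?u = "z ^ n"
          define K where "K = ?u div 2 - 1"
          have u: "1 \<le> ?u" "?u \<le> 2 * Suc K" "K = 0 \<or> 2 * Suc K \<le> ?u"
            using z by (cases n; auto simp: K_def)+
          have ac: "a < d" "c < d" "a \<noteq> c" using a c B G by auto
          have "\<exists>\<Phi>. coupled_by ?u L (ch x a) (ch x c) \<Phi>" "\<exists>\<Phi>. coupled_by ?u L (ch x c) (ch x a) \<Phi>"
            using Suc.IH cross a c by blast+
          then obtain \<Phi>1 \<Phi>2 where "coupled_by ?u L (ch x a) (ch x c) \<Phi>1" "coupled_by ?u L (ch x c) (ch x a) \<Phi>2"
            by blast
          from swap_visits[OF ac this e u(3,1)]
          have M: "(\<Sum>f\<in>?X. min (port_visits (port a f) e (obs x f)) (Suc K)) \<le> 5 * N c"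
            by (rule order_trans) (auto simp: N_def intro!: sum_mono)
          let ?M = "\<Sum>f\<in>?X. min (port_visits (port a f) e (obs x f)) (Suc K)"
          let ?r = "\<lambda>f. restr (port a f) e (obs x f)"
          define D1 where "D1 = {f \<in> ?X. differs (cap (Suc K) (?r f)) (obs (ch x a) (sub f (port a f)))
             (obs (ch y (\<beta> a)) (\<Phi> a (sub f (port a f))))}"
          define D2 where "D2 = {f \<in> ?X. Suc K \<le> port_visits (port a f) e (obs x f)}"
          have v: "visits (?r f) (obs (ch x a) (sub f (port a f))) = port_visits (port a f) e (obs x f)"
            if "f \<in> ?X" for f using visits_restr[of "port a f" e "obs x f"] obs_port[OF that ac(1)] by metis
          have "D a \<subseteq> D1 \<union> D2"
          proof
            fix f assume "f \<in> D a"
            then have f: "f \<in> ?X" and df: "differs (?r f) (obs (ch x a) (sub f (port a f)))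
               (obs (ch y (\<beta> a)) (\<Phi> a (sub f (port a f))))"
              using obs_port[OF _ ac(1)] by (auto simp: D_def)
            from differs_cap[OF df, of "Suc K"] v[OF f] f show "f \<in> D1 \<union> D2"
              by (auto simp: D1_def D2_def)
          qed
          then have "card (D a) \<le> card D1 + card D2"
            by (intro order_trans[OF card_mono card_Un_le]) (auto simp: D1_def D2_def finite_orders)
          then have "?u * card (D a) \<le> ?u * card D1 + ?u * card D2"
            unfolding distrib_left[symmetric] by (rule mult_le_mono2)
          also have "?u * card D1 \<le> ?M"
          proof -
            have "coupled_by ?u L (ch x a) (ch y (\<beta> a)) (\<Phi> a)" using \<Phi>[OF ac(1)] a by (simp add: \<mu>_def)
            from subtree_coupling[OF this ac(1), of "\<lambda>f. cap (Suc K) (?r f)"]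
            have "?u * card D1 \<le> (\<Sum>f\<in>?X. visits (cap (Suc K) (?r f)) (obs (ch x a) (sub f (port a f))))"
              unfolding D1_def using e by (simp add: restr_upd depth_le_cap depth_le_restr)
            also have "\<dots> = ?M" by (intro sum.cong refl) (simp add: visits_cap v)
            finally show ?thesis .
          qed
          also have "?u * card D2 \<le> 2 * ?M"
          proof -
            \<comment> \<open>Markov's inequality for the capped number of visits.\<close>
            have "Suc K * card D2 \<le> ?M" unfolding D2_def card_Collect_sum[OF finite_orders]
              by (intro sum_mono) auto
            moreover have "?u * card D2 \<le> 2 * Suc K * card D2" using u(2) by (rule mult_le_mono1)
            ultimately show ?thesis by simp
          qed
          finally show ?thesis using M by simp
        qed
        moreover have r: "z ^ Suc n * card (D a) \<le> N a" if "a \<in> {..<d} - B - G" for a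
          using pd[of a] that by (simp add: \<mu>_def)
        moreover have g: "z ^ Suc (Suc n) * card (D c) \<le> N c" if "c \<in> G" for c
        proof -
          have "c < d" "c \<notin> B" using that G by auto
          then show ?thesis using pd[of c] that by (simp add: \<mu>_def)
        qed
        ultimately have "z ^ Suc n * (\<Sum>a<d. card (D a)) \<le> (\<Sum>a<d. N a)"
          by (intro balance_visits[OF _ B(1) G B(2) z(3,2) s r g]) auto
        also have "\<dots> = (\<Sum>f\<in>?X. \<Sum>a<d. port_visits (port a f) e (obs x f))"
          unfolding N_def by (rule sum.swap)
        \<comment> \<open>Each port belongs to exactly one item, so summing over items is summing
          over ports.\<close>
        also have "\<dots> \<le> (\<Sum>f\<in>?X. visits e (obs x f))"
        proof (rule sum_mono)
          fix f assume "f \<in> ?X"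
          then have "bij_betw (\<lambda>a. port a f) {..<d} {..<d}"
            unfolding port_def by (intro permutes_imp_bij permutes_inv orders_permutes)
          from sum.reindex_bij_betw[OF this, of "\<lambda>k. port_visits k e (obs x f)"]
          show "(\<Sum>a<d. port_visits (port a f) e (obs x f)) \<le> visits e (obs x f)"
            using sum_port_visits_le[of "{..<d}"] by simp
        qed
        finally show ?thesis using le mult_le_mono2 order_trans by blast
      qed
      then show ?thesis using bij m unfolding coupled_by_def by blast
    qed
  }
qed

text \<open>Exchanging \<open>a\<close> with some \<open>c\<close> in \<open>G\<close> goes
  unnoticed except with probability V / z ^ m, so an answer names \<open>a\<close> hardly more often
  than \<open>c\<close>. No answer names the ports of two items, which leaves probability at most 1
  / card G + V / z ^ m for naming \<open>a\<close>.\<close>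

theorem guess_item:
  fixes t :: "nat option \<Rightarrow> nat"
  assumes a: "a < d" and G: "G \<subseteq> {..<d} - {a}"
    and R: "\<And>c. c \<in> G \<Longrightarrow> R m (ch x a) (ch x c) \<and> R m (ch x c) (ch x a)"
    and e: "depth_le (Suc L) e" and V: "\<And>ob. visits e ob \<le> V"
  shows "z ^ m * card G * card {f \<in> orders d (Suc L). t (result e (obs x f)) = port a f}
    \<le> (z ^ m + card G * V) * card (orders d (Suc L))"
proof -
  let ?X = "orders d (Suc L)"
  define H where "H c = {f \<in> ?X. t (result e (obs x f)) = port c f}" for c
  have one: "z ^ m * card (H a) \<le> z ^ m * card (H c) + V * card ?X" if c: "c \<in> G" for c
  proof -
    have ac: "a < d" "c < d" "a \<noteq> c" using a c G by auto
    obtain \<Phi> \<Psi> where "coupled_by (z ^ m) L (ch x a) (ch x c) \<Phi>" "coupled_by (z ^ m) L (ch x c) (ch x a) \<Psi>"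
      using indistinguishable R[OF c] by meson
    note sw = this
    let ?S = "swap a c \<Phi> \<Psi>"
    define D where "D = {f \<in> ?X. differs e (obs x f) (obs x (?S f))}"
    have "z ^ m * card D \<le> (\<Sum>f\<in>?X. port_visits (port a f) e (obs x f))
      + (\<Sum>f\<in>?X. port_visits (port c f) e (obs x f))"
      unfolding D_def by (rule swap_differs[OF ac sw, of "\<lambda>_. e"]) (rule e)
    also have "\<dots> \<le> (\<Sum>f\<in>?X. V)"
      unfolding sum.distrib[symmetric]
    proof (rule sum_mono)
      fix f assume "f \<in> ?X"
      then have "port a f \<noteq> port c f" using port_props ac by metis
      then show "port_visits (port a f) e (obs x f) + port_visits (port c f) e (obs x f) \<le> V"
        using sum_port_visits_le[of "{port a f, port c f}" e "obs x f"] V[of "obs x f"] by simp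
    qed
    finally have D: "z ^ m * card D \<le> V * card ?X" by (simp add: mult.commute)
    \<comment> \<open>If the exchange is not noticed, the answer stays the same while the port it
      names has passed to \<open>c\<close>.\<close>
    have "H a \<subseteq> {f \<in> ?X. ?S f \<in> H c} \<union> D"
      using swap_port[OF ac sw] bij_betwE[OF swap_bij[OF ac sw]] result_eq[of e]
      by (auto simp: H_def D_def)
    then have "card (H a) \<le> card {f \<in> ?X. ?S f \<in> H c} + card D"
      by (intro order_trans[OF card_mono card_Un_le]) (auto simp: D_def finite_orders)
    also have "card {f \<in> ?X. ?S f \<in> H c} \<le> card (H c)"
      using bij_betw_imp_inj_on[OF swap_bij[OF ac sw]]
      by (intro card_inj_on_le[of ?S]) (auto simp: H_def finite_orders inj_on_def)
    finally have "z ^ m * card (H a) \<le> z ^ m * (card (H c) + card D)" by simp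
    then show ?thesis using D by (simp add: distrib_left)
  qed
  have "card G * (z ^ m * card (H a)) \<le> (\<Sum>c\<in>G. z ^ m * card (H c) + V * card ?X)"
    using sum_bounded_below[of G "z ^ m * card (H a)" "\<lambda>c. z ^ m * card (H c) + V * card ?X"] one
    by simp
  also have "\<dots> = z ^ m * (\<Sum>c\<in>G. card (H c)) + card G * V * card ?X"
    by (simp add: sum.distrib sum_distrib_left)
  also have "(\<Sum>c\<in>G. card (H c)) = card (\<Union>c\<in>G. H c)"
  proof (rule card_UN_disjoint[symmetric])
    show "finite G" using G finite_subset by blast
    show "\<forall>c\<in>G. finite (H c)" by (simp add: H_def finite_orders)
    show "\<forall>c\<in>G. \<forall>c'\<in>G. c \<noteq> c' \<longrightarrow> H c \<inter> H c' = {}"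
    proof (intro ballI impI)
      fix c c' assume c: "c \<in> G" "c' \<in> G" "c \<noteq> c'"
      have "c = c'" if "f \<in> ?X" "port c f = port c' f" for f
        using port_props(2)[OF that(1), of c] port_props(2)[OF that(1), of c'] c G that(2) by auto
      then show "H c \<inter> H c' = {}" using c unfolding H_def by fastforce
    qed
  qed
  also have "\<dots> \<le> card ?X" by (rule card_mono) (auto simp: H_def finite_orders)
  finally have "card G * (z ^ m * card (H a)) \<le> z ^ m * card ?X + card G * V * card ?X" by simp
  then show ?thesis unfolding H_def distrib_right by (simp only: ac_simps)
qed

end

subsection \<open>Universal covers of multigraphs\<close>

text \<open>An item of a vertex is an incident edge, given by its other end and its number among the
  parallel edges.  A state of the tree process is a vertex together with the item leading back to its
  parent; the child at the back item is dead, as a walk should not turn around there.\<close>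

locale multigraph =
  fixes Bs :: "'b set" and mult :: "'b \<Rightarrow> 'b \<Rightarrow> nat" and d :: nat
  assumes finite_Bs: "finite Bs" and mult_sym: "mult b c = mult c b" and d2: "2 \<le> d"
    and deg_cases: "b \<in> Bs \<Longrightarrow> card (Sigma Bs (\<lambda>c. {..<mult b c})) = 1 \<or> card (Sigma Bs (\<lambda>c. {..<mult b c})) = d"
begin

definition items :: "'b \<Rightarrow> ('b \<times> nat) set" where
  "items b = Sigma Bs (\<lambda>c. {..<mult b c})"

definition deg :: "'b \<Rightarrow> nat" where "deg b = card (items b)"

definition num :: "'b \<Rightarrow> nat \<Rightarrow> 'b \<times> nat" where
  "num b = (SOME f. bij_betw f {..<deg b} (items b))"

text \<open>A vertex of degree 1 shows its only item at all \<open>d\<close> positions, so that the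
  orders permute the same set at every node. Explorers are later confined to ports below the
  observed degree.\<close>

definition item :: "'b \<Rightarrow> nat \<Rightarrow> 'b \<times> nat" where
  "item b a = num b (if deg b = d then a else 0)"

primrec ch :: "('b \<times> ('b \<times> nat) option) option \<Rightarrow> nat \<Rightarrow> ('b \<times> ('b \<times> nat) option) option" where
  "ch None a = None"
| "ch (Some st) a = (if d \<le> a \<or> snd st = Some (item (fst st) a) then None
     else Some (fst (item (fst st) a), Some (fst st, snd (item (fst st) a))))"

primrec ar :: "('b \<times> ('b \<times> nat) option) option \<Rightarrow> nat" where
  "ar None = 0"
| "ar (Some st) = deg (fst st)"

sublocale tree_process d ch ar None
proof
  show "ch x k = None" if "d \<le> k" for x k using that by (cases x) auto
qed simp

lemma finite_items: "finite (items b)"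
  by (auto simp: items_def finite_Bs)

lemma deg_cases': "b \<in> Bs \<Longrightarrow> deg b = 1 \<or> deg b = d"
  using deg_cases by (simp add: deg_def items_def)

lemma num_bij: "bij_betw (num b) {..<deg b} (items b)"
  using someI_ex[OF ex_bij_betw_nat_finite[OF finite_items, of b]]
  by (simp add: num_def deg_def atLeast0LessThan)

lemma item_in: "b \<in> Bs \<Longrightarrow> a < d \<Longrightarrow> item b a \<in> items b"
  using bij_betwE[OF num_bij, of b] deg_cases'[of b] d2 by (auto simp: item_def)

lemma item_bij: "deg b = d \<Longrightarrow> bij_betw (item b) {..<d} (items b)"
  using num_bij[of b] by (simp add: item_def[abs_def])

lemma item_leaf: "deg b = 1 \<Longrightarrow> item b a = item b 0"
  using d2 by (simp add: item_def)

lemma items_sym: "b \<in> Bs \<Longrightarrow> (c, r) \<in> items b \<Longrightarrow> c \<in> Bs \<and> (b, r) \<in> items c"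
  by (auto simp: items_def mult_sym)

lemma ch_Some: "a < d \<Longrightarrow> bk \<noteq> Some (item b a) \<Longrightarrow>
    ch (Some (b, bk)) a = Some (fst (item b a), Some (b, snd (item b a)))"
  by simp

lemma ch_back: "bk = Some (item b a) \<Longrightarrow> ch (Some (b, bk)) a = None"
  by simp

end

text \<open>Match the colour classes bijectively, then correct the image of \<open>a0\<close> by a
  transposition inside one class.\<close>

lemma recolouring:
  fixes \<kappa> \<kappa>' :: "nat \<Rightarrow> 'k"
  assumes c: "\<And>k. card {a. a < d \<and> \<kappa> a = k} = card {a. a < d \<and> \<kappa>' a = k}"
    and a: "a0 < d" "a0' < d" "\<kappa> a0 = \<kappa>' a0'"
  obtains \<beta> where "\<beta> permutes {..<d}" "\<And>a. a < d \<Longrightarrow> \<kappa>' (\<beta> a) = \<kappa> a" "\<beta> a0 = a0'"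
proof -
  have "\<exists>g. bij_betw g {a. a < d \<and> \<kappa> a = k} {a. a < d \<and> \<kappa>' a = k}" for k
    using c by (intro finite_same_card_bij) auto
  then obtain g where g: "\<And>k. bij_betw (g k) {a. a < d \<and> \<kappa> a = k} {a. a < d \<and> \<kappa>' a = k}" by metis
  define \<gamma> where "\<gamma> a = (if a < d then g (\<kappa> a) a else a)" for a
  have \<gamma>: "\<gamma> a < d \<and> \<kappa>' (\<gamma> a) = \<kappa> a" if "a < d" for a
    using bij_betwE[OF g[of "\<kappa> a"]] that by (auto simp: \<gamma>_def)
  have "inj_on \<gamma> {..<d}"
  proof (rule inj_onI)
    fix a b assume ab: "a \<in> {..<d}" "b \<in> {..<d}" "\<gamma> a = \<gamma> b"
    then have "\<kappa> a = \<kappa> b" using \<gamma> by (metis lessThan_iff)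
    then show "a = b" using ab g[of "\<kappa> a"] by (auto simp: \<gamma>_def bij_betw_def inj_on_def)
  qed
  moreover have "\<gamma> ` {..<d} = {..<d}"
    using \<gamma> by (intro endo_inj_surj calculation) auto
  ultimately have p: "\<gamma> permutes {..<d}"
    by (intro bij_imp_permutes) (auto simp: bij_betw_def \<gamma>_def)
  define \<beta> where "\<beta> = Transposition.transpose (\<gamma> a0) a0' \<circ> \<gamma>"
  have "\<beta> permutes {..<d}"
    unfolding \<beta>_def using \<gamma>[OF a(1)] a(2) by (intro permutes_compose[OF p] permutes_swap_id) simp_all
  moreover have "\<kappa>' (\<beta> b) = \<kappa> b" if "b < d" for b
  proof -
    have "\<kappa>' (Transposition.transpose (\<gamma> a0) a0' y) = \<kappa>' y" for y
      using \<gamma>[OF a(1)] a(3) unfolding Transposition.transpose_def by metis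
    then show ?thesis using \<gamma>[OF that] by (simp add: \<beta>_def)
  qed
  moreover have "\<beta> a0 = a0'" by (simp add: \<beta>_def)
  ultimately show ?thesis by (rule that)
qed

subsection \<open>The gadget\<close>

datatype vertex = U nat nat | W nat nat | C nat

text \<open>The bundles of size d - 1 - j s and the loops at \<open>C i\<close> pad the degrees to
  \<open>d\<close> everywhere except at the leaves \<open>U 0 x\<close>. The single edges from
  \<open>U j x\<close> to \<open>W (j + 1) x\<close> and the loops at \<open>U h x\<close> are the
  edges of the intended large matching. Every vertex of depth above i has exactly \<open>s\<close>
  edges to \<open>C i\<close>.\<close>

fun edges :: "nat \<Rightarrow> nat \<Rightarrow> nat \<Rightarrow> nat \<Rightarrow> vertex \<Rightarrow> vertex \<Rightarrow> nat" where
  "edges h N s d (U j x) (U i y) = (if x = y \<and> i = h \<and> j = h then 1 else 0)"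
| "edges h N s d (U j x) (W i y) =
     (if x = y then if i = j then d - 1 - j * s else if i = Suc j then 1 else 0 else 0)"
| "edges h N s d (W i y) (U j x) =
     (if x = y then if i = j then d - 1 - j * s else if i = Suc j then 1 else 0 else 0)"
| "edges h N s d (W i y) (W j x) = 0"
| "edges h N s d (U j x) (C i) = (if i < j then s else 0)"
| "edges h N s d (C i) (U j x) = (if i < j then s else 0)"
| "edges h N s d (W j x) (C i) = (if i < j then s else 0)"
| "edges h N s d (C i) (W j x) = (if i < j then s else 0)"
| "edges h N s d (C i) (C j) = (if i \<noteq> j then s else d - (2 * ((h - i) * N) * s + (h - 1) * s))"

fun depth :: "vertex \<Rightarrow> nat" where
  "depth (U j x) = j" | "depth (W j x) = j" | "depth (C i) = i"

definition gadget_vertices :: "nat \<Rightarrow> nat \<Rightarrow> vertex set" where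
  "gadget_vertices h N = (\<lambda>(j, x). U j x) ` ({..h} \<times> {..<N}) \<union> (\<lambda>(j, x). W j x) ` ({1..h} \<times> {..<N})
     \<union> C ` {..<h}"

lemma sum_gadget:
  "(\<Sum>b\<in>gadget_vertices h N. F b) = (\<Sum>j\<le>h. \<Sum>x<N. F (U j x)) + (\<Sum>j=1..h. \<Sum>x<N. F (W j x)) + (\<Sum>i<h. F (C i))"
  for F :: "vertex \<Rightarrow> nat"
proof -
  have "(\<Sum>b\<in>gadget_vertices h N. F b) = (\<Sum>b\<in>(\<lambda>(j, x). U j x) ` ({..h} \<times> {..<N}). F b)
    + (\<Sum>b\<in>(\<lambda>(j, x). W j x) ` ({1..h} \<times> {..<N}). F b) + (\<Sum>b\<in>C ` {..<h}. F b)"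
    unfolding gadget_vertices_def by (subst sum.union_disjoint; auto)+
  moreover have "(\<Sum>b\<in>(\<lambda>(j, x). U j x) ` ({..h} \<times> {..<N}). F b) = (\<Sum>j\<le>h. \<Sum>x<N. F (U j x))"
    by (subst sum.reindex) (auto simp: inj_on_def sum.cartesian_product intro!: sum.cong)
  moreover have "(\<Sum>b\<in>(\<lambda>(j, x). W j x) ` ({1..h} \<times> {..<N}). F b) = (\<Sum>j=1..h. \<Sum>x<N. F (W j x))"
    by (subst sum.reindex) (auto simp: inj_on_def sum.cartesian_product intro!: sum.cong)
  moreover have "(\<Sum>b\<in>C ` {..<h}. F b) = (\<Sum>i<h. F (C i))"
    by (subst sum.reindex) (auto simp: inj_on_def)
  ultimately show ?thesis by simp
qed

locale gadget =
  fixes h N s d :: nat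
  assumes h1: "1 \<le> h" and N1: "1 \<le> N" and s1: "1 \<le> s" and d: "(2 * h * N + h) * s < d"
begin

abbreviation "Bs \<equiv> gadget_vertices h N"
abbreviation "mlt \<equiv> edges h N s d"

lemma hs: "j \<le> h \<Longrightarrow> j * s \<le> d - 1"
proof -
  assume "j \<le> h"
  then have "j * s \<le> (2 * h * N + h) * s" by (intro mult_le_mono1) simp
  then show ?thesis using d by linarith
qed

lemma degree_sum:
  assumes "b \<in> Bs"
  shows "(\<Sum>c\<in>Bs. mlt b c) = (if depth b = 0 \<and> b \<noteq> C 0 then 1 else d)"
proof -
  have delta: "(\<Sum>j\<in>A. if j = k then F j else 0) = (if k \<in> A then F k else 0)"
    if "finite A" for A and k and F :: "nat \<Rightarrow> nat" using that by (simp add: sum.delta)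
  have below: "(\<Sum>i<h. if i < j then s else 0) = j * s" if "j \<le> h" for j
  proof -
    have "(\<Sum>i<h. if i < j then s else 0) = (\<Sum>i\<in>{i \<in> {..<h}. i < j}. s)"
      by (rule sum.inter_filter[symmetric]) simp
    also have "{i \<in> {..<h}. i < j} = {..<j}" using that by auto
    finally show ?thesis by simp
  qed
  consider (U) j x where "b = U j x" "j \<le> h" "x < N" | (W) j x where "b = W j x" "1 \<le> j" "j \<le> h" "x < N"
    | (C) i where "b = C i" "i < h" using assms by (auto simp: gadget_vertices_def)
  then show ?thesis
  proof cases
    case U
    have 1: "(\<Sum>i\<le>h. \<Sum>y<N. mlt b (U i y)) = (if j = h then 1 else 0)"
    proof -
      have "(\<Sum>y<N. mlt b (U i y)) = (if i = h then if j = h then 1 else 0 else 0)" for i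
        using U(3) by (auto simp: U(1) sum.delta if_distrib cong: if_cong)
      then show ?thesis by (simp add: sum.delta)
    qed
    have 2: "(\<Sum>i=1..h. \<Sum>y<N. mlt b (W i y)) = (if 1 \<le> j then d - 1 - j * s else 0) + (if j < h then 1 else 0)"
    proof -
      have "(\<Sum>y<N. mlt b (W i y)) = (if i = j then d - 1 - j * s else 0) + (if i = Suc j then 1 else 0)" for i
      proof -
        have "(\<Sum>y<N. mlt b (W i y)) = (\<Sum>y<N. if y = x then mlt b (W i x) else 0)"
          by (intro sum.cong) (auto simp: U(1))
        also have "\<dots> = mlt b (W i x)" using U(3) by (simp add: sum.delta)
        finally show ?thesis by (simp add: U(1))
      qed
      then show ?thesis using U(2) by (simp add: sum.distrib sum.delta Suc_le_eq)
    qed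
    have 3: "(\<Sum>i<h. mlt b (C i)) = j * s" using below[OF U(2)] by (simp add: U(1))
    show ?thesis unfolding sum_gadget 1 2 3 using U hs[OF U(2)] d h1 by auto
  next
    case W
    have 1: "(\<Sum>i\<le>h. \<Sum>y<N. mlt b (U i y)) = d - 1 - j * s + 1"
    proof -
      have "(\<Sum>y<N. mlt b (U i y)) = (if i = j then d - 1 - j * s else 0) + (if i = j - 1 then 1 else 0)" for i
      proof -
        have "(\<Sum>y<N. mlt b (U i y)) = (\<Sum>y<N. if y = x then mlt b (U i x) else 0)"
          by (intro sum.cong) (auto simp: W(1))
        also have "\<dots> = mlt b (U i x)" using W(4) by (simp add: sum.delta)
        finally show ?thesis using W(2) by (auto simp: W(1))
      qed
      moreover have "j - 1 \<le> h" using W by simp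
      ultimately show ?thesis using W(3) by (simp add: sum.distrib sum.delta)
    qed
    have 2: "(\<Sum>i=1..h. \<Sum>y<N. mlt b (W i y)) = 0" by (simp add: W(1))
    have 3: "(\<Sum>i<h. mlt b (C i)) = j * s" using below[OF W(3)] by (simp add: W(1))
    show ?thesis unfolding sum_gadget 1 2 3 using W hs[OF W(3)] d by auto
  next
    case C
    have above: "(\<Sum>j\<in>A. if i < j then s * N else 0) = (h - i) * N * s" if "A = {..h} \<or> A = {1..h}" for A
    proof -
      have "(\<Sum>j\<in>A. if i < j then s * N else 0) = (\<Sum>j\<in>{j \<in> A. i < j}. s * N)"
        using that by (intro sum.inter_filter[symmetric]) auto
      also have "{j \<in> A. i < j} = {i<..h}" using that C by auto
      finally show ?thesis by simp
    qed
    have 1: "(\<Sum>j\<le>h. \<Sum>y<N. mlt b (U j y)) = (h - i) * N * s"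
      using above[of "{..h}"] by (simp add: C(1) if_distrib mult.commute cong: if_cong)
    have 2: "(\<Sum>j=1..h. \<Sum>y<N. mlt b (W j y)) = (h - i) * N * s"
      using above[of "{1..h}"] by (simp add: C(1) if_distrib mult.commute cong: if_cong)
    have 3: "(\<Sum>j<h. mlt b (C j)) = (h - 1) * s + mlt b (C i)"
    proof -
      have "(\<Sum>j<h. mlt b (C j)) = (\<Sum>j\<in>{..<h} - {i}. mlt b (C j)) + mlt b (C i)"
        using C(2) by (subst sum.remove[of _ i]) auto
      also have "(\<Sum>j\<in>{..<h} - {i}. mlt b (C j)) = (\<Sum>j\<in>{..<h} - {i}. s)"
        by (intro sum.cong) (auto simp: C(1))
      finally show ?thesis using C(2) by simp
    qed
    have "2 * ((h - i) * N) * s + (h - 1) * s \<le> (2 * h * N + h) * s"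
      unfolding distrib_right[symmetric] by (intro mult_le_mono1 add_mono) (auto simp: mult.assoc)
    then have "2 * ((h - i) * N) * s + (h - 1) * s \<le> d" using d by linarith
    moreover have "2 * ((h - i) * N) * s = (h - i) * N * s + (h - i) * N * s" by simp
    ultimately show ?thesis unfolding sum_gadget 1 2 3 by (auto simp: C(1))
  qed
qed

sublocale multigraph Bs mlt d
proof
  show "finite Bs" by (auto simp: gadget_vertices_def)
  show "mlt b c = mlt c b" for b c by (cases b; cases c) auto
  have "1 * 1 \<le> (2 * h * N + h) * s" using h1 s1 by (intro mult_le_mono) auto
  then show "2 \<le> d" using d by linarith
  fix b assume "b \<in> Bs"
  then show "card (Sigma Bs (\<lambda>c. {..<mlt b c})) = 1 \<or> card (Sigma Bs (\<lambda>c. {..<mlt b c})) = d"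
    using degree_sum[of b] by (subst card_SigmaI) (auto simp: gadget_vertices_def)
qed

lemma deg_eq: "b \<in> Bs \<Longrightarrow> deg b = (if depth b = 0 \<and> b \<noteq> C 0 then 1 else d)"
  using degree_sum[of b] finite_Bs by (simp add: deg_def items_def)


section \<open>Closeness of subtrees of the gadget\<close>

lemma depth_le_h: "b \<in> Bs \<Longrightarrow> depth b \<le> h"
  by (auto simp: gadget_vertices_def)

lemma deg_pos_depth: "b \<in> Bs \<Longrightarrow> 1 \<le> depth b \<or> b = C i \<Longrightarrow> deg b = d"
  by (auto simp: deg_eq)

lemma Bs_simps [simp]:
  "U j x \<in> Bs \<longleftrightarrow> j \<le> h \<and> x < N" "W j x \<in> Bs \<longleftrightarrow> 1 \<le> j \<and> j \<le> h \<and> x < N" "C i \<in> Bs \<longleftrightarrow> i < h"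
  by (auto simp: gadget_vertices_def)

lemma mem_items: "(c, r) \<in> items b \<longleftrightarrow> c \<in> Bs \<and> r < mlt b c"
  by (simp add: items_def)

text \<open>Apart from edges to low connectors, the only way from depth at least m + 1 to smaller
  depth is the single edge from \<open>W (m + 1) x\<close> to \<open>U m x\<close>. It is the source
  of the bad children.\<close>

lemma shallow_item:
  assumes "b \<in> Bs" "(c, r) \<in> items b" "Suc m \<le> depth b" "\<And>i. c = C i \<Longrightarrow> Suc m \<le> i"
  shows "m \<le> depth c \<and> (Suc m \<le> depth c \<or> (\<exists>x. b = W (Suc m) x \<and> c = U m x \<and> r = 0))"
  using assms by (cases b; cases c) (auto simp: mem_items split: if_splits)

text \<open>The number of edges to a lower connector does not depend on the vertex, so the children
  of two deep vertices can be matched up connector by connector.\<close>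

lemma connector_item:
  assumes "b \<in> Bs" "Suc m \<le> depth b" "i < Suc m"
  shows "(C i, r) \<in> items b \<longleftrightarrow> r < s"
  using assms by (cases b) (auto simp: mem_items)

definition valid :: "vertex \<Rightarrow> vertex \<times> nat \<Rightarrow> bool" where
  "valid b it \<longleftrightarrow> b \<in> Bs \<and> it \<in> items b"

text \<open>A state is a vertex with its back item, and both have to be compared. Two states at the
  same connector differ only in the item leading back; they are granted one level more than the
  depths of the parents, and from this extra level the good children arise.\<close>

definition close :: "nat \<Rightarrow> vertex \<Rightarrow> vertex \<times> nat \<Rightarrow> vertex \<Rightarrow> vertex \<times> nat \<Rightarrow> bool" where
  "close m b it b' it' \<longleftrightarrow> valid b it \<and> valid b' it' \<and>
     (m \<le> depth b \<and> m \<le> depth b' \<and>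
        ((\<exists>i. fst it = C i \<and> fst it' = C i) \<or> m \<le> depth (fst it) \<and> m \<le> depth (fst it'))
      \<or> (\<exists>i. b = C i \<and> b' = C i \<and> m \<le> Suc (depth (fst it)) \<and> m \<le> Suc (depth (fst it'))))"

definition R :: "nat \<Rightarrow> (vertex \<times> (vertex \<times> nat) option) option \<Rightarrow> (vertex \<times> (vertex \<times> nat) option) option \<Rightarrow> bool" where
  "R m X Y \<longleftrightarrow> m = 0 \<or> X = Y \<or>
     (\<exists>b it b' it'. X = Some (b, Some it) \<and> Y = Some (b', Some it') \<and> close m b it b' it')"

lemma close_deg:
  assumes "close (Suc m) b it b' it'" shows "deg b = d" "deg b' = d"
  using assms deg_pos_depth by (auto simp: close_def valid_def)

lemma R_ar: "R (Suc m) X Y \<Longrightarrow> ar X = ar Y"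
  using close_deg by (auto simp: R_def)

lemma R_refl: "R m X X"
  by (simp add: R_def)

lemma valid_child: "b \<in> Bs \<Longrightarrow> a < d \<Longrightarrow> valid (fst (item b a)) (b, snd (item b a))"
  using item_in[of b a] items_sym[of b "fst (item b a)" "snd (item b a)"] by (simp add: valid_def)

lemma R_child:
  assumes "b \<in> Bs" "b' \<in> Bs" "a < d" "a' < d"
    "bk \<noteq> Some (item b a)" "bk' \<noteq> Some (item b' a')"
    "m \<noteq> 0 \<Longrightarrow> m \<le> depth (fst (item b a)) \<and> m \<le> depth (fst (item b' a')) \<and>
        ((\<exists>i. b = C i \<and> b' = C i) \<or> m \<le> depth b \<and> m \<le> depth b')
      \<or> (\<exists>i. fst (item b a) = C i \<and> fst (item b' a') = C i \<and> m \<le> Suc (depth b) \<and> m \<le> Suc (depth b'))"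
  shows "R m (ch (Some (b, bk)) a) (ch (Some (b', bk')) a')"
  unfolding ch_Some[OF assms(3,5)] ch_Some[OF assms(4,6)]
  using assms(7) valid_child[OF assms(1,3)] valid_child[OF assms(2,4)] by (auto simp: R_def close_def)

lemma item_ex:
  assumes "deg b = d" "it \<in> items b" obtains a where "a < d" "item b a = it"
proof -
  have "it \<in> item b ` {..<d}" using assms item_bij[of b] by (simp add: bij_betw_def)
  then show ?thesis using that by blast
qed

lemma item_inj: "deg b = d \<Longrightarrow> a < d \<Longrightarrow> a' < d \<Longrightarrow> item b a = item b a' \<Longrightarrow> a = a'"
  using item_bij[of b] by (auto simp: bij_betw_def inj_on_def)

lemma card_item_set:
  assumes "deg b = d" "T \<subseteq> items b"
  shows "card {a. a < d \<and> item b a \<in> T} = card T"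
proof -
  have "bij_betw (item b) {a. a < d \<and> item b a \<in> T} T"
  proof (rule bij_betw_subset[OF item_bij[OF assms(1)]])
    show "item b ` {a. a < d \<and> item b a \<in> T} = T"
      using assms item_ex[OF assms(1)] by (auto simp: image_iff) (metis subsetD)
  qed auto
  then show ?thesis by (rule bij_betw_same_card)
qed

text \<open>Exchanging the two back items aligns the dead children. One bad child remains, where the
  targets of the two back items face each other; all other children are equal on both sides. The
  good ones are the s children over \<open>U h 0\<close>, of which the back items may take two:
  hence s - 2.\<close>

lemma step_same_connector:
  assumes c: "close (Suc m) (C i) it (C i) it'" and ne: "it \<noteq> it'"
    and m: "m \<le> depth (fst it)" "m \<le> depth (fst it')"
  defines "X \<equiv> Some (C i, Some it)" and "Y \<equiv> Some (C i, Some it')"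
  shows "\<exists>\<beta> B G. \<beta> permutes {..<d} \<and> B \<subseteq> {..<d} \<and> card B \<le> 2 \<and> G \<subseteq> {..<d} - B
      \<and> (B \<noteq> {} \<longrightarrow> s - 2 \<le> card G)
      \<and> (\<forall>a\<in>{..<d} - B. R (Suc m) (ch X a) (ch Y (\<beta> a)))
      \<and> (\<forall>a\<in>B. R m (ch X a) (ch Y (\<beta> a)))
      \<and> (\<forall>c\<in>G. R (Suc (Suc m)) (ch X c) (ch Y (\<beta> c)))
      \<and> (\<forall>a\<in>B. \<forall>c\<in>G. R m (ch X a) (ch X c) \<and> R m (ch X c) (ch X a))"
proof -
  have v: "C i \<in> Bs" "it \<in> items (C i)" "it' \<in> items (C i)" using c by (auto simp: close_def valid_def)
  have dg: "deg (C i) = d" using v(1) deg_pos_depth by blast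
  obtain a0 where a0: "a0 < d" "item (C i) a0 = it" using item_ex[OF dg v(2)] by blast
  obtain a1 where a1: "a1 < d" "item (C i) a1 = it'" using item_ex[OF dg v(3)] by blast
  have n01: "a0 \<noteq> a1" using a0 a1 ne by auto
  let ?\<beta> = "Transposition.transpose a0 a1"
  define T where "T = (\<lambda>r. (U h 0, r)) ` {..<s}"
  have ih: "i < h" using v(1) by (auto simp: gadget_vertices_def)
  have T: "T \<subseteq> items (C i)" "card T = s"
    using ih N1 by (auto simp: T_def mem_items card_image inj_on_def)
  define G where "G = {a. a < d \<and> item (C i) a \<in> T} - {a0, a1}"
  have "card {a. a < d \<and> item (C i) a \<in> T} - card {a0, a1} \<le> card G"
    unfolding G_def by (rule diff_card_le_card_Diff) simp
  then have cardG: "s - 2 \<le> card G" using card_item_set[OF dg T(1)] T(2) n01 by simp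
  have other: "ch X a = ch Y (?\<beta> a)" if "a < d" "a \<noteq> a1" for a
  proof (cases "a = a0")
    case True
    then show ?thesis using a0 a1 by (simp add: X_def Y_def)
  next
    case False
    then have "?\<beta> a = a" using that by (simp add: Transposition.transpose_def)
    moreover have "item (C i) a \<noteq> it" "item (C i) a \<noteq> it'"
      using that False a0 a1 item_inj[OF dg] by metis+
    ultimately show ?thesis using that by (simp add: X_def Y_def)
  qed
  have badR: "R m (ch X a1) (ch Y (?\<beta> a1))"
    unfolding X_def Y_def using a0 a1 ne m by (intro R_child v) auto
  have cross: "R m (ch X a1) (ch X c) \<and> R m (ch X c) (ch X a1)" if "c \<in> G" for c
  proof -
    have c: "c < d" "fst (item (C i) c) = U h 0" "c \<noteq> a0" using that by (auto simp: G_def T_def)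
    have n: "item (C i) c \<noteq> it" using c a0 item_inj[OF dg] by metis
    have "fst it \<in> Bs" using v items_sym[of "C i" "fst it" "snd it"] by simp
    then have "m \<le> h" using m(1) depth_le_h order_trans by blast
    then show ?thesis
      unfolding X_def using a0 a1 ne m c n by (intro conjI R_child v) auto
  qed
  show ?thesis
  proof (rule exI[of _ ?\<beta>], rule exI[of _ "{a1}"], rule exI[of _ G], intro conjI ballI impI)
    show "R (Suc m) (ch X a) (ch Y (?\<beta> a))" if "a \<in> {..<d} - {a1}" for a
      using other[of a] that unfolding R_def by blast
    show "R (Suc (Suc m)) (ch X c) (ch Y (?\<beta> c))" if "c \<in> G" for c
    proof -
      have "c < d" "c \<noteq> a1" using that by (auto simp: G_def)
      then show ?thesis using other[of c] unfolding R_def by blast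
    qed
    show "?\<beta> permutes {..<d}" using a0 a1 by (intro permutes_swap_id) auto
  qed (use cardG badR cross a1 in \<open>auto simp: G_def\<close>)
qed

text \<open>Children at a connector \<open>C i\<close> with i \<le> m are matched to children at the
  same connector, the others arbitrarily, and back item to back item. Bad is at most one shallow
  child on each side. The good children lie over \<open>C m\<close>: the same connector with parents
  of depth above m gives level m + 2, while a shallow child has depth m just like
  \<open>C m\<close>.\<close>

lemma step_deep:
  assumes c: "close (Suc m) b it b' it'" and dp: "Suc m \<le> depth b" "Suc m \<le> depth b'"
    and it: "(\<exists>i. fst it = C i \<and> fst it' = C i) \<or> Suc m \<le> depth (fst it) \<and> Suc m \<le> depth (fst it')"
  defines "X \<equiv> Some (b, Some it)" and "Y \<equiv> Some (b', Some it')"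
  shows "\<exists>\<beta> B G. \<beta> permutes {..<d} \<and> B \<subseteq> {..<d} \<and> card B \<le> 2 \<and> G \<subseteq> {..<d} - B
      \<and> (B \<noteq> {} \<longrightarrow> s - 2 \<le> card G)
      \<and> (\<forall>a\<in>{..<d} - B. R (Suc m) (ch X a) (ch Y (\<beta> a)))
      \<and> (\<forall>a\<in>B. R m (ch X a) (ch Y (\<beta> a)))
      \<and> (\<forall>c\<in>G. R (Suc (Suc m)) (ch X c) (ch Y (\<beta> c)))
      \<and> (\<forall>a\<in>B. \<forall>c\<in>G. R m (ch X a) (ch X c) \<and> R m (ch X c) (ch X a))"
proof -
  have v: "b \<in> Bs" "it \<in> items b" "b' \<in> Bs" "it' \<in> items b'" using c by (auto simp: close_def valid_def)
  have dg: "deg b = d" "deg b' = d" using close_deg[OF c] .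
  \<comment> \<open>The colour of an item is the index of the connector it leads to if this is at
    most m; deeper connectors share the colour \<open>None\<close> with all other vertices.\<close>
  define \<kappa> where "\<kappa> u a = (case fst (item u a) of C i \<Rightarrow> if i < Suc m then Some i else None | _ \<Rightarrow> None)" for u a
  have \<kappa>_Some: "\<kappa> u a = Some i \<longleftrightarrow> fst (item u a) = C i \<and> i < Suc m" for u a i
    by (auto simp: \<kappa>_def split: vertex.splits)
  have size_Some: "card {a. a < d \<and> \<kappa> u a = Some i} = (if i < Suc m then s else 0)"
    if "u \<in> Bs" "Suc m \<le> depth u" for u i
  proof (cases "i < Suc m")
    case True
    have "{a. a < d \<and> \<kappa> u a = Some i} = {a. a < d \<and> item u a \<in> (\<lambda>r. (C i, r)) ` {..<s}}"
    proof -
      have "fst (item u a) = C i \<longleftrightarrow> item u a \<in> (\<lambda>r. (C i, r)) ` {..<s}" if "a < d" for a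
        using item_in[OF \<open>u \<in> Bs\<close> that] connector_item[OF \<open>u \<in> Bs\<close> \<open>Suc m \<le> depth u\<close> True]
        by (cases "item u a") auto
      then show ?thesis using True by (auto simp: \<kappa>_Some)
    qed
    moreover have "(\<lambda>r. (C i, r)) ` {..<s} \<subseteq> items u"
      using connector_item[OF that True] by auto
    moreover have "deg u = d" using that deg_pos_depth[of u] by auto
    ultimately show ?thesis using True by (simp add: card_item_set card_image inj_on_def)
  qed (simp add: \<kappa>_Some)
  have size: "card {a. a < d \<and> \<kappa> b a = k} = card {a. a < d \<and> \<kappa> b' a = k}" for k
  proof (cases k)
    case None
    have "card {a. a < d \<and> \<kappa> u a = None} = d - (\<Sum>i<Suc m. s)" if "u \<in> Bs" "Suc m \<le> depth u" for u
    proof -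
      have "{a. a < d \<and> \<kappa> u a = None} = {..<d} - (\<Union>i<Suc m. {a. a < d \<and> \<kappa> u a = Some i})"
      proof -
        have "\<kappa> u a = None \<longleftrightarrow> (\<forall>i<Suc m. \<kappa> u a \<noteq> Some i)" for a
          using \<kappa>_Some by (metis option.exhaust option.distinct(1))
        then show ?thesis by auto
      qed
      moreover have "card (\<Union>i<Suc m. {a. a < d \<and> \<kappa> u a = Some i}) = (\<Sum>i<Suc m. s)"
        by (subst card_UN_disjoint) (auto simp: size_Some[OF that])
      ultimately show ?thesis
        using card_Diff_subset[of "\<Union>i<Suc m. {a. a < d \<and> \<kappa> u a = Some i}" "{..<d}"] by auto
    qed
    then show ?thesis using None v dp by simp
  qed (use size_Some v dp in simp)
  obtain a0 where a0: "a0 < d" "item b a0 = it" using item_ex[OF dg(1) v(2)] by blast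
  obtain a1 where a1: "a1 < d" "item b' a1 = it'" using item_ex[OF dg(2) v(4)] by blast
  have "\<kappa> b a0 = \<kappa> b' a1" using it a0 a1 by (auto simp: \<kappa>_def split: vertex.splits)
  from recolouring[OF size a0(1) a1(1) this] obtain \<beta> where
    \<beta>: "\<beta> permutes {..<d}" "\<And>a. a < d \<Longrightarrow> \<kappa> b' (\<beta> a) = \<kappa> b a" "\<beta> a0 = a1" by blast
  have \<beta>d: "\<beta> a < d" if "a < d" for a using permutes_in_image[OF \<beta>(1), of a] that by simp
  define bad where "bad u = {a. a < d \<and> \<kappa> u a = None \<and> \<not> Suc m \<le> depth (fst (item u a))}" for u
  have shallow: "m \<le> depth (fst (item u a)) \<and> (Suc m \<le> depth (fst (item u a)) \<or>
      (\<exists>x. u = W (Suc m) x \<and> item u a = (U m x, 0)))"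
    if "u \<in> Bs" "Suc m \<le> depth u" "a < d" "\<kappa> u a = None" for u a
  proof -
    have "\<And>i. fst (item u a) = C i \<Longrightarrow> Suc m \<le> i"
      using that(4) \<kappa>_Some[of u a] by (metis not_less option.distinct(1))
    then show ?thesis
      using shallow_item[of u "fst (item u a)" "snd (item u a)" m] item_in[OF that(1,3)] that(1,2)
      by (auto simp: prod_eq_iff)
  qed
  have card_bad: "card (bad u) \<le> 1" if u: "u \<in> Bs" "Suc m \<le> depth u" for u
  proof -
    have dg: "deg u = d" using u deg_pos_depth[of u] by auto
    have W: "\<exists>x. u = W (Suc m) x \<and> item u a = (U m x, 0)" if "a \<in> bad u" for a
      using that shallow[OF u, of a] by (auto simp: bad_def)
    have "a = a'" if a: "a \<in> bad u" "a' \<in> bad u" for a a'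
    proof (rule item_inj[OF dg])
      show "a < d" "a' < d" using a by (simp_all add: bad_def)
      show "item u a = item u a'" using W[OF a(1)] W[OF a(2)] by auto
    qed
    moreover have "finite (bad u)" by (simp add: bad_def)
    ultimately show ?thesis by (simp add: card_le_Suc0_iff_eq)
  qed
  \<comment> \<open>The back item \<open>a0\<close> is left out, since the children behind the back
    items are dead on both sides.\<close>
  define B where "B = (bad b \<union> inv \<beta> ` bad b') - {a0}"
  have fin: "finite (bad u)" for u by (simp add: bad_def)
  have B_iff: "a \<in> B \<longleftrightarrow> a \<noteq> a0 \<and> (a \<in> bad b \<or> \<beta> a \<in> bad b')" for a
  proof -
    have "a \<in> inv \<beta> ` bad b' \<longleftrightarrow> \<beta> a \<in> bad b'"
    proof
      assume "a \<in> inv \<beta> ` bad b'"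
      then obtain y where "y \<in> bad b'" "a = inv \<beta> y" by blast
      then show "\<beta> a \<in> bad b'" by (simp add: permutes_inverses[OF \<beta>(1)])
    next
      assume "\<beta> a \<in> bad b'"
      then have "inv \<beta> (\<beta> a) \<in> inv \<beta> ` bad b'" by (rule imageI)
      then show "a \<in> inv \<beta> ` bad b'" by (simp add: permutes_inverses[OF \<beta>(1)])
    qed
    then show ?thesis by (auto simp: B_def)
  qed
  have Bd: "B \<subseteq> {..<d}"
  proof
    fix a assume "a \<in> B"
    then have "a < d \<or> \<beta> a < d" by (auto simp: B_iff bad_def)
    then show "a \<in> {..<d}" using permutes_in_image[OF \<beta>(1), of a] by auto
  qed
  have Bnone: "a < d \<and> a \<noteq> a0 \<and> \<kappa> b a = None \<and> \<kappa> b' (\<beta> a) = None" if "a \<in> B" for a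
  proof -
    have "a < d" using that Bd by blast
    moreover have "\<kappa> b a = None \<or> \<kappa> b' (\<beta> a) = None" "a \<noteq> a0"
      using that by (auto simp: B_iff bad_def)
    ultimately show ?thesis using \<beta>(2)[of a] by metis
  qed
  have "card B \<le> card (bad b \<union> inv \<beta> ` bad b')"
    unfolding B_def using fin by (intro card_mono) auto
  also have "\<dots> \<le> card (bad b) + card (bad b')"
    using card_Un_le[of "bad b" "inv \<beta> ` bad b'"] card_image_le[OF fin, of "inv \<beta>" b'] by linarith
  finally have cardB: "card B \<le> 2" using card_bad[OF v(1) dp(1)] card_bad[OF v(3) dp(2)] by simp
  define G where "G = {a. a < d \<and> \<kappa> b a = Some m} - {a0}"
  have "card {a. a < d \<and> \<kappa> b a = Some m} - card {a0} \<le> card G"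
    unfolding G_def by (rule diff_card_le_card_Diff) simp
  then have cardG: "s - 2 \<le> card G" using size_Some[OF v(1) dp(1)] by simp
  have GB: "G \<subseteq> {..<d} - B" using Bnone by (fastforce simp: G_def)
  have nb: "item b a \<noteq> it \<and> item b' (\<beta> a) \<noteq> it'" if "a < d" "a \<noteq> a0" for a
  proof -
    have "\<beta> a \<noteq> a1" using \<beta>(3) that permutes_inj[OF \<beta>(1)] by (metis injD)
    then show ?thesis
      using that a0 a1 item_inj[OF dg(1), of a a0] item_inj[OF dg(2), of "\<beta> a" a1] \<beta>d[of a] by auto
  qed
  have conn: "R (Suc (Suc m)) (ch X a) (ch Y (\<beta> a))" if "a < d" "a \<noteq> a0" "\<kappa> b a = Some i" for a i
  proof -
    have "\<kappa> b' (\<beta> a) = Some i" using \<beta>(2)[OF that(1)] that(3) by simp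
    then show ?thesis
      unfolding X_def Y_def using that nb[OF that(1,2)] dp \<beta>d[OF that(1)]
      by (intro R_child v) (auto simp: \<kappa>_Some)
  qed
  have conn': "R (Suc m) (ch X a) (ch Y (\<beta> a))" if "a < d" "a \<noteq> a0" "\<kappa> b a = Some i" for a i
  proof -
    have "\<kappa> b' (\<beta> a) = Some i" using \<beta>(2)[OF that(1)] that(3) by simp
    then show ?thesis
      unfolding X_def Y_def using that nb[OF that(1,2)] dp \<beta>d[OF that(1)]
      by (intro R_child v) (auto simp: \<kappa>_Some)
  qed
  have backs: "ch X a0 = ch Y (\<beta> a0)"
    using a0 a1 \<beta>(3) by (simp add: X_def Y_def)
  have rest: "R (Suc m) (ch X a) (ch Y (\<beta> a))" if a: "a \<in> {..<d} - B" for a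
  proof (cases "a = a0 \<or> \<kappa> b a \<noteq> None")
    case True
    then show ?thesis
    proof
      assume "a = a0" then show ?thesis by (simp only: backs R_refl)
    next
      assume "\<kappa> b a \<noteq> None"
      then obtain i where "\<kappa> b a = Some i" by blast
      then show ?thesis using conn'[of a i] a by (cases "a = a0") (simp_all only: backs R_refl, simp)
    qed
  next
    case False
    then have "\<kappa> b' (\<beta> a) = None" "a \<notin> bad b" "\<beta> a \<notin> bad b'"
      using a \<beta>(2)[of a] by (auto simp: B_iff)
    then show ?thesis
      unfolding X_def Y_def using False nb[of a] dp \<beta>d[of a] a
      by (intro R_child v) (auto simp: bad_def)
  qed
  have badR: "R m (ch X a) (ch Y (\<beta> a))" if a: "a \<in> B" for a
  proof -
    have a': "a < d" "a \<noteq> a0" "\<kappa> b a = None" "\<kappa> b' (\<beta> a) = None"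
      using Bnone[OF a] by auto
    show ?thesis
      unfolding X_def Y_def
      using a' nb[of a] dp \<beta>d[of a] shallow[OF v(1) dp(1) a'(1,3)] shallow[OF v(3) dp(2) _ a'(4)]
      by (intro R_child v) auto
  qed
  have cross: "R m (ch X a) (ch X c) \<and> R m (ch X c) (ch X a)" if a: "a \<in> B" and c: "c \<in> G" for a c
  proof -
    have a': "a < d" "a \<noteq> a0" "\<kappa> b a = None"
      using Bnone[OF a] by auto
    have c': "c < d" "c \<noteq> a0" "fst (item b c) = C m" using c by (auto simp: G_def \<kappa>_Some)
    show ?thesis
      unfolding X_def
      using a' c' nb[of a] nb[of c] dp shallow[OF v(1) dp(1) a'(1,3)]
      by (intro conjI R_child v) auto
  qed
  show ?thesis
  proof (rule exI[of _ \<beta>], rule exI[of _ B], rule exI[of _ G], intro conjI ballI impI)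
    show "R (Suc (Suc m)) (ch X c) (ch Y (\<beta> c))" if "c \<in> G" for c
      using conn that by (auto simp: G_def)
  qed (use \<beta>(1) Bd cardB cardG GB rest badR cross in auto)
qed

lemma R_step:
  assumes "R (Suc m) X Y"
  shows "\<exists>\<beta> B G. \<beta> permutes {..<d} \<and> B \<subseteq> {..<d} \<and> card B \<le> 2 \<and> G \<subseteq> {..<d} - B
      \<and> (B \<noteq> {} \<longrightarrow> s - 2 \<le> card G)
      \<and> (\<forall>a\<in>{..<d} - B. R (Suc m) (ch X a) (ch Y (\<beta> a)))
      \<and> (\<forall>a\<in>B. R m (ch X a) (ch Y (\<beta> a)))
      \<and> (\<forall>c\<in>G. R (Suc (Suc m)) (ch X c) (ch Y (\<beta> c)))
      \<and> (\<forall>a\<in>B. \<forall>c\<in>G. R m (ch X a) (ch X c) \<and> R m (ch X c) (ch X a))"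
proof (cases "X = Y")
  case True
  then show ?thesis
    by (intro exI[of _ id] exI[of _ "{}"]) (auto simp: R_refl permutes_id)
next
  case False
  then obtain b it b' it' where XY: "X = Some (b, Some it)" "Y = Some (b', Some it')"
    and c: "close (Suc m) b it b' it'" using assms unfolding R_def by blast
  from c consider
      "Suc m \<le> depth b" "Suc m \<le> depth b'"
      "(\<exists>i. fst it = C i \<and> fst it' = C i) \<or> Suc m \<le> depth (fst it) \<and> Suc m \<le> depth (fst it')"
    | i where "b = C i" "b' = C i" "m \<le> depth (fst it)" "m \<le> depth (fst it')"
    unfolding close_def by (metis Suc_le_mono)
  then show ?thesis
  proof cases
    case 1 then show ?thesis unfolding XY by (rule step_deep[OF c])
  next
    case (2 i)
    then show ?thesis unfolding XY using c step_same_connector[of m i it it'] False XY by simp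
  qed
qed

end

subsection \<open>Exploring a lifted graph\<close>

fun reduced :: "nat list \<Rightarrow> bool" where
  "reduced (a # b # w) \<longleftrightarrow> a \<noteq> b \<and> reduced (b # w)"
| "reduced _ \<longleftrightarrow> True"

text \<open>Going along an edge and back has to restore the position; hence involutions, and colours
  that agree at both ends of an edge. Injective colours at each vertex together with
  \<open>act_free\<close> keep the neighbors of a lifted vertex distinct, so degrees are
  preserved.\<close>

locale lift = multigraph Bs mult d
  for Bs :: "'b set" and mult :: "'b \<Rightarrow> 'b \<Rightarrow> nat" and d :: nat +
  fixes Gs :: "'g set" and act :: "nat \<Rightarrow> 'g \<Rightarrow> 'g" and col :: "'b \<Rightarrow> 'b \<times> nat \<Rightarrow> nat" and cs :: "nat set"
  assumes finite_Gs: "finite Gs" and Gs_ne: "Gs \<noteq> {}" and Bs_ne: "Bs \<noteq> {}"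
    and act_in: "t \<in> cs \<Longrightarrow> g \<in> Gs \<Longrightarrow> act t g \<in> Gs"
    and act_act: "t \<in> cs \<Longrightarrow> g \<in> Gs \<Longrightarrow> act t (act t g) = g"
    and col_in: "b \<in> Bs \<Longrightarrow> it \<in> items b \<Longrightarrow> col b it \<in> cs"
    and col_sym: "b \<in> Bs \<Longrightarrow> (c, r) \<in> items b \<Longrightarrow> col c (b, r) = col b (c, r)"
    and col_inj: "b \<in> Bs \<Longrightarrow> inj_on (col b) (items b)"
    and act_free: "g \<in> Gs \<Longrightarrow> t \<in> cs \<Longrightarrow> t' \<in> cs \<Longrightarrow> act t g = act t' g \<Longrightarrow> t = t'"
begin

definition Vs :: "('g \<times> bool \<times> 'b) set" where "Vs = Gs \<times> UNIV \<times> Bs"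
definition nv :: nat where "nv = card Vs"

abbreviation base :: "'g \<times> bool \<times> 'b \<Rightarrow> 'b" where "base v \<equiv> snd (snd v)"

text \<open>The Boolean side flips along every edge. This makes the lift bipartite and turns loops
  of the base into proper edges.\<close>

definition nbr :: "'g \<times> bool \<times> 'b \<Rightarrow> nat \<Rightarrow> 'g \<times> bool \<times> 'b" where
  "nbr v a = (act (col (base v) (item (base v) a)) (fst v), \<not> fst (snd v), fst (item (base v) a))"

lemma finite_Vs: "finite Vs"
  by (simp add: Vs_def finite_Gs finite_Bs)

lemma nv_pos: "0 < nv"
  using Gs_ne Bs_ne finite_Vs by (auto simp: nv_def card_gt_0_iff) (auto simp: Vs_def)

lemma nbr_Vs: "v \<in> Vs \<Longrightarrow> a < d \<Longrightarrow> nbr v a \<in> Vs"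
  using item_in[of "base v" a] items_sym[of "base v" "fst (item (base v) a)" "snd (item (base v) a)"]
  by (auto simp: Vs_def nbr_def intro!: act_in col_in)

lemma nbr_back:
  assumes "v \<in> Vs" "a < d" "item (base (nbr v a)) a' = (base v, snd (item (base v) a))"
  shows "nbr (nbr v a) a' = v"
proof -
  obtain g sd b where v: "v = (g, sd, b)" by (cases v)
  obtain c r where it: "item b a = (c, r)" by (cases "item b a")
  have b: "g \<in> Gs" "b \<in> Bs" using assms(1) by (auto simp: v Vs_def)
  have "(c, r) \<in> items b" using item_in[OF b(2) assms(2)] it by simp
  then have "col c (b, r) = col b (c, r)" "col b (c, r) \<in> cs" using col_sym col_in b by auto
  moreover have "item c a' = (b, r)" using assms(3) by (simp add: v nbr_def it)
  ultimately show ?thesis using act_act b by (simp add: v nbr_def it)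
qed

text \<open>The head of an address is the label of a root, its tail a path of ports in the tree of
  that root. The empty address lies in no tree and is dead.\<close>

definition fstate :: "(nat \<Rightarrow> 'g \<times> bool \<times> 'b) \<Rightarrow> port_orders \<Rightarrow> nat list \<Rightarrow> ('b \<times> ('b \<times> nat) option) option" where
  "fstate Z f q = (case q of [] \<Rightarrow> None | u # p \<Rightarrow> state_at p (Some (base (Z u), None)) (sub f u))"

primrec place :: "nat list \<Rightarrow> 'g \<times> bool \<times> 'b \<Rightarrow> port_orders \<Rightarrow> 'g \<times> bool \<times> 'b" where
  "place [] v f = v"
| "place (k # p) v f = place p (nbr v (f [] k)) (sub f k)"

definition fplace :: "(nat \<Rightarrow> 'g \<times> bool \<times> 'b) \<Rightarrow> port_orders \<Rightarrow> nat list \<Rightarrow> 'g \<times> bool \<times> 'b" where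
  "fplace Z f q = place (tl q) (Z (hd q)) (sub f (hd q))"

definition flab :: "(nat list \<Rightarrow> nat) \<Rightarrow> nat list \<Rightarrow> nat" where
  "flab l q = (if length q = 1 then hd q else l q)"

text \<open>A sample consists of the vertices \<open>Z\<close> behind the labels of the roots, the orders \<open>f\<close> of the
  ports and the labels \<open>l\<close> of the other nodes; observing a node reveals its degree and its label.\<close>

definition fob :: "(nat \<Rightarrow> 'g \<times> bool \<times> 'b) \<Rightarrow> port_orders \<Rightarrow> (nat list \<Rightarrow> nat) \<Rightarrow> nat list \<Rightarrow> nat \<times> nat" where
  "fob Z f l q = (ar (fstate Z f q), if ar (fstate Z f q) = 0 then 0 else flab l q)"

lemma state_at_snoc: "state_at (p @ [k]) x f = ch (state_at p x f) (f p k)"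
  by (induction p arbitrary: x f) (auto simp: sub_def)

lemma place_snoc: "place (p @ [k]) v f = nbr (place p v f) (f p k)"
  by (induction p arbitrary: v f) (auto simp: sub_def)

lemma fstate_snoc: "q \<noteq> [] \<Longrightarrow> fstate Z f (q @ [k]) = ch (fstate Z f q) (f q k)"
  by (cases q) (auto simp: fstate_def state_at_snoc sub_def)

lemma fplace_snoc: "q \<noteq> [] \<Longrightarrow> fplace Z f (q @ [k]) = nbr (fplace Z f q) (f q k)"
  by (cases q) (auto simp: fplace_def place_snoc sub_def)

lemma fstate_root: "fstate Z f [u] = Some (base (Z u), None)"
  by (simp add: fstate_def)

lemma fplace_root: "fplace Z f [u] = Z u"
  by (simp add: fplace_def)

lemma deg_pos: "b \<in> Bs \<Longrightarrow> 1 \<le> deg b" "b \<in> Bs \<Longrightarrow> deg b \<le> d"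
  using deg_cases'[of b] d2 by auto

text \<open>The node of a live address carries a genuine vertex, and its back item leads to the
  place of its parent. This lets the simulation find the label of a neighbor that is hidden behind
  the dead child.\<close>

lemma alive_props:
  assumes f: "\<And>q. f q permutes {..<d}" and Z: "Z u \<in> Vs" and s: "fstate Z f (u # p) = Some (b, bk)"
  shows "fplace Z f (u # p) \<in> Vs" "base (fplace Z f (u # p)) = b" "bk = None \<longleftrightarrow> p = []"
    "p \<noteq> [] \<Longrightarrow> a < d \<Longrightarrow> bk = Some (item b a) \<Longrightarrow> nbr (fplace Z f (u # p)) a = fplace Z f (u # butlast p)"
    "set p \<subseteq> {..<d}"
proof -
  have "fplace Z f (u # p) \<in> Vs \<and> base (fplace Z f (u # p)) = b \<and> (bk = None \<longleftrightarrow> p = []) \<and>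
    (p \<noteq> [] \<longrightarrow> (\<forall>a<d. bk = Some (item b a) \<longrightarrow> nbr (fplace Z f (u # p)) a = fplace Z f (u # butlast p)))
    \<and> set p \<subseteq> {..<d}"
    using s
  proof (induction p arbitrary: b bk rule: rev_induct)
    case Nil
    then show ?case using Z by (auto simp: fstate_root fplace_root)
  next
    case (snoc k p)
    have eq: "fstate Z f (u # p @ [k]) = ch (fstate Z f (u # p)) (f (u # p) k)"
      using fstate_snoc[of "u # p"] by simp
    then obtain b' bk' where s': "fstate Z f (u # p) = Some (b', bk')"
      using snoc.prems by (cases "fstate Z f (u # p)") auto
    let ?a = "f (u # p) k" and ?v = "fplace Z f (u # p)"
    have IH: "?v \<in> Vs" "base ?v = b'" "set p \<subseteq> {..<d}" using snoc.IH[OF s'] by auto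
    have a: "?a < d" and bb: "b = fst (item b' ?a)" "bk = Some (b', snd (item b' ?a))"
      using eq snoc.prems s' by (auto split: if_splits)
    have k: "k < d" using a permutes_in_image[OF f, of "u # p" k] by simp
    have pl: "fplace Z f (u # p @ [k]) = nbr ?v ?a" using fplace_snoc[of "u # p"] by simp
    have "base (nbr ?v ?a) = b" using bb IH(2) by (simp add: nbr_def)
    moreover have "nbr (nbr ?v ?a) a = ?v" if "a < d" "bk = Some (item b a)" for a
      using nbr_back[OF IH(1) a, of a] that bb IH(2) \<open>base (nbr ?v ?a) = b\<close> by simp
    ultimately show ?case using nbr_Vs[OF IH(1) a] bb IH(3) k by (simp add: pl)
  qed
  then show "fplace Z f (u # p) \<in> Vs" "base (fplace Z f (u # p)) = b" "bk = None \<longleftrightarrow> p = []"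
    "p \<noteq> [] \<Longrightarrow> a < d \<Longrightarrow> bk = Some (item b a) \<Longrightarrow> nbr (fplace Z f (u # p)) a = fplace Z f (u # butlast p)"
    "set p \<subseteq> {..<d}"
    by blast+
qed

text \<open>\<open>mem\<close> holds for each label met a node bearing it; a query at another label
  opens a new tree. Each query takes at most three visits: to the node for its degree, to its child,
  and, if the child is dead because the neighbor is the parent, to the parent for its label. At a
  root no child below the degree is dead, so the value \<open>Stop None\<close> there is
  arbitrary.\<close>

primrec sim :: "strategy \<Rightarrow> (nat \<Rightarrow> nat list option) \<Rightarrow> (nat \<times> nat) explorer" where
  "sim (Answer x) mem = Stop x"
| "sim (Query v i k) mem = (if nv \<le> v then sim (k None) mem else
     (let P = (case mem v of None \<Rightarrow> [v] | Some P \<Rightarrow> P) in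
      Visit P (\<lambda>y. if 1 \<le> i \<and> i \<le> fst y \<and> i \<le> d
        then Visit (P @ [i - 1]) (\<lambda>y'. if fst y' = 0
          then (if length P = 1 then Stop None
                else Visit (butlast P) (\<lambda>y''. sim (k (Some (snd y''))) (mem(v \<mapsto> P))))
          else sim (k (Some (snd y'))) (mem(v \<mapsto> P, snd y' \<mapsto> P @ [i - 1])))
        else sim (k None) (if fst y = 0 then mem else mem(v \<mapsto> P)))))"

primrec rplace :: "('g \<times> bool \<times> 'b \<Rightarrow> nat \<Rightarrow> nat) \<Rightarrow> nat list \<Rightarrow> 'g \<times> bool \<times> 'b \<Rightarrow> 'g \<times> bool \<times> 'b" where
  "rplace \<sigma> [] v = v"
| "rplace \<sigma> (k # p) v = rplace \<sigma> p (nbr v (\<sigma> v k))"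

text \<open>In the real sample, order and label of a node are those of the vertex it lies over, so
  nodes over the same vertex share them. In the ideal samples they are independent.\<close>

definition rZ where "rZ \<pi> = inv_into Vs \<pi>" for \<pi> :: "'g \<times> bool \<times> 'b \<Rightarrow> nat"
definition rf where "rf \<pi> \<sigma> q = \<sigma> (rplace \<sigma> (tl q) (rZ \<pi> (hd q)))" for \<pi> :: "'g \<times> bool \<times> 'b \<Rightarrow> nat"
definition rl where "rl \<pi> \<sigma> q = \<pi> (rplace \<sigma> (tl q) (rZ \<pi> (hd q)))" for \<pi> :: "'g \<times> bool \<times> 'b \<Rightarrow> nat"

lemma place_rplace: "place p v (\<lambda>q. \<sigma> (rplace \<sigma> q v)) = rplace \<sigma> p v"
proof (induction p arbitrary: v)
  case (Cons k p)
  have "sub (\<lambda>q. \<sigma> (rplace \<sigma> q v)) k = (\<lambda>q. \<sigma> (rplace \<sigma> q (nbr v (\<sigma> v k))))"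
    by (simp add: sub_def)
  then show ?case using Cons by simp
qed simp

lemma fplace_real: "q \<noteq> [] \<Longrightarrow> fplace (rZ \<pi>) (rf \<pi> \<sigma>) q = rplace \<sigma> (tl q) (rZ \<pi> (hd q))"
  using place_rplace[of "tl q" "rZ \<pi> (hd q)" \<sigma>] by (simp add: fplace_def sub_def rf_def)

definition labellings :: "('g \<times> bool \<times> 'b \<Rightarrow> nat) set" where
  "labellings = {\<pi> \<in> extensional Vs. bij_betw \<pi> Vs {..<nv}}"

definition vorders :: "('g \<times> bool \<times> 'b \<Rightarrow> nat \<Rightarrow> nat) set" where
  "vorders = PiE_dflt Vs id (\<lambda>_. {s. s permutes {..<d}})"

lemma vorders_permutes: "\<sigma> \<in> vorders \<Longrightarrow> \<sigma> v permutes {..<d}"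
  unfolding vorders_def PiE_dflt_def by (cases "v \<in> Vs") (auto simp del: split_paired_All simp: permutes_id)

definition adj :: "('g \<times> bool \<times> 'b \<Rightarrow> nat) \<Rightarrow> ('g \<times> bool \<times> 'b \<Rightarrow> nat \<Rightarrow> nat) \<Rightarrow> nat \<Rightarrow> nat list" where
  "adj \<pi> \<sigma> w = (if w < nv then map (\<lambda>k. \<pi> (nbr (rZ \<pi> w) (\<sigma> (rZ \<pi> w) k))) [0..<deg (base (rZ \<pi> w))] else [])"

text \<open>The invariant on \<open>mem\<close> asks only that the stored node lies over the vertex
  with the given label. Any such node will do: in the real sample they agree in degree, port order
  and the labels of the neighbors.\<close>

lemma run_eq_sim:
  assumes \<pi>: "\<pi> \<in> labellings" and \<sigma>: "\<sigma> \<in> vorders"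
    and mem: "\<And>w P. mem w = Some P \<Longrightarrow> P \<noteq> [] \<and> hd P < nv \<and> fstate (rZ \<pi>) (rf \<pi> \<sigma>) P \<noteq> None
      \<and> fplace (rZ \<pi>) (rf \<pi> \<sigma>) P = rZ \<pi> w"
  shows "run (adj \<pi> \<sigma>) S = result (sim S mem) (fob (rZ \<pi>) (rf \<pi> \<sigma>) (rl \<pi> \<sigma>))"
  using mem
proof (induction S arbitrary: mem)
  case (Query v i k)
  let ?Z = "rZ \<pi>" and ?f = "rf \<pi> \<sigma>" and ?l = "rl \<pi> \<sigma>"
  let ?o = "fob ?Z ?f ?l"
  have bij: "bij_betw \<pi> Vs {..<nv}" using \<pi> by (simp add: labellings_def)
  have ZV: "?Z w \<in> Vs" "\<pi> (?Z w) = w" if "w < nv" for w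
    using bij that by (auto simp: rZ_def bij_betw_def inv_into_into f_inv_into_f)
  have Z\<pi>: "?Z (\<pi> x) = x" if "x \<in> Vs" for x
    using bij that by (auto simp: rZ_def bij_betw_def)
  have pf: "?f q permutes {..<d}" for q by (simp add: rf_def vorders_permutes[OF \<sigma>])
  have lab: "flab ?l q = \<pi> (fplace ?Z ?f q)" if "q \<noteq> []" "hd q < nv" for q
    using that ZV by (cases q) (auto simp: flab_def fplace_real rl_def)
  show ?case
  proof (cases "nv \<le> v")
    case True
    then have "adj_query (adj \<pi> \<sigma>) v i = None" by (simp add: adj_query_def adj_def)
    then show ?thesis using Query.IH[of "k None" mem] Query.prems True by simp
  next
    case False
    define P where "P = (case mem v of None \<Rightarrow> [v] | Some P \<Rightarrow> P)"
    have P: "P \<noteq> []" "hd P < nv" "fstate ?Z ?f P \<noteq> None" "fplace ?Z ?f P = ?Z v"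
      using Query.prems[of v] False by (auto simp: P_def fstate_root fplace_root split: option.split)
    then obtain u p where up: "P = u # p" "u < nv" by (cases P) auto
    obtain b bk where st: "fstate ?Z ?f P = Some (b, bk)" using P(3) by auto
    note al = alive_props[OF pf ZV(1)[OF up(2)] st[unfolded up(1)], folded up(1)]
    have b: "b \<in> Bs" using al(1,2) by (auto simp: Vs_def)
    have fP: "?f P = \<sigma> (?Z v)" using P(1,4) by (simp add: rf_def fplace_real)
    have oP: "fst (?o P) = deg b" by (simp add: fob_def st)
    have dg: "1 \<le> deg b" "deg b \<le> d" using deg_pos[OF b] .
    have q: "adj_query (adj \<pi> \<sigma>) v i = (if 1 \<le> i \<and> i \<le> deg b then Some (\<pi> (nbr (?Z v) (\<sigma> (?Z v) (i - 1)))) else None)"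
      using False al(2) P(4) by (auto simp: adj_query_def adj_def)
    have memP: "\<And>w Q. (mem(v \<mapsto> P)) w = Some Q \<Longrightarrow> Q \<noteq> [] \<and> hd Q < nv \<and> fstate ?Z ?f Q \<noteq> None \<and> fplace ?Z ?f Q = ?Z w"
      using Query.prems P by (auto split: if_splits)
    show ?thesis
    proof (cases "1 \<le> i \<and> i \<le> deg b")
      case False
      have "result (sim (Query v i k) mem) ?o = result (sim (k None) (mem(v \<mapsto> P))) ?o"
        using False oP dg \<open>\<not> nv \<le> v\<close> by (auto simp: P_def[symmetric] Let_def)
      moreover have "run (adj \<pi> \<sigma>) (k None) = result (sim (k None) (mem(v \<mapsto> P))) ?o"
        by (rule Query.IH[OF _ memP]) auto
      ultimately show ?thesis using q False by auto
    next
      case True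
      let ?a = "\<sigma> (?Z v) (i - 1)" and ?Q = "P @ [i - 1]"
      have "i - 1 < d" using True dg by linarith
      then have a: "?a < d" using permutes_in_image[OF vorders_permutes[OF \<sigma>], of "?Z v" "i - 1"] by simp
      have stQ: "fstate ?Z ?f ?Q = ch (Some (b, bk)) ?a" using fstate_snoc[OF P(1)] st fP by simp
      have plQ: "fplace ?Z ?f ?Q = nbr (?Z v) ?a" using fplace_snoc[OF P(1)] P(4) fP by simp
      have run: "run (adj \<pi> \<sigma>) (Query v i k) = run (adj \<pi> \<sigma>) (k (Some (\<pi> (nbr (?Z v) ?a))))"
        using q True by simp
      show ?thesis
      proof (cases "bk = Some (item b ?a)")
        case isb: True
        then have pne: "p \<noteq> []" using al(3) by auto
        have bP: "butlast P = u # butlast p" using pne up by simp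
        have par: "nbr (?Z v) ?a = fplace ?Z ?f (butlast P)"
          using al(4)[OF pne a isb] P(4) bP by simp
        have "\<exists>k'. P = butlast P @ [k']" using P(1) append_butlast_last_id by metis
        then obtain k' where k': "P = butlast P @ [k']" by blast
        have "fstate ?Z ?f (butlast P) \<noteq> None"
        proof
          assume "fstate ?Z ?f (butlast P) = None"
          then have "fstate ?Z ?f (butlast P @ [k']) = None" using fstate_snoc[of "butlast P"] bP by simp
          then show False using k' P(3) by simp
        qed
        then obtain b2 bk2 where st2: "fstate ?Z ?f (butlast P) = Some (b2, bk2)" by auto
        have "b2 \<in> Bs" using alive_props(1,2)[OF pf ZV(1)[OF up(2)] st2[unfolded bP]] by (auto simp: Vs_def)
        then have "ar (fstate ?Z ?f (butlast P)) \<noteq> 0" using deg_pos st2 by fastforce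
        then have o2: "snd (?o (butlast P)) = \<pi> (nbr (?Z v) ?a)"
          using lab[of "butlast P"] par bP up(2) by (simp add: fob_def)
        have "fstate ?Z ?f ?Q = None" unfolding stQ by (rule ch_back[OF isb])
        then have "fst (?o ?Q) = 0" by (simp add: fob_def)
        then have "result (sim (Query v i k) mem) ?o = result (sim (k (Some (\<pi> (nbr (?Z v) ?a)))) (mem(v \<mapsto> P))) ?o"
          using True oP dg \<open>\<not> nv \<le> v\<close> o2 pne up by (auto simp: P_def[symmetric] Let_def)
        moreover have "run (adj \<pi> \<sigma>) (k (Some (\<pi> (nbr (?Z v) ?a)))) = \<dots>"
          by (rule Query.IH[OF _ memP]) auto
        ultimately show ?thesis using run by simp
      next
        case nback: False
        have stQ': "fstate ?Z ?f ?Q = Some (fst (item b ?a), Some (b, snd (item b ?a)))"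
          using stQ a nback by simp
        have Qup: "?Q = u # (p @ [i - 1])" using up by simp
        note alQ = alive_props[OF pf ZV(1)[OF up(2)] stQ'[unfolded Qup], folded Qup]
        have "fst (item b ?a) \<in> Bs" using alQ(1,2) by (auto simp: Vs_def)
        then have "ar (fstate ?Z ?f ?Q) \<noteq> 0" using deg_pos stQ' by fastforce
        then have oQ: "fst (?o ?Q) \<noteq> 0" "snd (?o ?Q) = \<pi> (nbr (?Z v) ?a)"
          using lab[of ?Q] up plQ by (auto simp: fob_def)
        have memQ: "\<And>w Q. (mem(v \<mapsto> P, \<pi> (nbr (?Z v) ?a) \<mapsto> ?Q)) w = Some Q \<Longrightarrow> Q \<noteq> [] \<and> hd Q < nv \<and> fstate ?Z ?f Q \<noteq> None \<and> fplace ?Z ?f Q = ?Z w"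
        proof -
          fix w Q assume asm: "(mem(v \<mapsto> P, \<pi> (nbr (?Z v) ?a) \<mapsto> ?Q)) w = Some Q"
          show "Q \<noteq> [] \<and> hd Q < nv \<and> fstate ?Z ?f Q \<noteq> None \<and> fplace ?Z ?f Q = ?Z w"
          proof (cases "w = \<pi> (nbr (?Z v) ?a)")
            case True
            then have "Q = ?Q" using asm by simp
            then show ?thesis using up stQ' plQ Z\<pi> alQ(1) True by simp
          next
            case False
            then show ?thesis using memP[of w Q] asm by simp
          qed
        qed
        have "result (sim (Query v i k) mem) ?o = result (sim (k (Some (\<pi> (nbr (?Z v) ?a))))
            (mem(v \<mapsto> P, \<pi> (nbr (?Z v) ?a) \<mapsto> ?Q))) ?o"
          using True oP dg \<open>\<not> nv \<le> v\<close> oQ by (auto simp: P_def[symmetric] Let_def)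
        moreover have "run (adj \<pi> \<sigma>) (k (Some (\<pi> (nbr (?Z v) ?a)))) = \<dots>"
          by (rule Query.IH[OF _ memQ]) auto
        ultimately show ?thesis using run by simp
      qed
    qed
  qed
qed simp

section \<open>Orderly explorers\<close>

definition known :: "(nat list \<Rightarrow> nat option) \<Rightarrow> nat list \<Rightarrow> nat \<times> nat \<Rightarrow> nat list \<Rightarrow> nat option" where
  "known M p y = (if fst y = 0 \<or> p \<in> dom M then M else M(p \<mapsto> (if length p = 1 then hd p else snd y)))"

text \<open>An explorer that knows \<open>M\<close>, that is, the labels of certain nodes, is orderly if it only visits
  known nodes, their children, and roots whose labels it has not met.\<close>

primrec orderly :: "(nat \<times> nat) explorer \<Rightarrow> (nat list \<Rightarrow> nat option) \<Rightarrow> bool" where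
  "orderly (Stop x) M = True"
| "orderly (Visit p c) M = ((p \<in> dom M \<or> (\<exists>u<nv. p = [u] \<and> u \<notin> ran M) \<or>
       (\<exists>q k. q \<in> dom M \<and> k < d \<and> p = q @ [k]))
     \<and> (\<forall>y. orderly (c y) (known M p y)))"

definition tidy :: "(nat list \<Rightarrow> nat option) \<Rightarrow> bool" where
  "tidy M \<longleftrightarrow> (\<forall>q\<in>dom M. (\<exists>u<nv. q = [u]) \<or> (\<exists>q' k. q' \<in> dom M \<and> k < d \<and> q = q' @ [k]))"

lemma tidy_ne: "tidy M \<Longrightarrow> q \<in> dom M \<Longrightarrow> q \<noteq> []"
  by (auto simp: tidy_def)

lemma tidy_known:
  assumes "tidy M" "p \<in> dom M \<or> (\<exists>u<nv. p = [u] \<and> u \<notin> ran M) \<or> (\<exists>q k. q \<in> dom M \<and> k < d \<and> p = q @ [k])"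
  shows "tidy (known M p y)"
  using assms by (auto simp: tidy_def known_def)

text \<open>A root is opened only for a label without an entry in \<open>mem\<close>, and every
  label met has an entry; so a new root never repeats a label already seen.\<close>

lemma orderly_sim:
  assumes "tidy M" "\<And>w P. mem w = Some P \<Longrightarrow> P \<in> dom M" "\<And>w. w \<in> ran M \<Longrightarrow> mem w \<noteq> None"
  shows "orderly (sim S mem) M"
  using assms
proof (induction S arbitrary: mem M)
  case (Query v i k)
  show ?case
  proof (cases "nv \<le> v")
    case True
    then show ?thesis using Query.IH[OF _ Query.prems] by simp
  next
    case False
    define P where "P = (case mem v of None \<Rightarrow> [v] | Some P \<Rightarrow> P)"
    have P: "P \<in> dom M \<or> (\<exists>u<nv. P = [u] \<and> u \<notin> ran M) \<or> (\<exists>q k. q \<in> dom M \<and> k < d \<and> P = q @ [k])"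
      using Query.prems(2,3)[of v] False by (auto simp: P_def split: option.split)
    have PM: "P \<in> dom M \<or> P = [v] \<and> mem v = None"
      using Query.prems(2)[of v] by (auto simp: P_def split: option.split)
    show ?thesis
      unfolding sim.simps if_not_P[OF False] Let_def P_def[symmetric]
      unfolding orderly.simps(2)
    proof (intro conjI P allI)
      fix y :: "nat \<times> nat"
      define M1 where "M1 = known M P y"
      have t1: "tidy M1" unfolding M1_def by (rule tidy_known[OF Query.prems(1) P])
      show "orderly (if 1 \<le> i \<and> i \<le> fst y \<and> i \<le> d
        then Visit (P @ [i - 1]) (\<lambda>y'. if fst y' = 0
          then (if length P = 1 then Stop None
                else Visit (butlast P) (\<lambda>y''. sim (k (Some (snd y''))) (mem(v \<mapsto> P))))
          else sim (k (Some (snd y'))) (mem(v \<mapsto> P, snd y' \<mapsto> P @ [i - 1])))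
        else sim (k None) (if fst y = 0 then mem else mem(v \<mapsto> P))) (known M P y)"
      proof (cases "fst y = 0")
        case True
        then have "known M P y = M" by (simp add: known_def)
        then show ?thesis using True Query.IH[OF _ Query.prems] by auto
      next
        case False
        have PM1: "P \<in> dom M1" and M_M1: "dom M \<subseteq> dom M1" using False by (auto simp: M1_def known_def)
        have ran1: "w \<in> ran M1 \<Longrightarrow> w \<in> ran M \<or> w = v" for w
          using PM by (auto simp: M1_def known_def ran_def split: if_splits)
        have mem1: "\<And>w Q. (mem(v \<mapsto> P)) w = Some Q \<Longrightarrow> Q \<in> dom M1"
          subgoal for w Q using Query.prems(2)[of w Q] M_M1 PM1 by (cases "w = v") auto
          done
        have ranm: "\<And>w. w \<in> ran M1 \<Longrightarrow> (mem(v \<mapsto> P)) w \<noteq> None"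
          subgoal for w using Query.prems(3)[of w] ran1[of w] by (cases "w = v") auto
          done
        have IH1: "orderly (sim (k x) (mem(v \<mapsto> P))) M1" for x
          by (rule Query.IH[OF _ t1 mem1 ranm]) auto
        show ?thesis
        proof (cases "1 \<le> i \<and> i \<le> fst y \<and> i \<le> d")
          case False
          show ?thesis unfolding if_not_P[OF False] using \<open>fst y \<noteq> 0\<close> IH1 by (simp add: M1_def)
        next
          case True
          have Q: "P @ [i - 1] \<in> dom M1 \<or> (\<exists>u<nv. P @ [i - 1] = [u] \<and> u \<notin> ran M1) \<or> (\<exists>q k. q \<in> dom M1 \<and> k < d \<and> P @ [i - 1] = q @ [k])"
          proof -
            have "i - 1 < d" using True by linarith
            then show ?thesis using PM1 by blast
          qed
          have "orderly (if fst y' = 0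
            then (if length P = 1 then Stop None
                  else Visit (butlast P) (\<lambda>y''. sim (k (Some (snd y''))) (mem(v \<mapsto> P))))
            else sim (k (Some (snd y'))) (mem(v \<mapsto> P, snd y' \<mapsto> P @ [i - 1]))) (known M1 (P @ [i - 1]) y')" for y'
          proof (cases "fst y' = 0")
            case True
            have k1: "known M1 (P @ [i - 1]) y' = M1" using True by (simp add: known_def)
            have bd: "butlast P \<in> dom M1" if "length P \<noteq> 1"
            proof -
              have "(\<exists>u<nv. P = [u]) \<or> (\<exists>q' k. q' \<in> dom M1 \<and> k < d \<and> P = q' @ [k])"
                using t1 PM1 unfolding tidy_def by (rule bspec)
              then consider u where "P = [u]" | q' k where "q' \<in> dom M1" "P = q' @ [k]" by blast
              then show ?thesis
              proof cases
                case 1 then show ?thesis using that by simp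
              next
                case 2 then show ?thesis by (simp only: butlast_snoc)
              qed
            qed
            then have "known M1 (butlast P) y'' = M1" if "length P \<noteq> 1" for y''
              using that by (simp add: known_def)
            then show ?thesis unfolding k1 if_P[OF True] using bd IH1 by simp
          next
            case nz: False
            define M2 where "M2 = known M1 (P @ [i - 1]) y'"
            have t2: "tidy M2" unfolding M2_def by (rule tidy_known[OF t1 Q])
            have d2: "P @ [i - 1] \<in> dom M2" "dom M1 \<subseteq> dom M2" using nz by (auto simp: M2_def known_def)
            have r2: "w \<in> ran M2 \<Longrightarrow> w \<in> ran M1 \<or> w = snd y'" for w
              using tidy_ne[OF t1 PM1] by (auto simp: M2_def known_def ran_def split: if_splits)
            have "orderly (sim (k (Some (snd y'))) (mem(v \<mapsto> P, snd y' \<mapsto> P @ [i - 1]))) M2"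
            proof (rule Query.IH[OF _ t2])
              show "Q \<in> dom M2" if "(mem(v \<mapsto> P, snd y' \<mapsto> P @ [i - 1])) w = Some Q" for w Q
                using that mem1[of w Q] d2 by (auto split: if_splits)
              show "(mem(v \<mapsto> P, snd y' \<mapsto> P @ [i - 1])) w \<noteq> None" if "w \<in> ran M2" for w
                using r2[OF that] ranm[of w] by (auto split: if_splits)
            qed auto
            then show ?thesis using nz by (simp add: M2_def)
          qed
          then show ?thesis unfolding if_P[OF True] M1_def[symmetric] using Q by simp
        qed
      qed
    qed
  qed
qed simp

end

declare split_paired_All [simp del] split_paired_Ex [simp del]

section \<open>Counting with prescribed values\<close>

primrec vb :: "'o explorer \<Rightarrow> nat \<Rightarrow> bool" where
  "vb (Stop x) T = True"
| "vb (Visit p c) T = (0 < T \<and> (\<forall>y. vb (c y) (T - 1)))"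

lemma card_cylinder:
  assumes fin: "finite A" and B: "\<And>x. x \<in> A \<Longrightarrow> finite (B x)" and V: "V \<subseteq> A" "\<And>x. x \<in> V \<Longrightarrow> f0 x \<in> B x"
  shows "card {f \<in> PiE_dflt A dflt B. \<forall>x\<in>V. f x = f0 x} * (\<Prod>x\<in>V. card (B x)) = card (PiE_dflt A dflt B)"
proof -
  have "{f \<in> PiE_dflt A dflt B. \<forall>x\<in>V. f x = f0 x} = PiE_dflt A dflt (\<lambda>x. if x \<in> V then {f0 x} else B x)"
  proof (intro equalityI subsetI)
    fix f assume "f \<in> PiE_dflt A dflt (\<lambda>x. if x \<in> V then {f0 x} else B x)"
    then have f: "\<And>x. x \<in> A \<Longrightarrow> f x \<in> (if x \<in> V then {f0 x} else B x)" "\<And>x. x \<notin> A \<Longrightarrow> f x = dflt"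
      by (auto simp only: PiE_dflt_def mem_Collect_eq)
    have "f x = f0 x" if "x \<in> V" for x using f(1)[of x] that V(1) by auto
    moreover have "f x \<in> B x" if "x \<in> A" for x using f(1)[of x] that V by (cases "x \<in> V") auto
    ultimately show "f \<in> {f \<in> PiE_dflt A dflt B. \<forall>x\<in>V. f x = f0 x}" using f(2)
      by (simp only: PiE_dflt_def mem_Collect_eq) blast
  next
    fix f assume "f \<in> {f \<in> PiE_dflt A dflt B. \<forall>x\<in>V. f x = f0 x}"
    then show "f \<in> PiE_dflt A dflt (\<lambda>x. if x \<in> V then {f0 x} else B x)"
      by (auto simp only: PiE_dflt_def mem_Collect_eq split: if_splits)
  qed
  moreover have "card (PiE_dflt A dflt (\<lambda>x. if x \<in> V then {f0 x} else B x)) = (\<Prod>x\<in>A - V. card (B x))"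
  proof -
    have "card (PiE_dflt A dflt (\<lambda>x. if x \<in> V then {f0 x} else B x)) = (\<Prod>x\<in>A. card (if x \<in> V then {f0 x} else B x))"
      using fin B by (intro card_PiE_dflt) auto
    also have "\<dots> = (\<Prod>x\<in>A - V. card (if x \<in> V then {f0 x} else B x)) * (\<Prod>x\<in>V. card (if x \<in> V then {f0 x} else B x))"
      by (rule prod.subset_diff[OF V(1) fin])
    finally show ?thesis by simp
  qed
  moreover have "card (PiE_dflt A dflt B) = (\<Prod>x\<in>A - V. card (B x)) * (\<Prod>x\<in>V. card (B x))"
    using card_PiE_dflt[of A B dflt] fin B prod.subset_diff[OF V(1) fin, of "\<lambda>x. card (B x)"] by simp
  ultimately show ?thesis by simp
qed

text \<open>Prescribing k values of a random bijection has probability 1 / (m (m - 1) ... (m - k +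
  1)), which is at least 1 / m ^ k. In the induction, composing with a transposition shows that the
  prescribed value at \<open>a\<close> is at least as frequent as any other.\<close>

lemma card_bijections_cylinder:
  fixes m :: nat
  assumes fin: "finite V" and A: "A \<subseteq> V" "inj_on f A" "f ` A \<subseteq> {..<m}"
  defines "B \<equiv> {\<pi> \<in> extensional V. bij_betw \<pi> V {..<m}}"
  shows "card B \<le> card {\<pi> \<in> B. \<forall>v\<in>A. \<pi> v = f v} * m ^ card A"
proof -
  have finB: "finite B"
    by (rule finite_subset[of _ "PiE V (\<lambda>_. {..<m})"]) (auto simp: B_def PiE_def bij_betw_def finite_PiE[unfolded PiE_def] fin)
  have "finite A" using A(1) fin finite_subset by blast
  then show ?thesis using A
  proof (induction A rule: finite_induct)
    case (insert a A)
    let ?P = "{\<pi> \<in> B. \<forall>v\<in>A. \<pi> v = f v}"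
    have IH: "card B \<le> card ?P * m ^ card A" using insert by (intro insert.IH) auto
    have "card ?P \<le> card (\<Union>w<m. {\<pi> \<in> ?P. \<pi> a = w})"
    proof (rule card_mono)
      show "finite (\<Union>w<m. {\<pi> \<in> ?P. \<pi> a = w})" using finB by simp
      have "\<pi> a < m" if "\<pi> \<in> B" for \<pi>
      proof -
        have "bij_betw \<pi> V {..<m}" using that by (simp add: B_def)
        then show ?thesis using insert.prems(1) bij_betwE by blast
      qed
      then show "?P \<subseteq> (\<Union>w<m. {\<pi> \<in> ?P. \<pi> a = w})" by auto
    qed
    also have "\<dots> \<le> (\<Sum>w<m. card {\<pi> \<in> ?P. \<pi> a = w})" by (rule card_UN_le) simp
    also have "\<dots> \<le> (\<Sum>w<m. card {\<pi> \<in> ?P. \<pi> a = f a})"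
    proof (rule sum_mono)
      fix w assume w: "w \<in> {..<m}"
      define T where "T \<pi> = restrict (Transposition.transpose w (f a) \<circ> \<pi>) V" for \<pi> :: "'a \<Rightarrow> nat"
      have fa: "f a < m" "a \<in> V" using insert.prems by auto
      show "card {\<pi> \<in> ?P. \<pi> a = w} \<le> card {\<pi> \<in> ?P. \<pi> a = f a}"
      proof (rule card_inj_on_le)
        show "finite {\<pi> \<in> ?P. \<pi> a = f a}" using finB by simp
        show "T ` {\<pi> \<in> ?P. \<pi> a = w} \<subseteq> {\<pi> \<in> ?P. \<pi> a = f a}"
        proof (rule image_subsetI)
          fix \<pi> assume "\<pi> \<in> {\<pi> \<in> ?P. \<pi> a = w}"
          then have \<pi>: "\<pi> \<in> B" "\<forall>v\<in>A. \<pi> v = f v" "w = \<pi> a" by auto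
          have bij: "bij_betw \<pi> V {..<m}" using \<pi> by (simp add: B_def)
          have "bij_betw (Transposition.transpose w (f a)) {..<m} {..<m}"
            using w fa by (intro permutes_imp_bij permutes_swap_id) auto
          from bij_betw_trans[OF bij this] have "bij_betw (T \<pi>) V {..<m}"
            unfolding T_def by (subst bij_betw_cong[of V _ "Transposition.transpose w (f a) \<circ> \<pi>"]) auto
          moreover have "T \<pi> v = f v" if "v \<in> A" for v
          proof -
            have v: "v \<in> V" "v \<noteq> a" using that insert by auto
            have "f v \<noteq> f a" using insert.prems(2) insert.hyps that by (auto simp: inj_on_def)
            moreover have "\<pi> v \<noteq> w" using bij v fa \<pi>(3) by (auto simp: bij_betw_def inj_on_def)
            ultimately show ?thesis using \<pi>(2) that v by (simp add: T_def Transposition.transpose_def)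
          qed
          ultimately show "T \<pi> \<in> {\<pi> \<in> ?P. \<pi> a = f a}"
            using \<pi>(3) fa by (auto simp: B_def T_def)
        qed
        show "inj_on T {\<pi> \<in> ?P. \<pi> a = w}"
        proof (rule inj_onI)
          fix \<pi> \<rho> assume h: "\<pi> \<in> {\<pi> \<in> ?P. \<pi> a = w}" "\<rho> \<in> {\<pi> \<in> ?P. \<pi> a = w}" "T \<pi> = T \<rho>"
          have "\<pi> v = \<rho> v" for v
          proof (cases "v \<in> V")
            case True
            then have "Transposition.transpose w (f a) (\<pi> v) = Transposition.transpose w (f a) (\<rho> v)"
              using fun_cong[OF h(3), of v] by (simp add: T_def)
            then show ?thesis by (metis transpose_involutory)
          next
            case False
            then show ?thesis using h by (auto simp: B_def extensional_def)
          qed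
          then show "\<pi> = \<rho>" by blast
        qed
      qed
    qed
    also have "\<dots> = m * card {\<pi> \<in> B. \<forall>v\<in>insert a A. \<pi> v = f v}"
    proof -
      have "{\<pi> \<in> ?P. \<pi> a = f a} = {\<pi> \<in> B. \<forall>v\<in>insert a A. \<pi> v = f v}" by auto
      then show ?thesis by simp
    qed
    finally have "card ?P * m ^ card A \<le> (m * card {\<pi> \<in> B. \<forall>v\<in>insert a A. \<pi> v = f v}) * m ^ card A"
      by (rule mult_le_mono1)
    moreover have "card (insert a A) = Suc (card A)" using insert.hyps by simp
    ultimately show ?case using order_trans[OF IH] by (simp only: power_Suc ac_simps)
  qed simp
qed

text \<open>Good samples are covered by the classes of their keys, and the real classes of distinct
  keys are disjoint, so the classwise inequalities add up. This carries the probability of a good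
  transcript from the ideal model over to the real one.\<close>

lemma key_domination:
  fixes kI :: "'s \<Rightarrow> 'k" and kR :: "'r \<Rightarrow> 'k"
  assumes fin: "finite I" "finite R" "Good \<subseteq> I"
    and le: "\<And>s. s \<in> Good \<Longrightarrow> card {t \<in> I. kI t = kI s} * card R \<le> card {r \<in> R. kR r = kI s} * card I"
  shows "card Good * card R \<le> card {r \<in> R. kR r \<in> kI ` Good} * card I"
proof -
  have fG: "finite Good" using fin finite_subset by blast
  have "Good \<subseteq> (\<Union>k\<in>kI ` Good. {t \<in> I. kI t = k})" using fin(3) by auto
  then have "card Good \<le> card (\<Union>k\<in>kI ` Good. {t \<in> I. kI t = k})"
    using fin fG by (intro card_mono) auto
  also have "\<dots> \<le> (\<Sum>k\<in>kI ` Good. card {t \<in> I. kI t = k})" using fG by (intro card_UN_le) auto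
  finally have "card Good * card R \<le> (\<Sum>k\<in>kI ` Good. card {t \<in> I. kI t = k} * card R)"
    unfolding sum_distrib_right[symmetric] by (rule mult_le_mono1)
  also have "\<dots> \<le> (\<Sum>k\<in>kI ` Good. card {r \<in> R. kR r = k} * card I)"
    using le by (intro sum_mono) auto
  also have "\<dots> = card (\<Union>k\<in>kI ` Good. {r \<in> R. kR r = k}) * card I"
    unfolding sum_distrib_right[symmetric] using fin fG by (subst card_UN_disjoint) auto
  also have "(\<Union>k\<in>kI ` Good. {r \<in> R. kR r = k}) = {r \<in> R. kR r \<in> kI ` Good}" by auto
  finally show ?thesis .
qed

lemma visited_cong:
  "(\<And>p. p \<in> visited e ob \<Longrightarrow> ob' p = ob p) \<Longrightarrow> visited e ob' = visited e ob \<and> result e ob' = result e ob"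
  by (induction e) auto

lemma vb_visits: "vb e T \<Longrightarrow> visits e ob \<le> T"
proof (induction e arbitrary: T)
  case (Visit p c)
  then have "visits (c (ob p)) ob \<le> T - 1" "0 < T" by auto
  then show ?case by simp
qed simp

lemma finite_visited: "finite (visited e ob)"
  by (induction e) auto

lemma card_visited: "card (visited e ob) \<le> visits e ob"
  by (induction e) (auto simp: card_insert_if finite_visited intro: le_SucI)

lemma depth_le_visited: "depth_le L e \<Longrightarrow> p \<in> visited e ob \<Longrightarrow> length p \<le> L"
  by (induction e) auto

definition alive :: "(nat \<times> nat) explorer \<Rightarrow> (nat list \<Rightarrow> nat \<times> nat) \<Rightarrow> nat list set" where
  "alive e ob = {q \<in> visited e ob. fst (ob q) \<noteq> 0}"

lemma finite_alive: "finite (alive e ob)"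
  by (simp add: alive_def finite_visited)

lemma card_alive: "vb e T \<Longrightarrow> card (alive e ob) \<le> T"
  using card_mono[OF finite_visited, of "alive e ob" e ob] card_visited[of e ob] vb_visits[of e T ob]
  by (auto simp: alive_def)

section \<open>Comparison of the ideal model with the real graph\<close>

context lift
begin

lemma orderly_parent:
  "orderly e M \<Longrightarrow> q \<in> visited e ob \<Longrightarrow> q \<in> dom M \<or> (\<exists>u<nv. q = [u]) \<or>
     (\<exists>q' k. q' \<in> dom M \<union> alive e ob \<and> k < d \<and> q = q' @ [k])"
proof (induction e arbitrary: M)
  case (Visit p c)
  show ?case
  proof (cases "q = p")
    case True
    then show ?thesis using Visit.prems(1) by auto
  next
    case False
    let ?M = "known M p (ob p)"
    have o: "orderly (c (ob p)) ?M" and q: "q \<in> visited (c (ob p)) ob" using Visit.prems False by auto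
    have "dom ?M \<subseteq> dom M \<union> alive (Visit p c) ob" by (auto simp: known_def alive_def)
    then have sub: "dom ?M \<union> alive (c (ob p)) ob \<subseteq> dom M \<union> alive (Visit p c) ob"
      by (auto simp: alive_def)
    have "dom ?M \<subseteq> insert p (dom M)" by (auto simp: known_def)
    then consider "q \<in> dom ?M" | u where "u < nv" "q = [u]"
      | q' k where "q' \<in> dom ?M \<union> alive (c (ob p)) ob" "k < d" "q = q' @ [k]"
      using Visit.IH[OF _ o q] by blast
    then show ?thesis
    proof cases
      case 1 then show ?thesis using \<open>dom ?M \<subseteq> insert p (dom M)\<close> False by blast
    next
      case 2 then show ?thesis by blast
    next
      case 3 then have "q' \<in> dom M \<union> alive (Visit p c) ob" using sub by blast
      then show ?thesis using 3 by blast
    qed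
  qed
qed simp

lemma orderly_depth_le:
  "orderly e M \<Longrightarrow> vb e T \<Longrightarrow> (\<And>q. q \<in> dom M \<Longrightarrow> length q \<le> m) \<Longrightarrow> depth_le (m + T) e"
proof (induction e arbitrary: M T m)
  case (Visit p c)
  have T: "0 < T" using Visit.prems(2) by simp
  have p: "length p \<le> Suc m"
    using Visit.prems(1,3) by fastforce
  have "depth_le (Suc m + (T - 1)) (c y)" for y
  proof (rule Visit.IH[of "c y" "known M p y"])
    show "length q \<le> Suc m" if "q \<in> dom (known M p y)" for q
      using that p Visit.prems(3)[of q] by (fastforce simp: known_def split: if_splits)
  qed (use Visit.prems in auto)
  then show ?case using p T by simp
qed simp

definition forest :: "nat \<Rightarrow> nat list set" where
  "forest L = {q. q \<noteq> [] \<and> hd q < nv \<and> tl q \<in> paths d (Suc L)}"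

lemma forest_Cons: "u # p \<in> forest L \<longleftrightarrow> u < nv \<and> p \<in> paths d (Suc L)"
  by (simp add: forest_def)

lemma finite_forest: "finite (forest L)"
proof -
  have "q \<in> (\<lambda>(u, p). u # p) ` ({..<nv} \<times> paths d (Suc L))" if "q \<in> forest L" for q
    using that by (intro rev_image_eqI[of "(hd q, tl q)"]) (auto simp: forest_def)
  then have "forest L \<subseteq> (\<lambda>(u, p). u # p) ` ({..<nv} \<times> paths d (Suc L))" by blast
  then show ?thesis by (rule finite_subset) (simp add: finite_paths)
qed

definition ZS :: "(nat \<Rightarrow> 'g \<times> bool \<times> 'b) set" where "ZS = PiE_dflt {..<nv} undefined (\<lambda>_. Vs)"
definition FS :: "nat \<Rightarrow> port_orders set" where
  "FS L = PiE_dflt (forest L) id (\<lambda>_. {s. s permutes {..<d}})"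
definition LS :: "nat \<Rightarrow> (nat list \<Rightarrow> nat) set" where
  "LS L = PiE_dflt {q \<in> forest L. length q \<noteq> 1} 0 (\<lambda>_. {..<nv})"

definition samples where "samples L = ZS \<times> FS L \<times> LS L"

lemma ZS_Vs: "Z \<in> ZS \<Longrightarrow> u < nv \<Longrightarrow> Z u \<in> Vs"
  unfolding ZS_def PiE_dflt_def by blast

lemma FS_permutes: "f \<in> FS L \<Longrightarrow> f q permutes {..<d}"
  unfolding FS_def PiE_dflt_def using permutes_id by (cases "q \<in> forest L") auto

lemma finite_ZS: "finite ZS" unfolding ZS_def by (intro finite_PiE_dflt) (auto simp: finite_Vs)
lemma finite_FS: "finite (FS L)" unfolding FS_def
  by (intro finite_PiE_dflt) (auto simp: finite_forest finite_permutations)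
lemma finite_LS: "finite (LS L)" unfolding LS_def by (intro finite_PiE_dflt) (auto simp: finite_forest)

lemma finite_samples: "finite (samples L)"
  by (simp add: samples_def finite_ZS finite_FS finite_LS)

text \<open>The transcript of a run: address, place, order and label of each live node visited. It
  determines the whole run, including which visited nodes are dead.\<close>

definition key where
  "key e Z f l = (\<lambda>q. (q, fplace Z f q, f q, flab l q)) ` alive e (fob Z f l)"

context
  fixes e :: "(nat \<times> nat) explorer" and L :: nat
  assumes e: "orderly e Map.empty" "vb e L"
begin

lemma visited_parent:
  "q \<in> visited e ob \<Longrightarrow> (\<exists>u<nv. q = [u]) \<or> (\<exists>q' k. q' \<in> alive e ob \<and> k < d \<and> q = q' @ [k])"
  using orderly_parent[OF e(1)] by auto

lemma visited_forest:
  assumes "q \<in> visited e ob" shows "q \<in> forest L"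
proof -
  have "depth_le (0 + L) e" by (rule orderly_depth_le[OF e]) simp
  then have len: "length q \<le> L" if "q \<in> visited e ob" for q
    using that by (simp add: depth_le_visited)
  have "q \<noteq> [] \<and> hd q < nv \<and> set (tl q) \<subseteq> {..<d}"
    using assms
  proof (induction "length q" arbitrary: q rule: less_induct)
    case less
    consider u where "u < nv" "q = [u]" | q' k where "q' \<in> alive e ob" "k < d" "q = q' @ [k]"
      using visited_parent[OF less.prems] by blast
    then show ?case
    proof cases
      case 2
      have "q' \<in> visited e ob" using 2 by (simp add: alive_def)
      from less.hyps[OF _ this] 2 show ?thesis by (cases q') auto
    qed simp
  qed
  then show ?thesis using len[OF assms] by (auto simp: forest_def paths_def)
qed

text \<open>The state of a node is computed from the state and the order of its parent, and the
  parent of a visited node that is not a root is itself visited and live. Hence induction on the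
  length of the address.\<close>

lemma agree_fob:
  assumes Z: "\<And>u. u < nv \<Longrightarrow> Z u \<in> Vs"
    and ag: "\<And>q. q \<in> alive e (fob Z f l) \<Longrightarrow>
      (length q = 1 \<longrightarrow> Z' (hd q) = Z (hd q)) \<and> f' q = f q \<and> flab l' q = flab l q"
    and q: "q \<in> visited e (fob Z f l)"
  shows "fstate Z' f' q = fstate Z f q \<and> fob Z' f' l' q = fob Z f l q \<and> fplace Z' f' q = fplace Z f q"
  using q
proof (induction "length q" arbitrary: q rule: less_induct)
  case less
  have *: "fob Z' f' l' q = fob Z f l q" if "fstate Z' f' q = fstate Z f q"
    using that ag[of q] less.prems by (auto simp: fob_def alive_def)
  consider u where "u < nv" "q = [u]" | q' k where "q' \<in> alive e (fob Z f l)" "k < d" "q = q' @ [k]"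
    using visited_parent[OF less.prems] by blast
  then show ?case
  proof cases
    case 1
    have "base (Z u) \<in> Bs" using Z[OF 1(1)] by (auto simp: Vs_def)
    then have "fst (fob Z f l q) \<noteq> 0" using 1 deg_pos(1) by (fastforce simp: fob_def fstate_root)
    then have "q \<in> alive e (fob Z f l)" using less.prems by (simp add: alive_def)
    then have "Z' u = Z u" using ag[of q] 1 by simp
    then have "fstate Z' f' q = fstate Z f q" "fplace Z' f' q = fplace Z f q"
      using 1 by (simp_all add: fstate_root fplace_root)
    then show ?thesis using * by blast
  next
    case 2
    have v: "q' \<in> visited e (fob Z f l)" using 2 by (simp add: alive_def)
    have ne: "q' \<noteq> []" using visited_forest[OF v] by (simp add: forest_def)
    have "f' q' = f q'" using ag[OF 2(1)] by simp
    then have "fstate Z' f' q = fstate Z f q" "fplace Z' f' q = fplace Z f q"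
      using less.hyps[OF _ v] 2(3) by (simp_all add: fstate_snoc[OF ne] fplace_snoc[OF ne])
    then show ?thesis using * by blast
  qed
qed

lemma agree_key:
  assumes Z: "\<And>u. u < nv \<Longrightarrow> Z u \<in> Vs"
    and ag: "\<And>q. q \<in> alive e (fob Z f l) \<Longrightarrow>
      (length q = 1 \<longrightarrow> Z' (hd q) = Z (hd q)) \<and> f' q = f q \<and> flab l' q = flab l q"
  shows "key e Z' f' l' = key e Z f l"
proof -
  note A = agree_fob[OF Z ag]
  have "visited e (fob Z' f' l') = visited e (fob Z f l)"
    using visited_cong[of e "fob Z f l" "fob Z' f' l'"] A by blast
  then have "alive e (fob Z' f' l') = alive e (fob Z f l)" using A by (auto simp: alive_def)
  then show ?thesis using A ag unfolding key_def by (intro image_cong) (auto simp: alive_def)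
qed

lemma key_agree:
  assumes "key e Z' f' l' = key e Z f l"
  shows "alive e (fob Z' f' l') = alive e (fob Z f l)"
    "q \<in> alive e (fob Z f l) \<Longrightarrow> f' q = f q \<and> flab l' q = flab l q \<and> fplace Z' f' q = fplace Z f q"
proof -
  have "fst ` key e Z' f' l' = fst ` key e Z f l" using assms by simp
  then show D: "alive e (fob Z' f' l') = alive e (fob Z f l)"
    by (simp add: key_def image_image)
  show "f' q = f q \<and> flab l' q = flab l q \<and> fplace Z' f' q = fplace Z f q" if "q \<in> alive e (fob Z f l)"
  proof -
    have "(q, fplace Z f q, f q, flab l q) \<in> key e Z' f' l'"
      using that unfolding assms by (auto simp: key_def)
    then show ?thesis by (auto simp: key_def)
  qed
qed

lemma key_agree_root:
  assumes "key e Z' f' l' = key e Z f l" "[u] \<in> alive e (fob Z f l)"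
  shows "Z' u = Z u"
  using key_agree(2)[OF assms] by (simp add: fplace_root)

lemma key_result:
  assumes Z: "\<And>u. u < nv \<Longrightarrow> Z u \<in> Vs" and k: "key e Z' f' l' = key e Z f l"
  shows "result e (fob Z' f' l') = result e (fob Z f l)"
proof -
  have ag: "(length q = 1 \<longrightarrow> Z' (hd q) = Z (hd q)) \<and> f' q = f q \<and> flab l' q = flab l q"
    if "q \<in> alive e (fob Z f l)" for q
    using key_agree(2)[OF k that] key_agree_root[OF k, of "hd q"] that
    by (cases q) auto
  show ?thesis using visited_cong[of e "fob Z f l" "fob Z' f' l'"] agree_fob[OF Z ag] by blast
qed

text \<open>Every live node costs the same factor nv * d!: a root has nv choices for its vertex, any
  other node nv choices for its label, and both have d! orders.\<close>

lemma ideal_class: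
  assumes s: "(Z, f, l) \<in> samples L"
  defines "D \<equiv> alive e (fob Z f l)"
  shows "card {(Z', f', l') \<in> samples L. key e Z' f' l' = key e Z f l} * (nv * fact d) ^ card D \<le> card (samples L)"
proof -
  have Z: "Z \<in> ZS" "f \<in> FS L" "l \<in> LS L" using s by (auto simp: samples_def)
  have DF: "D \<subseteq> forest L" using visited_forest by (auto simp: D_def alive_def)
  define D1 where "D1 = {u. [u] \<in> D}"
  define D2 where "D2 = {q \<in> D. length q \<noteq> 1}"
  have fin: "finite D" by (simp add: D_def finite_alive)
  have D1': "{q \<in> D. length q = 1} = (\<lambda>u. [u]) ` D1"
    by (auto simp: D1_def length_Suc_conv)
  have cD: "card D = card D1 + card D2"
  proof -
    have "card D = card {q \<in> D. length q = 1} + card D2"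
      unfolding D2_def using fin by (subst card_Un_disjoint[symmetric]) (auto intro: arg_cong[where f = card])
    also have "card {q \<in> D. length q = 1} = card D1" unfolding D1' by (simp add: card_image inj_on_def)
    finally show ?thesis .
  qed
  let ?CZ = "{Z' \<in> ZS. \<forall>u\<in>D1. Z' u = Z u}" and ?CF = "{f' \<in> FS L. \<forall>q\<in>D. f' q = f q}"
    and ?CL = "{l' \<in> LS L. \<forall>q\<in>D2. l' q = l q}"
  have "D1 \<subseteq> {..<nv}" using DF by (auto simp: D1_def forest_def)
  then have cZ: "card ?CZ * nv ^ card D1 = card ZS"
    using card_cylinder[of "{..<nv}" "\<lambda>_. Vs" D1 Z undefined] finite_Vs ZS_Vs[OF Z(1)]
    by (auto simp: ZS_def nv_def)
  have cF: "card ?CF * fact d ^ card D = card (FS L)"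
    using card_cylinder[of "forest L" "\<lambda>_. {s. s permutes {..<d}}" D f id] DF FS_permutes[OF Z(2)] finite_forest
    by (simp add: FS_def finite_permutations card_permutations)
  have "l q < nv" if "q \<in> D2" for q
    using that DF Z(3) by (auto simp: D2_def LS_def PiE_dflt_def)
  then have cL: "card ?CL * nv ^ card D2 = card (LS L)"
    using card_cylinder[of "{q \<in> forest L. length q \<noteq> 1}" "\<lambda>_. {..<nv}" D2 l 0] DF finite_forest
    by (auto simp: LS_def D2_def)
  have "{(Z', f', l') \<in> samples L. key e Z' f' l' = key e Z f l} \<subseteq> ?CZ \<times> ?CF \<times> ?CL"
  proof (rule subsetI)
    fix t assume "t \<in> {(Z', f', l') \<in> samples L. key e Z' f' l' = key e Z f l}"
    then obtain Z' f' l' where t: "t = (Z', f', l')"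
      and m: "(Z', f', l') \<in> samples L" and k: "key e Z' f' l' = key e Z f l" by auto
    have "l' q = l q" if "q \<in> D2" for q
      using key_agree(2)[OF k, of q] that by (simp add: D2_def D_def flab_def)
    then show "t \<in> ?CZ \<times> ?CF \<times> ?CL"
      using m key_agree(2)[OF k] key_agree_root[OF k] by (auto simp: t samples_def D1_def D_def)
  qed
  then have "card {(Z', f', l') \<in> samples L. key e Z' f' l' = key e Z f l} \<le> card (?CZ \<times> ?CF \<times> ?CL)"
    by (intro card_mono) (auto simp: finite_ZS finite_FS finite_LS)
  also have "\<dots> = card ?CZ * (card ?CF * card ?CL)" by (simp add: card_cartesian_product)
  finally have "card {(Z', f', l') \<in> samples L. key e Z' f' l' = key e Z f l} * (nv * fact d) ^ card D
      \<le> card ?CZ * (card ?CF * card ?CL) * (nv * fact d) ^ card D" by (rule mult_le_mono1)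
  also have "\<dots> = (card ?CZ * nv ^ card D1) * ((card ?CF * fact d ^ card D) * (card ?CL * nv ^ card D2))"
    by (simp add: cD power_add power_mult_distrib algebra_simps)
  also have "\<dots> = card (samples L)" unfolding cZ cF cL by (simp add: samples_def card_cartesian_product)
  finally show ?thesis .
qed

text \<open>With distinct places and distinct labels, the transcript prescribes \<open>\<pi>\<close>
  and \<open>\<sigma>\<close> at \<open>card D\<close> vertices, and values of a bijection are met
  at least as often as independent ones. The places themselves then come out right step by step
  along the addresses.\<close>

lemma real_class:
  assumes s: "(Z, f, l) \<in> samples L"
  defines "D \<equiv> alive e (fob Z f l)"
  assumes pl: "inj_on (fplace Z f) D" and lb: "inj_on (flab l) D"
  shows "card (labellings \<times> vorders) \<le> card {(\<pi>, \<sigma>) \<in> labellings \<times> vorders.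
      key e (rZ \<pi>) (rf \<pi> \<sigma>) (rl \<pi> \<sigma>) = key e Z f l} * (nv * fact d) ^ card D"
proof -
  have Z: "Z \<in> ZS" "f \<in> FS L" "l \<in> LS L" using s by (auto simp: samples_def)
  have ZV: "\<And>u. u < nv \<Longrightarrow> Z u \<in> Vs" using ZS_Vs[OF Z(1)] .
  have DF: "D \<subseteq> forest L" using visited_forest by (auto simp: D_def alive_def)
  have fin: "finite D" by (simp add: D_def finite_alive)
  have DV: "fplace Z f q \<in> Vs" if "q \<in> D" for q
  proof -
    have "q \<in> forest L" using that DF by blast
    then obtain u p where up: "q = u # p" "u < nv" by (cases q) (auto simp: forest_def)
    have "fstate Z f q \<noteq> None"
      using that by (cases "fstate Z f q") (auto simp: D_def alive_def fob_def)
    then obtain b bk where "fstate Z f (u # p) = Some (b, bk)" using up(1) by auto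
    with FS_permutes[OF Z(2)] ZV[OF up(2)] have "fplace Z f (u # p) \<in> Vs" by (rule alive_props(1))
    then show ?thesis using up(1) by simp
  qed
  have Dl: "flab l q < nv" if "q \<in> D" for q
  proof -
    have "q \<in> forest L" using that DF by blast
    then show ?thesis using Z(3) by (cases "length q = 1") (auto simp: flab_def forest_def LS_def PiE_dflt_def)
  qed
  let ?g = "inv_into D (fplace Z f)"
  let ?A = "fplace Z f ` D"
  have g: "?g (fplace Z f q) = q" if "q \<in> D" for q using pl that by simp
  define a where "a v = flab l (?g v)" for v
  define b where "b v = f (?g v)" for v
  have cA: "card ?A = card D" using pl by (rule card_image)
  let ?Cp = "{\<pi> \<in> labellings. \<forall>v\<in>?A. \<pi> v = a v}" and ?Cs = "{\<sigma> \<in> vorders. \<forall>v\<in>?A. \<sigma> v = b v}"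
  have cp: "card labellings \<le> card ?Cp * nv ^ card D"
    unfolding cA[symmetric] labellings_def
  proof (rule card_bijections_cylinder[OF finite_Vs])
    show "?A \<subseteq> Vs" using DV by auto
    show "a ` ?A \<subseteq> {..<nv}" using Dl g by (auto simp: a_def)
    show "inj_on a ?A" using lb g by (auto simp: a_def inj_on_def)
  qed
  have cs: "card ?Cs * fact d ^ card D = card vorders"
    unfolding vorders_def
    using card_cylinder[of Vs "\<lambda>_. {s. s permutes {..<d}}" ?A b id] finite_Vs DV g FS_permutes[OF Z(2)] cA
    by (auto simp: finite_permutations card_permutations b_def)
  have sub: "?Cp \<times> ?Cs \<subseteq> {(\<pi>, \<sigma>) \<in> labellings \<times> vorders. key e (rZ \<pi>) (rf \<pi> \<sigma>) (rl \<pi> \<sigma>) = key e Z f l}"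
  proof (rule subsetI)
    fix r assume "r \<in> ?Cp \<times> ?Cs"
    then obtain \<pi> \<sigma> where r: "r = (\<pi>, \<sigma>)" and \<pi>: "\<pi> \<in> labellings" "\<forall>v\<in>?A. \<pi> v = a v"
      and \<sigma>: "\<sigma> \<in> vorders" "\<forall>v\<in>?A. \<sigma> v = b v" by auto
    have \<pi>D: "\<pi> (fplace Z f q) = flab l q" and \<sigma>D: "\<sigma> (fplace Z f q) = f q" if "q \<in> D" for q
      using that \<pi>(2) \<sigma>(2) g by (auto simp: a_def b_def)
    have root: "rZ \<pi> u = Z u" if "[u] \<in> D" for u
    proof -
      have "\<pi> (Z u) = u" using \<pi>D[OF that] by (simp add: fplace_root flab_def)
      moreover have "inj_on \<pi> Vs" using \<pi>(1) by (simp add: labellings_def bij_betw_def)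
      moreover have "Z u \<in> Vs" using DV[OF that] by (simp add: fplace_root)
      ultimately show ?thesis unfolding rZ_def by (metis inv_into_f_f)
    qed
    have pl: "rplace \<sigma> (tl q) (rZ \<pi> (hd q)) = fplace Z f q" if "q \<in> D" for q
      using that
    proof (induction "length q" arbitrary: q rule: less_induct)
      case less
      then have v: "q \<in> visited e (fob Z f l)" by (simp add: D_def alive_def)
      consider u where "u < nv" "q = [u]" | q' k where "q' \<in> D" "k < d" "q = q' @ [k]"
        using visited_parent[OF v] by (auto simp: D_def)
      then show ?case
      proof cases
        case 1
        then show ?thesis using root less.prems by (simp add: fplace_root)
      next
        case 2
        have ne: "q' \<noteq> []" using 2(1) DF by (auto simp: forest_def)
        have "rplace \<sigma> (p @ [k]) w = nbr (rplace \<sigma> p w) (\<sigma> (rplace \<sigma> p w) k)" for p w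
          by (induction p arbitrary: w) auto
        then have "rplace \<sigma> (tl q) (rZ \<pi> (hd q)) = nbr (fplace Z f q') (\<sigma> (fplace Z f q') k)"
          using less.hyps[of q'] 2 ne by simp
        then show ?thesis using \<sigma>D[OF 2(1)] 2(3) by (simp add: fplace_snoc[OF ne])
      qed
    qed
    have "key e (rZ \<pi>) (rf \<pi> \<sigma>) (rl \<pi> \<sigma>) = key e Z f l"
    proof (rule agree_key[OF ZV])
      fix q assume "q \<in> alive e (fob Z f l)"
      then have q: "q \<in> D" by (simp add: D_def)
      have "flab (rl \<pi> \<sigma>) q = flab l q"
        using pl[OF q] \<pi>D[OF q] by (auto simp: flab_def rl_def)
      moreover have "rZ \<pi> (hd q) = Z (hd q)" if "length q = 1"
        using root[of "hd q"] q that by (cases q) auto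
      ultimately show "(length q = 1 \<longrightarrow> rZ \<pi> (hd q) = Z (hd q)) \<and> rf \<pi> \<sigma> q = f q \<and> flab (rl \<pi> \<sigma>) q = flab l q"
        using pl[OF q] \<sigma>D[OF q] by (simp add: rf_def)
    qed
    then show "r \<in> {(\<pi>, \<sigma>) \<in> labellings \<times> vorders. key e (rZ \<pi>) (rf \<pi> \<sigma>) (rl \<pi> \<sigma>) = key e Z f l}"
      using \<pi>(1) \<sigma>(1) by (simp add: r)
  qed
  have finl: "finite labellings"
    by (rule finite_subset[of _ "PiE Vs (\<lambda>_. {..<nv})"])
      (auto simp: labellings_def PiE_def bij_betw_def finite_PiE[unfolded PiE_def] finite_Vs)
  have finv: "finite vorders" unfolding vorders_def
    by (intro finite_PiE_dflt finite_Vs) (simp add: finite_permutations)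
  have "card (labellings \<times> vorders) \<le> (card ?Cp * nv ^ card D) * (card ?Cs * fact d ^ card D)"
    unfolding card_cartesian_product cs by (rule mult_le_mono1[OF cp])
  also have "\<dots> = card (?Cp \<times> ?Cs) * (nv * fact d) ^ card D"
    by (simp add: card_cartesian_product power_mult_distrib)
  also have "\<dots> \<le> card {(\<pi>, \<sigma>) \<in> labellings \<times> vorders. key e (rZ \<pi>) (rf \<pi> \<sigma>) (rl \<pi> \<sigma>) = key e Z f l} * (nv * fact d) ^ card D"
    using finl finv by (intro mult_le_mono1 card_mono[OF _ sub]) (auto intro: finite_subset[OF _ finite_cartesian_product])
  finally show ?thesis .
qed

lemma finite_real: "finite (labellings \<times> vorders)"
proof -
  have "finite labellings"
    by (rule finite_subset[of _ "PiE Vs (\<lambda>_. {..<nv})"])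
      (auto simp: labellings_def PiE_def bij_betw_def finite_PiE[unfolded PiE_def] finite_Vs)
  moreover have "finite vorders" unfolding vorders_def
    by (intro finite_PiE_dflt finite_Vs) (simp add: finite_permutations)
  ultimately show ?thesis by simp
qed

definition "good Z f l \<longleftrightarrow> inj_on (fplace Z f) (alive e (fob Z f l)) \<and> inj_on (flab l) (alive e (fob Z f l))"

theorem real_dominates_ideal:
  assumes Good: "Good \<subseteq> {(Z, f, l) \<in> samples L. good Z f l}"
  shows "card Good * card (labellings \<times> vorders) \<le> card {(\<pi>, \<sigma>) \<in> labellings \<times> vorders.
      \<exists>(Z, f, l)\<in>Good. key e (rZ \<pi>) (rf \<pi> \<sigma>) (rl \<pi> \<sigma>) = key e Z f l} * card (samples L)"
proof -
  let ?kI = "\<lambda>(Z, f, l). key e Z f l" and ?kR = "\<lambda>(\<pi>, \<sigma>). key e (rZ \<pi>) (rf \<pi> \<sigma>) (rl \<pi> \<sigma>)"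
  have "card Good * card (labellings \<times> vorders) \<le> card {r \<in> labellings \<times> vorders. ?kR r \<in> ?kI ` Good} * card (samples L)"
  proof (rule key_domination[OF finite_samples finite_real])
    show "Good \<subseteq> samples L" using Good by auto
    fix s assume "s \<in> Good"
    obtain Z f l where s: "s = (Z, f, l)" by (cases s)
    have m: "(Z, f, l) \<in> samples L" "good Z f l" using \<open>s \<in> Good\<close> Good s by auto
    let ?n = "(nv * fact d) ^ card (alive e (fob Z f l))"
    have I: "card {t \<in> samples L. ?kI t = ?kI s} * ?n \<le> card (samples L)"
      using ideal_class[OF m(1)] by (simp add: s case_prod_beta' mem_Times_iff conj_assoc)
    have R: "card (labellings \<times> vorders) \<le> card {r \<in> labellings \<times> vorders. ?kR r = ?kI s} * ?n"
      using real_class[OF m(1)] m(2) by (simp add: s good_def case_prod_beta' mem_Times_iff conj_assoc)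
    \<comment> \<open>The ideal and the real class bound contain the same factor \<open>n\<close>,
      which cancels.\<close>
    have *: "x * r \<le> y * S" if "x * n \<le> S" "r \<le> y * n" for x n S r y :: nat
    proof -
      have "x * r \<le> x * (y * n)" using that(2) by (rule mult_le_mono2)
      also have "\<dots> = y * (x * n)" by simp
      also have "\<dots> \<le> y * S" using that(1) by (rule mult_le_mono2)
      finally show ?thesis .
    qed
    show "card {t \<in> samples L. ?kI t = ?kI s} * card (labellings \<times> vorders)
        \<le> card {r \<in> labellings \<times> vorders. ?kR r = ?kI s} * card (samples L)"
      by (rule *[OF I R])
  qed
  also have "{r \<in> labellings \<times> vorders. ?kR r \<in> ?kI ` Good} = {(\<pi>, \<sigma>) \<in> labellings \<times> vorders.
      \<exists>(Z, f, l)\<in>Good. key e (rZ \<pi>) (rf \<pi> \<sigma>) (rl \<pi> \<sigma>) = key e Z f l}"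
    by (auto simp: image_iff split: prod.splits)
  finally show ?thesis .
qed

end

end

section \<open>Collisions of labels and of places\<close>

context lift
begin

text \<open>\<open>X\<close> consists of the labels compatible with the knowledge \<open>M\<close>.
  The label of a newly met node is still uniform on \<open>X\<close>, so it repeats one of m known
  labels with probability at most m / nv; a new root repeats none by orderliness. Conditioning on
  the label lets the induction continue with one more known node.\<close>

lemma label_collisions_aux:
  assumes "orderly e M" "vb e T" "card (dom M) \<le> m" "finite (dom M)" "dom M \<subseteq> forest L" "inj_on M (dom M)"
    and "X = {l \<in> LS L. \<forall>q\<in>dom M. Some (flab l q) = M q}"
    and "\<And>l. l \<in> X \<Longrightarrow> visited e (fob Z f l) \<subseteq> forest L"
  shows "card {l \<in> X. \<not> inj_on (flab l) (dom M \<union> alive e (fob Z f l))} * nv \<le> T * (m + T) * card X"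
  using assms
proof (induction e arbitrary: M T m X)
  case (Stop x)
  have "inj_on (flab l) (dom M)" if "l \<in> X" for l
  proof (rule inj_onI)
    fix q q' assume q: "q \<in> dom M" "q' \<in> dom M" "flab l q = flab l q'"
    have "Some (flab l q) = M q" "Some (flab l q') = M q'" using that q(1,2) Stop.prems(7) by blast+
    then have "M q = M q'" using q(3) by simp
    then show "q = q'" using Stop.prems(6) q(1,2) by (auto dest: inj_onD)
  qed
  then have "{l \<in> X. \<not> inj_on (flab l) (dom M \<union> alive (Stop x) (fob Z f l))} = {}"
    by (auto simp: alive_def)
  then show ?case by (simp only: card.empty)
next
  case (Visit p c)
  let ?o = "fob Z f"
  let ?a = "ar (fstate Z f p)"
  have T: "0 < T" and vbc: "vb (c y) (T - 1)" and ord: "orderly (c y) (known M p y)" for y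
    using Visit.prems(1,2) by (auto simp only: vb.simps orderly.simps)
  have pc: "p \<in> dom M \<or> (\<exists>u<nv. p = [u] \<and> u \<notin> ran M) \<or> (\<exists>q k. q \<in> dom M \<and> k < d \<and> p = q @ [k])"
    using Visit.prems(1) by simp
  have finX: "finite X" using Visit.prems(7) finite_LS by simp
  obtain T' where T': "T = Suc T'" using T by (cases T) auto
  have vis: "visited (c (?o l p)) (?o l) \<subseteq> forest L" "p \<in> forest L" if "l \<in> X" for l
    using Visit.prems(8)[OF that] by auto
  show ?case
  proof (cases "?a = 0 \<or> p \<in> dom M")
    case True
    define y where "y = (?a, if ?a = 0 then 0 else the (M p))"
    have y: "?o l p = y" if "l \<in> X" for l
    proof (cases "?a = 0")
      case False
      then have "p \<in> dom M" using True by (simp add: dom_def)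
      then have "Some (flab l p) = M p" using that Visit.prems(7) by blast
      then have "flab l p = the (M p)" by (metis option.sel)
      then show ?thesis using False by (simp add: fob_def y_def)
    qed (simp add: fob_def y_def)
    have k: "known M p y = M" using True by (auto simp: known_def y_def)
    have al: "dom M \<union> alive (Visit p c) (?o l) = dom M \<union> alive (c y) (?o l)" if "l \<in> X" for l
      using True y[OF that] by (auto simp: alive_def y_def)
    have "card {l \<in> X. \<not> inj_on (flab l) (dom M \<union> alive (c y) (?o l))} * nv \<le> T' * (m + T') * card X"
    proof (rule Visit.IH[OF rangeI])
      show "orderly (c y) M" using ord[of y] k by simp
      show "vb (c y) T'" using vbc[of y] T' by simp
      show "visited (c y) (?o l) \<subseteq> forest L" if "l \<in> X" for l
        using vis(1)[OF that] y[OF that] by simp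
    qed (use Visit.prems in auto)
    also have "\<dots> \<le> T * (m + T) * card X" by (intro mult_le_mono) (auto simp: T')
    finally show ?thesis using al by (simp cong: conj_cong)
  next
    case False
    have cardM: "card (dom (M(p \<mapsto> w))) \<le> Suc m" for w
      using Visit.prems(3,4) False by (simp add: card_insert_if)
    have finM: "finite (dom (M(p \<mapsto> w)))" for w using Visit.prems(4) by simp
    have domM: "dom (M(p \<mapsto> w)) \<subseteq> forest L" if "p \<in> forest L" for w using Visit.prems(5) that by simp
    have injM: "inj_on (M(p \<mapsto> w)) (dom (M(p \<mapsto> w)))" if "w \<notin> ran M" for w
      using Visit.prems(6) that False by (auto simp: inj_on_def ran_def dom_def)
    have al: "dom M \<union> alive (Visit p c) (?o l) = dom (M(p \<mapsto> w)) \<union> alive (c (?o l p)) (?o l)" for l w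
      using False by (auto simp: alive_def fob_def)
    have upd_iff: "(\<forall>q\<in>dom (M(p \<mapsto> w)). Some (flab l q) = (M(p \<mapsto> w)) q) \<longleftrightarrow>
        flab l p = w \<and> (\<forall>q\<in>dom M. Some (flab l q) = M q)" for l w
    proof -
      have "dom (M(p \<mapsto> w)) = insert p (dom M)" by simp
      moreover have "(\<forall>q\<in>dom M. Some (flab l q) = (M(p \<mapsto> w)) q) \<longleftrightarrow> (\<forall>q\<in>dom M. Some (flab l q) = M q)"
        by (intro ball_cong refl) (use False in auto)
      moreover have "(\<forall>q\<in>insert p (dom M). P q) \<longleftrightarrow> P p \<and> (\<forall>q\<in>dom M. P q)" for P by blast
      ultimately show ?thesis by (simp only: fun_upd_same option.inject)
    qed
    show ?thesis
    proof (cases "X = {}")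
      case ne: False
      have pF: "p \<in> forest L" using vis ne by blast
      consider u where "u < nv" "p = [u]" "u \<notin> ran M" | q k where "q \<in> dom M" "p = q @ [k]"
        using pc False by blast
      then show ?thesis
      proof cases
        case 1
        have y: "?o l p = (?a, u)" for l using False 1 by (simp add: fob_def flab_def)
        have k: "known M p (?a, u) = M(p \<mapsto> u)" using False 1 by (simp add: known_def)
        have "card {l \<in> X. \<not> inj_on (flab l) (dom (M(p \<mapsto> u)) \<union> alive (c (?a, u)) (?o l))} * nv
            \<le> T' * (Suc m + T') * card X"
        proof (rule Visit.IH[OF rangeI])
          show "orderly (c (?a, u)) (M(p \<mapsto> u))" using ord[of "(?a, u)"] k by simp
          show "vb (c (?a, u)) T'" using vbc T' by simp
          show "X = {l \<in> LS L. \<forall>q\<in>dom (M(p \<mapsto> u)). Some (flab l q) = (M(p \<mapsto> u)) q}"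
            unfolding Visit.prems(7) upd_iff using 1 by (simp add: flab_def)
          show "visited (c (?a, u)) (?o l) \<subseteq> forest L" if "l \<in> X" for l
            using vis(1)[OF that] y by simp
        qed (rule cardM finM domM[OF pF] injM[OF 1(3)])+
        also have "\<dots> \<le> T * (m + T) * card X" by (intro mult_le_mono) (auto simp: T')
        finally show ?thesis using al[where w = u] y by simp
      next
        case 2
        have "q \<noteq> []" using 2 Visit.prems(5) by (auto simp: forest_def)
        then have len: "length p \<noteq> 1" using 2 by simp
        have pL: "p \<in> {q \<in> forest L. length q \<noteq> 1}" using pF len by simp
        have fl: "flab l p = l p" for l using len by (simp add: flab_def)
        define Xw where "Xw w = {l \<in> X. l p = w}" for w
        have updX: "l(p := w) \<in> Xw w" if "l \<in> X" "w < nv" for l w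
        proof -
          have "l \<in> LS L" "\<forall>q\<in>dom M. Some (flab l q) = M q" using that Visit.prems(7) by auto
          moreover have "l(p := w) \<in> LS L"
            using \<open>l \<in> LS L\<close> that(2) pL unfolding LS_def PiE_dflt_def by auto
          moreover have "flab (l(p := w)) q = flab l q" if "q \<in> dom M" for q
            using that False by (auto simp: flab_def)
          ultimately show ?thesis using Visit.prems(7) by (auto simp: Xw_def)
        qed
        have le: "card (Xw w) \<le> card (Xw w')" if "w' < nv" for w w'
        proof (rule card_inj_on_le)
          show "inj_on (\<lambda>l. l(p := w')) (Xw w)"
          proof (rule inj_onI)
            fix l l' assume "l \<in> Xw w" "l' \<in> Xw w" "l(p := w') = l'(p := w')"
            then show "l = l'" by (auto simp: Xw_def fun_eq_iff) (metis fun_upd_apply)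
          qed
          show "(\<lambda>l. l(p := w')) ` Xw w \<subseteq> Xw w'" using updX that by (auto simp: Xw_def[of w])
          show "finite (Xw w')" using finX by (simp add: Xw_def)
        qed
        have Xp: "l p < nv" if "l \<in> X" for l
          using that Visit.prems(7) pL by (auto simp: LS_def PiE_dflt_def)
        have "card X = card (\<Union>w<nv. Xw w)"
          by (rule arg_cong[where f = card]) (use Xp in \<open>auto simp: Xw_def\<close>)
        also have "\<dots> = (\<Sum>w<nv. card (Xw w))"
          by (rule card_UN_disjoint) (auto simp: Xw_def finX)
        finally have sumX: "card X = (\<Sum>w<nv. card (Xw w))" .
        have nX: "nv * card (Xw w) \<le> card X" for w
          unfolding sumX using sum_bounded_below[of "{..<nv}" "card (Xw w)" "\<lambda>w. card (Xw w)"] le by simp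
        let ?bad = "{l \<in> X. \<not> inj_on (flab l) (dom M \<union> alive (Visit p c) (?o l))}"
        have "card ?bad \<le> card (\<Union>w<nv. ?bad \<inter> Xw w)"
          by (intro card_mono) (use Xp finX in \<open>auto simp: Xw_def\<close>)
        also have "\<dots> \<le> (\<Sum>w<nv. card (?bad \<inter> Xw w))" by (rule card_UN_le) simp
        finally have "card ?bad * nv \<le> (\<Sum>w<nv. card (?bad \<inter> Xw w) * nv)"
          unfolding sum_distrib_right[symmetric] by (rule mult_le_mono1)
        also have "\<dots> \<le> (\<Sum>w<nv. (if w \<in> ran M then card X else 0) + T' * (Suc m + T') * card (Xw w))"
        proof (rule sum_mono)
          fix w assume w: "w \<in> {..<nv}"
          show "card (?bad \<inter> Xw w) * nv \<le> (if w \<in> ran M then card X else 0) + T' * (Suc m + T') * card (Xw w)"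
          \<comment> \<open>A repeated label gives up its whole class, but there are at most m such
            labels; for a fresh one the induction hypothesis applies.\<close>
          proof (cases "w \<in> ran M")
            case True
            have "card (?bad \<inter> Xw w) * nv \<le> card (Xw w) * nv"
              using finX by (intro mult_le_mono1 card_mono) (auto simp: Xw_def)
            also have "\<dots> \<le> card X" using nX[of w] by (simp add: mult.commute)
            finally show ?thesis using True by simp
          next
            case wM: False
            have y: "?o l p = (?a, w)" if "l \<in> Xw w" for l
              using that False fl by (simp add: fob_def Xw_def)
            have k: "known M p (?a, w) = M(p \<mapsto> w)" using False len by (auto simp: known_def)
            have "card {l \<in> Xw w. \<not> inj_on (flab l) (dom (M(p \<mapsto> w)) \<union> alive (c (?a, w)) (?o l))} * nv
                \<le> T' * (Suc m + T') * card (Xw w)"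
            proof (rule Visit.IH[OF rangeI])
              show "orderly (c (?a, w)) (M(p \<mapsto> w))" using ord[of "(?a, w)"] k by simp
              show "vb (c (?a, w)) T'" using vbc T' by simp
              show "Xw w = {l \<in> LS L. \<forall>q\<in>dom (M(p \<mapsto> w)). Some (flab l q) = (M(p \<mapsto> w)) q}"
                unfolding Xw_def Visit.prems(7) upd_iff using fl by auto
              show "visited (c (?a, w)) (?o l) \<subseteq> forest L" if "l \<in> Xw w" for l
                using vis(1)[of l] y[OF that] that by (simp add: Xw_def)
            qed (rule cardM finM domM[OF pF] injM[OF wM])+
            moreover have "?bad \<inter> Xw w = {l \<in> Xw w. \<not> inj_on (flab l) (dom (M(p \<mapsto> w)) \<union> alive (c (?a, w)) (?o l))}"
              using al[where w = w] y by (auto simp: Xw_def)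
            ultimately show ?thesis by simp
          qed
        qed
        also have "\<dots> = (\<Sum>w\<in>{w\<in>{..<nv}. w \<in> ran M}. card X) + T' * (Suc m + T') * card X"
          unfolding sumX[symmetric] sum.distrib sum_distrib_left[symmetric] by (subst sum.inter_filter) auto
        also have "(\<Sum>w\<in>{w\<in>{..<nv}. w \<in> ran M}. card X) \<le> m * card X"
        proof -
          have "{w\<in>{..<nv}. w \<in> ran M} \<subseteq> (\<lambda>q. the (M q)) ` dom M" by (auto simp: ran_def image_iff dom_def) force
          then have "card {w\<in>{..<nv}. w \<in> ran M} \<le> card (dom M)"
            using surj_card_le[OF Visit.prems(4)] by blast
          then show ?thesis using Visit.prems(3) by simp
        qed
        finally have "card ?bad * nv \<le> (m + T' * (Suc m + T')) * card X" by (simp add: distrib_right)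
        also have "\<dots> \<le> T * (m + T) * card X" by (intro mult_le_mono1) (simp add: T')
        finally show ?thesis .
      qed
    qed simp
  qed
qed

lemma label_collisions:
  assumes e: "orderly e Map.empty" "vb e L"
  shows "card {l \<in> LS L. \<not> inj_on (flab l) (alive e (fob Z f l))} * nv \<le> L * L * card (LS L)"
  using label_collisions_aux[OF e, of 0 L "LS L" Z f] visited_forest[OF e] by auto

text \<open>The colours met along a walk. The walk changes the position by the product of the
  corresponding involutions.\<close>

primrec cword :: "nat list \<Rightarrow> 'b \<Rightarrow> port_orders \<Rightarrow> nat list" where
  "cword [] b f = []"
| "cword (k # p) b f = col b (item b (f [] k)) # cword p (fst (item b (f [] k))) (sub f k)"

lemma length_cword [simp]: "length (cword p b f) = length p"
  by (induction p arbitrary: b f) auto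

lemma fst_place: "fst (place p v f) = fold act (cword p (base v) f) (fst v)"
  by (induction p arbitrary: v f) (auto simp: nbr_def)

lemma fold_act_in: "set w \<subseteq> cs \<Longrightarrow> g \<in> Gs \<Longrightarrow> fold act w g \<in> Gs"
  by (induction w arbitrary: g) (auto simp: act_in)

lemma fold_act_rev: "set w \<subseteq> cs \<Longrightarrow> g \<in> Gs \<Longrightarrow> fold act (rev w) (fold act w g) = g"
  by (induction w arbitrary: g) (auto simp: act_in act_act)

lemma inj_fold_act: "set w \<subseteq> cs \<Longrightarrow> inj_on (fold act w) Gs"
  by (rule inj_on_inverseI[where g = "fold act (rev w)"]) (rule fold_act_rev)

lemma reduced_Cons: "reduced (a # w) \<longleftrightarrow> reduced w \<and> (w \<noteq> [] \<longrightarrow> a \<noteq> hd w)"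
  by (cases w) auto

lemma reduced_append:
  "reduced (v @ w) \<longleftrightarrow> reduced v \<and> reduced w \<and> (v \<noteq> [] \<and> w \<noteq> [] \<longrightarrow> last v \<noteq> hd w)"
  by (induction v) (auto simp: reduced_Cons)

lemma reduced_rev: "reduced (rev w) \<longleftrightarrow> reduced w"
  by (induction w) (auto simp: reduced_Cons reduced_append last_rev)

text \<open>A live path never takes the back item, and distinct items of a vertex have distinct
  colours; so consecutive colours differ.\<close>

lemma cword_props:
  assumes "b \<in> Bs" "\<And>it. bk = Some it \<Longrightarrow> it \<in> items b" "state_at p (Some (b, bk)) f \<noteq> None"
  shows "set (cword p b f) \<subseteq> cs \<and> reduced (cword p b f) \<and>
    (\<forall>it. p \<noteq> [] \<and> bk = Some it \<longrightarrow> hd (cword p b f) \<noteq> col b it)"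
  using assms
proof (induction p arbitrary: b bk f)
  case (Cons k p)
  let ?a = "f [] k"
  have st: "state_at p (ch (Some (b, bk)) ?a) (sub f k) \<noteq> None" using Cons.prems(3) by simp
  then have nn: "ch (Some (b, bk)) ?a \<noteq> None" using state_at_dead by metis
  then have a: "?a < d" "bk \<noteq> Some (item b ?a)" by (auto split: if_splits)
  let ?c = "fst (item b ?a)" and ?r = "snd (item b ?a)"
  have it: "item b ?a \<in> items b" using item_in[OF Cons.prems(1) a(1)] .
  have sy: "?c \<in> Bs" "(b, ?r) \<in> items ?c" using items_sym[OF Cons.prems(1), of ?c ?r] it by auto
  have IH: "set (cword p ?c (sub f k)) \<subseteq> cs \<and> reduced (cword p ?c (sub f k)) \<and>
    (\<forall>it. p \<noteq> [] \<and> Some (b, ?r) = Some it \<longrightarrow> hd (cword p ?c (sub f k)) \<noteq> col ?c it)"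
    using st unfolding ch_Some[OF a] by (intro Cons.IH) (use sy in auto)
  have c: "col ?c (b, ?r) = col b (item b ?a)" using col_sym[OF Cons.prems(1), of ?c ?r] it by simp
  have "col b (item b ?a) \<noteq> col b it'" if "bk = Some it'" for it'
    using col_inj[OF Cons.prems(1)] it Cons.prems(2)[OF that] a(2) that by (auto simp: inj_on_def)
  then show ?case using IH c col_in[OF Cons.prems(1) it]
    by (auto simp: reduced_Cons)
qed simp

text \<open>At a vertex of degree 1 all ports show the same item. Staying below the degree makes
  different ports lead to different items.\<close>

primrec okpath :: "nat list \<Rightarrow> ('b \<times> ('b \<times> nat) option) option \<Rightarrow> port_orders \<Rightarrow> bool" where
  "okpath [] x f = True"
| "okpath (k # p) x f = (k < ar x \<and> okpath p (ch x (f [] k)) (sub f k))"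

text \<open>After the common prefix the two walks start with different colours, unless one of them
  has ended. Going back along one and forth along the other therefore spells a nonempty reduced word
  \<open>w\<close>, which fixes the position where the walks meet; \<open>r\<close> leads from the
  start to that position.\<close>

lemma diverging_paths:
  assumes "b \<in> Bs" "\<And>it. bk = Some it \<Longrightarrow> it \<in> items b" "\<And>q. f q permutes {..<d}"
    "state_at p (Some (b, bk)) f \<noteq> None" "state_at p' (Some (b, bk)) f \<noteq> None" "p \<noteq> p'"
    "okpath p (Some (b, bk)) f" "okpath p' (Some (b, bk)) f"
  shows "\<exists>w r. w \<noteq> [] \<and> reduced w \<and> set w \<subseteq> cs \<and> length w \<le> length p + length p' \<and> set r \<subseteq> cs \<and>
    (\<forall>g\<in>Gs. fold act (cword p b f) g = fold act (cword p' b f) g \<longrightarrow>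
       fold act w (fold act r g) = fold act r g)"
  using assms
proof (induction p arbitrary: p' b bk f)
  case Nil
  then show ?case
    using cword_props[of b bk p' f] by (intro exI[of _ "cword p' b f"] exI[of _ "[]"]) (auto, metis length_0_conv length_cword)
next
  case (Cons k p)
  note P = cword_props[OF Cons.prems(1,2,4)]
  show ?case
  proof (cases p')
    case Nil
    then show ?thesis using P
      by (intro exI[of _ "cword (k # p) b f"] exI[of _ "[]"]) auto
  next
    case (Cons k' q)
    note P' = cword_props[OF Cons.prems(1,2,5)]
    let ?a = "f [] k"
    have st: "state_at p (ch (Some (b, bk)) ?a) (sub f k) \<noteq> None" using Cons.prems(4) by simp
    then have nn: "ch (Some (b, bk)) ?a \<noteq> None" using state_at_dead by metis
    then have a: "?a < d" "bk \<noteq> Some (item b ?a)" by (auto split: if_splits)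
    have it: "item b ?a \<in> items b" using item_in[OF Cons.prems(1) a(1)] .
    show ?thesis
    proof (cases "k = k'")
      case True
      let ?c = "fst (item b ?a)" and ?r = "snd (item b ?a)"
      have sy: "?c \<in> Bs" "(b, ?r) \<in> items ?c" using items_sym[OF Cons.prems(1), of ?c ?r] it by auto
      have "\<exists>w r. w \<noteq> [] \<and> reduced w \<and> set w \<subseteq> cs \<and> length w \<le> length p + length q \<and> set r \<subseteq> cs \<and>
        (\<forall>g\<in>Gs. fold act (cword p ?c (sub f k)) g = fold act (cword q ?c (sub f k)) g \<longrightarrow>
           fold act w (fold act r g) = fold act r g)"
      proof (rule Cons.IH[of ?c "Some (b, ?r)"])
        note chk = ch_Some[OF a]
        show "state_at p (Some (?c, Some (b, ?r))) (sub f k) \<noteq> None" using st unfolding chk .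
        have "state_at q (ch (Some (b, bk)) ?a) (sub f k) \<noteq> None"
          using Cons.prems(5) Cons True by (simp del: ch.simps)
        then show "state_at q (Some (?c, Some (b, ?r))) (sub f k) \<noteq> None" unfolding chk .
        have "okpath p (ch (Some (b, bk)) ?a) (sub f k)" using Cons.prems(7) by (simp del: ch.simps)
        then show "okpath p (Some (?c, Some (b, ?r))) (sub f k)" unfolding chk .
        have "okpath q (ch (Some (b, bk)) ?a) (sub f k)"
          using Cons.prems(8) Cons True by (simp del: ch.simps)
        then show "okpath q (Some (?c, Some (b, ?r))) (sub f k)" unfolding chk .
        show "sub f k q' permutes {..<d}" for q' using Cons.prems(3) by (simp add: sub_def)
      qed (use sy True Cons Cons.prems(6) in auto)
      then obtain w r where wr: "w \<noteq> []" "reduced w" "set w \<subseteq> cs" "length w \<le> length p + length q" "set r \<subseteq> cs"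
        "\<forall>g\<in>Gs. fold act (cword p ?c (sub f k)) g = fold act (cword q ?c (sub f k)) g \<longrightarrow>
           fold act w (fold act r g) = fold act r g" by blast
      have cc: "col b (item b ?a) \<in> cs" using col_in[OF Cons.prems(1) it] .
      show ?thesis
        using wr cc act_in[OF cc] True Cons
        by (intro exI[of _ w] exI[of _ "col b (item b ?a) # r"]) auto
    next
      case False
      let ?x = "cword (k # p) b f" and ?y = "cword p' b f"
      have st': "state_at q (ch (Some (b, bk)) (f [] k')) (sub f k') \<noteq> None" using Cons.prems(5) Cons by simp
      then have nn': "ch (Some (b, bk)) (f [] k') \<noteq> None" using state_at_dead by metis
      then have a': "f [] k' < d" by (auto split: if_splits)
      have kd: "k < deg b" "k' < deg b" using Cons.prems(7,8) Cons by auto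
      then have dd: "deg b = d" using False deg_cases'[OF Cons.prems(1)] by auto
      have "f [] k \<noteq> f [] k'"
        using False injD[OF permutes_inj[OF Cons.prems(3)], of "[]" k k'] by blast
      then have "item b (f [] k) \<noteq> item b (f [] k')"
        using inj_onD[OF bij_betw_imp_inj_on[OF item_bij[OF dd]], of "f [] k" "f [] k'"] a(1) a' by auto
      then have "col b (item b (f [] k)) \<noteq> col b (item b (f [] k'))"
        using inj_onD[OF col_inj[OF Cons.prems(1)], of "item b (f [] k)" "item b (f [] k')"]
          it item_in[OF Cons.prems(1) a'] by blast
      then have hd: "hd ?x \<noteq> hd ?y" using Cons by simp
      show ?thesis
      proof (rule exI[of _ "rev ?x @ ?y"], rule exI[of _ ?x], intro conjI ballI impI)
        show "reduced (rev ?x @ ?y)"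
          using P P' hd unfolding reduced_append reduced_rev by (simp add: last_rev del: cword.simps)
        fix g assume "g \<in> Gs" "fold act ?x g = fold act ?y g"
        then show "fold act (rev ?x @ ?y) (fold act ?x g) = fold act ?x g"
          using fold_act_rev[of ?x g] P by (simp del: cword.simps)
      next
        show "rev ?x @ ?y \<noteq> []" by simp
        show "set (rev ?x @ ?y) \<subseteq> cs" "set ?x \<subseteq> cs" using P P' by (simp_all del: cword.simps)
        show "length (rev ?x @ ?y) \<le> length (k # p) + length p'" by (simp del: cword.simps)
      qed
    qed
  qed
qed

definition okp :: "(nat list \<Rightarrow> nat \<times> nat) \<Rightarrow> nat list \<Rightarrow> bool" where
  "okp ob q \<longleftrightarrow> (\<forall>p k s. q = p @ k # s \<and> p \<noteq> [] \<longrightarrow> k < fst (ob p))"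

lemma okp_root: "okp ob [u]"
  by (auto simp: okp_def append_eq_Cons_conv Cons_eq_append_conv)

lemma okp_snoc: "okp ob q \<Longrightarrow> k < fst (ob q) \<Longrightarrow> okp ob (q @ [k])"
  by (auto simp: okp_def append_eq_append_conv2 append_eq_Cons_conv Cons_eq_append_conv)

lemma okp_butlast: "okp ob q \<Longrightarrow> okp ob (butlast q)"
  by (cases q rule: rev_cases) (auto simp: okp_def)

lemma sim_okp:
  assumes "\<And>w P. mem w = Some P \<Longrightarrow> okp ob P" "p \<in> visited (sim S mem) ob"
  shows "okp ob p"
  using assms
proof (induction S arbitrary: mem)
  case (Query v i k)
  show ?case
  proof (cases "nv \<le> v")
    case True
    then show ?thesis using Query.IH[OF rangeI Query.prems(1)] Query.prems(2) by simp
  next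
    case False
    define P where "P = (case mem v of None \<Rightarrow> [v] | Some P \<Rightarrow> P)"
    have P: "okp ob P" using Query.prems(1)[of v] by (auto simp: P_def okp_root split: option.split)
    have memP: "okp ob Q" if "(mem(v \<mapsto> P)) w = Some Q" for w Q
      using that Query.prems(1)[of w Q] P by (cases "w = v") auto
    have v: "p \<in> visited (Visit P (\<lambda>y. if 1 \<le> i \<and> i \<le> fst y \<and> i \<le> d
        then Visit (P @ [i - 1]) (\<lambda>y'. if fst y' = 0
          then (if length P = 1 then Stop None
                else Visit (butlast P) (\<lambda>y''. sim (k (Some (snd y''))) (mem(v \<mapsto> P))))
          else sim (k (Some (snd y'))) (mem(v \<mapsto> P, snd y' \<mapsto> P @ [i - 1])))
        else sim (k None) (if fst y = 0 then mem else mem(v \<mapsto> P)))) ob"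
      using Query.prems(2) unfolding sim.simps if_not_P[OF False] Let_def P_def[symmetric] .
    show ?thesis
    proof (cases "1 \<le> i \<and> i \<le> fst (ob P) \<and> i \<le> d")
      case True
      then have "i - 1 < fst (ob P)" by linarith
      then have Q: "okp ob (P @ [i - 1])" by (rule okp_snoc[OF P])
      have memQ: "okp ob R" if "(mem(v \<mapsto> P, u \<mapsto> P @ [i - 1])) w = Some R" for u w R
        using that memP[of w R] Q by (cases "w = u") auto
      have vv: "p = P \<or> p = P @ [i - 1] \<or> p = butlast P
         \<or> p \<in> visited (sim (k (Some (snd (ob (butlast P))))) (mem(v \<mapsto> P))) ob
         \<or> p \<in> visited (sim (k (Some (snd (ob (P @ [i - 1]))))) (mem(v \<mapsto> P, snd (ob (P @ [i - 1])) \<mapsto> P @ [i - 1]))) ob"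
        using v unfolding visited.simps if_P[OF True]
        by (cases "fst (ob (P @ [i - 1])) = 0"; cases "length P = 1") auto
      have IHP: "okp ob p" if "p \<in> visited (sim (k x) (mem(v \<mapsto> P))) ob" for x
        by (rule Query.IH[OF rangeI _ that]) (rule memP)
      have IHQ: "okp ob p" if "p \<in> visited (sim (k x) (mem(v \<mapsto> P, u \<mapsto> P @ [i - 1]))) ob" for x u
        by (rule Query.IH[OF rangeI _ that]) (rule memQ)
      show ?thesis using vv IHP IHQ P Q okp_butlast[OF P] by blast
    next
      case F: False
      have "p = P \<or> p \<in> visited (sim (k None) (if fst (ob P) = 0 then mem else mem(v \<mapsto> P))) ob"
        using v unfolding visited.simps if_not_P[OF F] by auto
      then show ?thesis
      proof
        assume v': "p \<in> visited (sim (k None) (if fst (ob P) = 0 then mem else mem(v \<mapsto> P))) ob"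
        show ?thesis
        proof (rule Query.IH[OF rangeI _ v'])
          show "okp ob Q" if "(if fst (ob P) = 0 then mem else mem(v \<mapsto> P)) w = Some Q" for w Q
            using that memP[of w Q] Query.prems(1)[of w Q] by (cases "fst (ob P) = 0") simp_all
        qed
      qed (use P in simp)
    qed
  qed
qed simp

lemma okpath_iff:
  "(\<And>r k s. p = r @ k # s \<Longrightarrow> k < ar (state_at r x f)) \<Longrightarrow> okpath p x f"
proof (induction p arbitrary: x f)
  case (Cons k p)
  have "k < ar x" using Cons.prems[of "[]" k p] by simp
  moreover have "okpath p (ch x (f [] k)) (sub f k)"
    by (rule Cons.IH) (use Cons.prems[of "k # _"] in auto)
  ultimately show ?case by simp
qed simp

lemma okp_okpath:
  assumes "okp (fob Z f l) (u # p)"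
  shows "okpath p (Some (base (Z u), None)) (sub f u)"
proof (rule okpath_iff)
  fix r k s assume "p = r @ k # s"
  then have "k < fst (fob Z f l (u # r))"
    using assms unfolding okp_def by (metis append_Cons list.distinct(1))
  then show "k < ar (state_at r (Some (base (Z u), None)) (sub f u))"
    by (simp add: fob_def fstate_def)
qed

lemma fplace_cword: "fst (fplace Z f (u # p)) = fold act (cword p (base (Z u)) (sub f u)) (fst (Z u))"
  by (simp add: fplace_def fst_place)

lemma fob_upd_root: "fob (Z(u := (g, snd (Z u)))) f l = fob Z f l"
proof -
  have "fstate (Z(u := (g, snd (Z u)))) f q = fstate Z f q" for q
    by (cases q) (auto simp: fstate_def)
  then show ?thesis by (simp add: fob_def fun_eq_iff)
qed

lemma ZS_upd: "Z \<in> ZS \<Longrightarrow> u < nv \<Longrightarrow> g \<in> Gs \<Longrightarrow> Z(u := (g, snd (Z u))) \<in> ZS"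
  unfolding ZS_def PiE_dflt_def Vs_def by (auto simp: mem_Times_iff)

lemma resample_root:
  fixes F :: "_ \<Rightarrow> nat"
  assumes "u < nv"
  shows "(\<Sum>Z\<in>ZS. \<Sum>g\<in>Gs. F (Z(u := (g, snd (Z u))))) = card Gs * (\<Sum>Z\<in>ZS. F Z)"
proof -
  have g: "fst (Z u) \<in> Gs" if "Z \<in> ZS" for Z
    using ZS_Vs[OF that assms] by (auto simp: Vs_def)
  have "(\<Sum>Z\<in>ZS. \<Sum>g\<in>Gs. F (Z(u := (g, snd (Z u))))) = (\<Sum>(Z, g)\<in>ZS \<times> Gs. F (Z(u := (g, snd (Z u)))))"
    by (rule sum.cartesian_product)
  also have "\<dots> = (\<Sum>(Z, g)\<in>ZS \<times> Gs. F Z)"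
    by (rule sum.reindex_bij_witness[where i = "\<lambda>(Z, g). (Z(u := (g, snd (Z u))), fst (Z u))"
          and j = "\<lambda>(Z, g). (Z(u := (g, snd (Z u))), fst (Z u))"])
      (auto simp: ZS_upd[OF _ assms] g)
  also have "\<dots> = (\<Sum>Z\<in>ZS. \<Sum>g\<in>Gs. F Z)"
    by (rule sum.cartesian_product[symmetric])
  finally show ?thesis by (simp add: sum_distrib_left)
qed

text \<open>Two nodes of the explored forest lie over the same vertex only if the position of a root
  satisfies an equation given by a nonempty reduced word.\<close>

lemma place_collisions:
  assumes e: "orderly e Map.empty" "vb e L" and f: "f \<in> FS L"
    and ports: "\<And>ob p. p \<in> visited e ob \<Longrightarrow> okp ob p"
    and \<kappa>: "1 \<le> \<kappa>" "\<And>w. w \<noteq> [] \<Longrightarrow> reduced w \<Longrightarrow> set w \<subseteq> cs \<Longrightarrow> length w \<le> 2 * L \<Longrightarrow>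
      card {g \<in> Gs. fold act w g = g} \<le> \<kappa>"
  shows "card {Z \<in> ZS. \<not> inj_on (fplace Z f) (alive e (fob Z f l))} * card Gs \<le> L * L * \<kappa> * card ZS"
proof -
  define A where "A Z = alive e (fob Z f l)" for Z
  define B where "B q q' = {Z \<in> ZS. q \<in> A Z \<and> q' \<in> A Z \<and> fst (fplace Z f q) = fst (fplace Z f q')}" for q q'
  let ?F = "forest L"
  have AF: "A Z \<subseteq> ?F" for Z using visited_forest[OF e] by (auto simp: A_def alive_def)
  have pf: "sub f u q permutes {..<d}" for u q by (simp add: sub_def FS_permutes[OF f])
  have one: "card (B q q') * card Gs \<le> \<kappa> * card {Z \<in> ZS. q \<in> A Z \<and> q' \<in> A Z}"
    if q: "q \<in> ?F" "q' \<in> ?F" "q \<noteq> q'" for q q'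
  proof -
    obtain u p where up: "q = u # p" "u < nv" using q(1) by (cases q) (auto simp: forest_def)
    obtain u' p' where up': "q' = u' # p'" "u' < nv" using q(2) by (cases q') (auto simp: forest_def)
    have len: "length p \<le> L" "length p' \<le> L" using q(1,2) up up' by (auto simp: forest_def paths_def)
    \<comment> \<open>Redrawing the position of the root of \<open>q\<close> keeps its base, hence
      all states, observations and the set of live nodes; only places move.\<close>
    have "card Gs * card (B q q') = (\<Sum>Z\<in>ZS. \<Sum>g\<in>Gs. if Z(u := (g, snd (Z u))) \<in> B q q' then 1 else 0)"
      using resample_root[OF up(2), of "\<lambda>Z. if Z \<in> B q q' then 1 else 0"] finite_ZS
      by (simp add: B_def sum.inter_filter[symmetric] cong: conj_cong)
    also have "\<dots> \<le> (\<Sum>Z\<in>ZS. if q \<in> A Z \<and> q' \<in> A Z then \<kappa> else 0)"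
    proof (rule sum_mono)
      fix Z assume Z: "Z \<in> ZS"
      have AZ: "A (Z(u := (g, snd (Z u)))) = A Z" for g by (simp add: A_def fob_upd_root)
      show "(\<Sum>g\<in>Gs. if Z(u := (g, snd (Z u))) \<in> B q q' then 1 else 0) \<le> (if q \<in> A Z \<and> q' \<in> A Z then \<kappa> else 0)"
      proof (cases "q \<in> A Z \<and> q' \<in> A Z")
        case True
        let ?b = "base (Z u)" and ?w = "cword p (base (Z u)) (sub f u)"
        have bB: "?b \<in> Bs" using ZS_Vs[OF Z up(2)] by (auto simp: Vs_def)
        have st: "state_at p (Some (?b, None)) (sub f u) \<noteq> None"
          using True up by (cases "fstate Z f q") (auto simp: A_def alive_def fob_def fstate_def)
        note cw = cword_props[OF bB _ st]
        let ?S = "{g \<in> Gs. fst (fplace (Z(u := (g, snd (Z u)))) f q) = fst (fplace (Z(u := (g, snd (Z u)))) f q')}"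
        have "(\<Sum>g\<in>Gs. if Z(u := (g, snd (Z u))) \<in> B q q' then 1 else 0) \<le> (\<Sum>g\<in>Gs. if g \<in> ?S then 1 else 0 :: nat)"
          by (intro sum_mono) (auto simp: B_def)
        also have "\<dots> = card ?S"
          using finite_Gs by (simp add: sum.inter_filter[symmetric])
        also have "card ?S \<le> \<kappa>"
        proof (cases "u = u'")
          \<comment> \<open>With different roots only the place of \<open>q\<close> moves, and
            injectively, so at most one position produces a collision.\<close>
          case False
          let ?T = "{g \<in> Gs. fold act ?w g = fst (fplace Z f q')}"
          have sub: "?S \<subseteq> ?T"
            unfolding up up' fplace_cword using False by auto
          have finT: "finite ?T" using finite_Gs by simp
          have "set ?w \<subseteq> cs" using cw by blast
          then have inj: "inj_on (fold act ?w) Gs" by (rule inj_fold_act)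
          have "g = g'" if "g \<in> ?T" "g' \<in> ?T" for g g'
            using inj_onD[OF inj, of g g'] that by simp
          then have "card ?T \<le> 1" using finT by (simp add: card_le_Suc0_iff_eq)
          then show ?thesis using card_mono[OF finT sub] \<kappa>(1) by linarith
        next
          case uu: True
          have st': "state_at p' (Some (?b, None)) (sub f u) \<noteq> None"
            using True up' uu by (cases "fstate Z f q'") (auto simp: A_def alive_def fob_def fstate_def)
          have ok: "okpath p (Some (?b, None)) (sub f u)" "okpath p' (Some (?b, None)) (sub f u)"
            using True up up' uu ports[of _ "fob Z f l"] by (auto intro!: okp_okpath simp: A_def alive_def)
          have "p \<noteq> p'" using q(3) up up' uu by simp
          from diverging_paths[OF bB _ pf st st' this ok] obtain w r where
            w: "w \<noteq> []" "reduced w" "set w \<subseteq> cs" "length w \<le> length p + length p'" "set r \<subseteq> cs"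
            "\<forall>g\<in>Gs. fold act ?w g = fold act (cword p' ?b (sub f u)) g \<longrightarrow>
               fold act w (fold act r g) = fold act r g" by auto
          have "card ?S \<le> card {g \<in> Gs. fold act w g = g}"
          proof (rule card_inj_on_le)
            show "inj_on (fold act r) ?S" using inj_fold_act[OF w(5)] by (rule inj_on_subset) auto
            show "fold act r ` ?S \<subseteq> {g \<in> Gs. fold act w g = g}"
              unfolding up up' fplace_cword using w(6) fold_act_in[OF w(5)] uu by auto
            show "finite {g \<in> Gs. fold act w g = g}" using finite_Gs by simp
          qed
          also have "\<dots> \<le> \<kappa>" using \<kappa>(2)[OF w(1-3)] w(4) len by simp
          finally show ?thesis .
        qed
        finally show ?thesis using True by simp
      next
        case False
        then have "Z(u := (g, snd (Z u))) \<notin> B q q'" for g using AZ by (auto simp: B_def)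
        then show ?thesis by simp
      qed
    qed
    also have "\<dots> = \<kappa> * card {Z \<in> ZS. q \<in> A Z \<and> q' \<in> A Z}"
      using finite_ZS by (simp add: sum.inter_filter[symmetric])
    finally show ?thesis by (simp add: mult.commute)
  qed
  let ?P = "{(q, q') \<in> ?F \<times> ?F. q \<noteq> q'}"
  have finP: "finite ?P" by (rule finite_subset[of _ "?F \<times> ?F"]) (auto simp: finite_forest)
  have "{Z \<in> ZS. \<not> inj_on (fplace Z f) (A Z)} \<subseteq> (\<Union>(q, q')\<in>?P. B q q')"
  proof
    fix Z assume "Z \<in> {Z \<in> ZS. \<not> inj_on (fplace Z f) (A Z)}"
    then obtain q q' where "Z \<in> ZS" "q \<in> A Z" "q' \<in> A Z" "q \<noteq> q'" "fplace Z f q = fplace Z f q'"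
      by (auto simp: inj_on_def)
    moreover from this have "(q, q') \<in> ?P" using AF[of Z] by auto
    ultimately show "Z \<in> (\<Union>(q, q')\<in>?P. B q q')" by (force simp: B_def)
  qed
  then have "card {Z \<in> ZS. \<not> inj_on (fplace Z f) (A Z)} \<le> card (\<Union>(q, q')\<in>?P. B q q')"
    using finP finite_ZS by (intro card_mono) (auto simp: B_def)
  also have "\<dots> \<le> (\<Sum>(q, q')\<in>?P. card (B q q'))"
    using card_UN_le[OF finP, of "\<lambda>(q, q'). B q q'"] by (simp add: case_prod_beta')
  finally have "card {Z \<in> ZS. \<not> inj_on (fplace Z f) (A Z)} * card Gs \<le> (\<Sum>(q, q')\<in>?P. card (B q q')) * card Gs"
    by (rule mult_le_mono1)
  also have "\<dots> = (\<Sum>(q, q')\<in>?P. card (B q q') * card Gs)"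
    by (simp add: sum_distrib_right case_prod_beta')
  also have "\<dots> \<le> (\<Sum>(q, q')\<in>?P. \<kappa> * card {Z \<in> ZS. q \<in> A Z \<and> q' \<in> A Z})"
    using one by (intro sum_mono) auto
  also have "\<dots> \<le> (\<Sum>(q, q')\<in>?F \<times> ?F. \<kappa> * card {Z \<in> ZS. q \<in> A Z \<and> q' \<in> A Z})"
    by (intro sum_mono2) (auto simp: finite_forest)
  also have "\<dots> = (\<Sum>(q, q')\<in>?F \<times> ?F. \<Sum>Z\<in>ZS. \<kappa> * (if q \<in> A Z \<and> q' \<in> A Z then 1 else 0))"
    using finite_ZS by (simp add: sum.inter_filter[symmetric] sum_distrib_left[symmetric])
  also have "\<dots> = (\<Sum>Z\<in>ZS. \<kappa> * (\<Sum>(q, q')\<in>?F \<times> ?F. if q \<in> A Z \<and> q' \<in> A Z then 1 else 0))"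
    unfolding case_prod_beta' sum_distrib_left by (rule sum.swap)
  \<comment> \<open>The union bound runs over all pairs of addresses of the forest, but each pair is
    weighted by the event that both are live, and at most L * L pairs are live at a time.\<close>
  also have "\<dots> \<le> (\<Sum>Z\<in>ZS. \<kappa> * (L * L))"
  proof (intro sum_mono mult_le_mono2)
    fix Z
    have "(\<Sum>(q, q')\<in>?F \<times> ?F. if q \<in> A Z \<and> q' \<in> A Z then 1 else 0 :: nat)
        = card {x \<in> ?F \<times> ?F. fst x \<in> A Z \<and> snd x \<in> A Z}"
      using finite_forest by (simp add: case_prod_beta' sum.inter_filter[symmetric])
    also have "\<dots> \<le> card (A Z \<times> A Z)"
      by (rule card_mono) (auto simp: A_def finite_alive)
    also have "\<dots> \<le> L * L"
      unfolding card_cartesian_product A_def by (intro mult_le_mono card_alive e)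
    finally show "(\<Sum>(q, q')\<in>?F \<times> ?F. if q \<in> A Z \<and> q' \<in> A Z then 1 else 0) \<le> L * L" .
  qed
  also have "\<dots> = L * L * \<kappa> * card ZS" by simp
  finally show ?thesis by (simp add: A_def)
qed

end

subsection \<open>Guessing the centre edge\<close>

primrec trunc :: "strategy \<Rightarrow> nat \<Rightarrow> strategy" where
  "trunc (Answer x) T = Answer x"
| "trunc (Query v i k) T = (if T = 0 then Answer None else Query v i (\<lambda>y. trunc (k y) (T - 1)))"

primrec max_queries :: "strategy \<Rightarrow> nat \<Rightarrow> bool" where
  "max_queries (Answer x) T = True"
| "max_queries (Query v i k) T = (0 < T \<and> (\<forall>y. max_queries (k y) (T - 1)))"

text \<open>Asking for the neighbors of \<open>v\<close> beforehand changes no answer, but it makes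
  their labels part of the transcript. In a good sample these are distinct, so a label answered by
  \<open>S\<close> singles out one port.\<close>

primrec ask :: "nat \<Rightarrow> nat \<Rightarrow> strategy \<Rightarrow> strategy" where
  "ask v 0 S = S"
| "ask v (Suc j) S = Query v (Suc j) (\<lambda>_. ask v j S)"

lemma run_trunc: "query_count ad S \<le> T \<Longrightarrow> run ad (trunc S T) = run ad S"
proof (induction S arbitrary: T)
  case (Query v i k)
  then show ?case by (cases T) auto
qed simp

lemma max_queries_trunc: "max_queries (trunc S T) T"
  by (induction S arbitrary: T) auto

lemma run_ask: "run ad (ask v j S) = run ad S"
  by (induction j) auto

lemma max_queries_ask: "max_queries S T \<Longrightarrow> max_queries (ask v j S) (j + T)"
  by (induction j) auto

lemma vb_mono: "vb e T \<Longrightarrow> T \<le> T' \<Longrightarrow> vb e T'"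
proof (induction e arbitrary: T T')
  case (Visit p c)
  have "vb (c y) (T' - 1)" for y
    by (rule Visit.IH[OF rangeI, of y "T - 1"]) (use Visit.prems in auto)
  then show ?case using Visit.prems by auto
qed simp

lemma vb_restr: "vb e T \<Longrightarrow> vb (restr k e ob) T"
proof (induction e arbitrary: T)
  case (Visit p c)
  have IH: "vb (restr k (c y) ob) (T - 1)" for y
    by (rule Visit.IH[OF rangeI]) (use Visit.prems in auto)
  have IH': "vb (restr k (c y) ob) T" for y
    by (rule vb_mono[OF IH]) simp
  show ?case using Visit.prems IH IH' by simp
qed simp

lemma depth_le_mono: "depth_le L e \<Longrightarrow> L \<le> L' \<Longrightarrow> depth_le L' e"
  by (induction e) auto

lemma result_restr: "result (restr k e ob) (\<lambda>q. ob (k # q)) = result e ob"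
  by (induction e) (auto simp: in_port_def)

text \<open>Labels fixed in advance can be built into the explorer, which leaves an explorer of
  degrees alone, as the tree processes require.\<close>

primrec relabel :: "(nat list \<Rightarrow> nat) \<Rightarrow> (nat \<times> nat) explorer \<Rightarrow> nat explorer" where
  "relabel l (Stop x) = Stop x"
| "relabel l (Visit p c) = Visit p (\<lambda>a. relabel l (c (a, if a = 0 then 0 else l p)))"

lemma result_relabel:
  "result (relabel l e) a = result e (\<lambda>q. (a q, if a q = 0 then 0 else l q))"
  by (induction e) auto

lemma depth_le_relabel: "depth_le L e \<Longrightarrow> depth_le L (relabel l e)"
  by (induction e) auto

lemma vb_relabel: "vb e T \<Longrightarrow> vb (relabel l e) T"
  by (induction e arbitrary: T) auto

context lift
begin

lemma vb_sim: "max_queries S T \<Longrightarrow> vb (sim S mem) (3 * T)"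
proof (induction S arbitrary: mem T)
  case (Query v i k)
  obtain T' where T: "T = Suc T'" using Query.prems by (cases T) auto
  have IH: "vb (sim (k x) mem') (3 * T')" for x mem'
    by (rule Query.IH[OF rangeI]) (use Query.prems T in auto)
  have IH': "vb (sim (k x) mem') R" if "3 * T' \<le> R" for x mem' R
    using vb_mono[OF IH that] .
  show ?case
    by (auto simp: T Let_def intro!: IH')
qed simp

text \<open>A child bearing the label of \<open>v\<close> itself would redirect the memory of
  \<open>v\<close> and divert the remaining questions. This case is kept apart; it is a collision of
  labels.\<close>

lemma ask_visits_ports:
  assumes "mem v = None \<or> mem v = Some [v]" "v < nv" "fst (ob [v]) = d" "j \<le> d"
    "\<And>k. k < d \<Longrightarrow> fst (ob [v, k]) \<noteq> 0"
  shows "(\<forall>k<j. [v, k] \<in> visited (sim (ask v j S) mem) ob)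
    \<or> (\<exists>k<j. [v, k] \<in> visited (sim (ask v j S) mem) ob \<and> snd (ob [v, k]) = v)"
  using assms(1,4)
proof (induction j arbitrary: mem)
  case (Suc j)
  have P: "(case mem v of None \<Rightarrow> [v] | Some P \<Rightarrow> P) = [v]" using Suc.prems(1) by auto
  let ?w = "snd (ob [v, j])"
  have vis: "visited (sim (ask v (Suc j) S) mem) ob
      = {[v], [v, j]} \<union> visited (sim (ask v j S) (mem(v \<mapsto> [v], ?w \<mapsto> [v, j]))) ob"
    using assms(2,3) assms(5)[of j] Suc.prems(2) P by (auto simp: Let_def)
  show ?case
  proof (cases "?w = v")
    case True
    then show ?thesis unfolding vis by blast
  next
    case False
    have "(\<forall>k<j. [v, k] \<in> visited (sim (ask v j S) (mem(v \<mapsto> [v], ?w \<mapsto> [v, j]))) ob)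
      \<or> (\<exists>k<j. [v, k] \<in> visited (sim (ask v j S) (mem(v \<mapsto> [v], ?w \<mapsto> [v, j]))) ob \<and> snd (ob [v, k]) = v)"
      by (rule Suc.IH) (use False Suc.prems in auto)
    then show ?thesis unfolding vis by (auto simp: less_Suc_eq)
  qed
qed simp

lemma ask_visits_root:
  assumes "mem v = None" "v < nv" "0 < j"
  shows "[v] \<in> visited (sim (ask v j S) mem) ob"
  using assms by (cases j) (auto simp: Let_def)

end

section \<open>The centre edge is hard to guess\<close>

locale gadget_lift = gadget h N s d + lift "gadget_vertices h N" "edges h N s d" d Gs act col cs
  for h N s d :: nat and Gs :: "'g set" and act col cs +
  fixes z :: nat
  assumes z: "even z" "2 \<le> z" "60 * z \<le> s - 2"
begin

interpretation ind: indistinguishability d ch ar None z "s - 2" R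
  apply unfold_locales
      apply (rule z)
     apply (rule z)
    apply (rule z)
   apply (erule R_ar)
  apply (erule R_step)
  done

definition centre_item :: "vertex \<Rightarrow> nat" where
  "centre_item b = (SOME a. a < d \<and> item b a = (b, 0))"

lemma centre_item:
  assumes "x < N"
  shows "centre_item (U h x) < d" "item (U h x) (centre_item (U h x)) = (U h x, 0)"
proof -
  have b: "U h x \<in> Bs" using assms by simp
  have dg: "deg (U h x) = d" using deg_pos_depth[OF b] h1 by simp
  have "(U h x, 0) \<in> items (U h x)" using assms by (simp add: mem_items)
  then obtain a where "a < d \<and> item (U h x) a = (U h x, 0)" using item_ex[OF dg] by metis
  then have "centre_item (U h x) < d \<and> item (U h x) (centre_item (U h x)) = (U h x, 0)"
    unfolding centre_item_def by (rule someI)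
  then show "centre_item (U h x) < d" "item (U h x) (centre_item (U h x)) = (U h x, 0)" by auto
qed

text \<open>The centre edge leads to depth h, each of the s edges to \<open>C (h - 1)\<close> to
  depth h - 1, and all of them share a parent of depth h. Hence the subtrees behind them are close
  at level h - 1.\<close>

lemma guess_centre:
  fixes t :: "nat option \<Rightarrow> nat"
  assumes x: "x < N" and e: "depth_le (Suc L) e" and V: "\<And>ob. visits e ob \<le> V"
  shows "z ^ (h - 1) * s * card {f \<in> orders d (Suc L).
      t (result e (obs (Some (U h x, None)) f)) = port (centre_item (U h x)) f}
    \<le> (z ^ (h - 1) + s * V) * card (orders d (Suc L))"
proof -
  let ?b = "U h x"
  have b: "?b \<in> Bs" using x by simp
  have dg: "deg ?b = d" using deg_pos_depth[OF b] h1 by simp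
  define G where "G = {a. a < d \<and> item ?b a \<in> (\<lambda>r. (C (h - 1), r)) ` {..<s}}"
  have sub: "(\<lambda>r. (C (h - 1), r)) ` {..<s} \<subseteq> items ?b" using h1 by (auto simp: mem_items)
  have cG: "card G = s" unfolding G_def card_item_set[OF dg sub] by (simp add: card_image inj_on_def)
  have Gp: "c < d \<and> fst (item ?b c) = C (h - 1)" if "c \<in> G" for c using that by (auto simp: G_def)
  have "z ^ (h - 1) * card G * card {f \<in> orders d (Suc L). t (result e (obs (Some (?b, None)) f)) = port (centre_item ?b) f}
    \<le> (z ^ (h - 1) + card G * V) * card (orders d (Suc L))"
  proof (rule ind.guess_item[OF centre_item(1)[OF x] _ _ e V])
    show "G \<subseteq> {..<d} - {centre_item ?b}" using Gp centre_item(2)[OF x] by fastforce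
    show "R (h - 1) (ch (Some (?b, None)) (centre_item ?b)) (ch (Some (?b, None)) c) \<and>
        R (h - 1) (ch (Some (?b, None)) c) (ch (Some (?b, None)) (centre_item ?b))" if "c \<in> G" for c
      using Gp[OF that] centre_item[OF x] by (intro conjI R_child b) auto
  qed
  then show ?thesis unfolding cG .
qed

definition port_of :: "nat \<Rightarrow> (nat list \<Rightarrow> nat) \<Rightarrow> nat option \<Rightarrow> nat" where
  "port_of v l r = (SOME k. k < d \<and> Some (l [v, k]) = r)"

definition guessed where
  "guessed e v Z f l \<longleftrightarrow> (\<exists>x<N. base (Z v) = U h x) \<and>
     port_of v l (result e (fob Z f l)) = inv (f [v]) (centre_item (base (Z v)))"

text \<open>Only the orders in the tree rooted at \<open>v\<close> are redrawn. With everything else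
  fixed, the explorer, its labels built in, restricts to an explorer of this single tree.\<close>

lemma guessed_count_fixed:
  assumes v: "v < nv" and e: "depth_le L e" "vb e L"
  shows "z ^ (h - 1) * s * card {f \<in> FS L. guessed e v Z f l} \<le> (z ^ (h - 1) + s * L) * card (FS L)"
proof (cases "\<exists>x<N. base (Z v) = U h x")
  case True
  then obtain x where x: "x < N" "base (Z v) = U h x" by blast
  let ?a = "centre_item (U h x)" and ?u = "z ^ (h - 1) * s"
  have eq: "?u * card {f \<in> FS L. guessed e v Z f l} = (\<Sum>f\<in>FS L. if guessed e v Z f l then ?u else 0)"
    by (rule card_Collect_sum[OF finite_FS])
  have "(\<Sum>f\<in>FS L. if guessed e v Z f l then ?u else 0) \<le> (\<Sum>f\<in>FS L. z ^ (h - 1) + s * L)"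
  proof (rule resample_sum_le[where \<kappa> = "\<lambda>_. v" and Y = "orders d (Suc L)"])
    show "finite (FS L)" "finite (orders d (Suc L))" "orders d (Suc L) \<noteq> {}"
      by (rule finite_FS finite_orders orders_ne)+
    show "upd f v h' \<in> FS L \<and> v = v" if "f \<in> FS L" "h' \<in> orders d (Suc L)" for f h'
    proof -
      have "upd f v h' q permutes {..<d}" for q
        using FS_permutes[OF that(1)] orders_permutes[OF that(2)] by (simp add: upd_def)
      moreover have "upd f v h' q = id" if q: "q \<notin> forest L" for q
      proof (cases "in_port v q")
        case True
        then have "tl q \<notin> paths d (Suc L)" using q v by (auto simp: in_port_def forest_Cons)
        then show ?thesis using orders_id[OF \<open>h' \<in> orders d (Suc L)\<close>] True by (simp add: upd_def)
      next
        case False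
        then show ?thesis using \<open>f \<in> FS L\<close> q by (simp add: upd_def FS_def PiE_dflt_def)
      qed
      ultimately show ?thesis by (simp add: FS_def PiE_dflt_def)
    qed
    show "sub f v \<in> orders d (Suc L)" if "f \<in> FS L" for f
    proof (rule orders_memI)
      show "sub f v p permutes {..<d}" for p using FS_permutes[OF that] by (simp add: sub_def)
      show "sub f v p = id" if "p \<notin> paths d (Suc L)" for p
        using that \<open>f \<in> FS L\<close> by (simp add: sub_def forest_Cons FS_def PiE_dflt_def)
    qed
    fix f assume f: "f \<in> FS L"
    let ?ob = "\<lambda>f q. ar (fstate Z f q)"
    define e2 where "e2 = restr v (relabel (flab l) e) (?ob f)"
    have vis: "visits e2 ob \<le> L" for ob
      unfolding e2_def by (intro vb_visits vb_restr vb_relabel e(2))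
    have "depth_le (Suc (Suc L)) (relabel (flab l) e)"
      by (rule depth_le_mono[OF depth_le_relabel[OF e(1)]]) simp
    then have dp: "depth_le (Suc L) e2" unfolding e2_def by (rule depth_le_restr)
    have obv: "(\<lambda>q. ?ob (upd f v h') (v # q)) = obs (Some (U h x, None)) h'" for h'
      by (auto simp: fstate_def obs_def x(2) sub_upd)
    have res: "result e (fob Z (upd f v h') l) = result e2 (obs (Some (U h x, None)) h')" for h'
    proof -
      have "?ob f p = ?ob (upd f v h') p" if "\<not> in_port v p" for p
        using that by (cases p) (auto simp: fstate_def sub_upd)
      then have "restr v (relabel (flab l) e) (?ob f) = restr v (relabel (flab l) e) (?ob (upd f v h'))"
        by (intro restr_cong) auto
      then show ?thesis
        unfolding e2_def obv[of h', symmetric]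
        by (simp add: result_restr[of v _ "?ob (upd f v h')"] result_relabel fob_def[abs_def])
    qed
    have "guessed e v Z (upd f v h') l \<longleftrightarrow>
        port_of v l (result e2 (obs (Some (U h x, None)) h')) = port ?a h'" for h'
    proof -
      have "upd f v h' [v] = h' []" by (simp add: upd_def)
      then show ?thesis using x by (auto simp: guessed_def res port_def)
    qed
    then have "(\<Sum>h'\<in>orders d (Suc L). if guessed e v Z (upd f v h') l then ?u else 0)
        = ?u * card {h' \<in> orders d (Suc L). port_of v l (result e2 (obs (Some (U h x, None)) h')) = port ?a h'}"
      unfolding card_Collect_sum[OF finite_orders] by simp
    also have "\<dots> \<le> (z ^ (h - 1) + s * L) * card (orders d (Suc L))"
      by (rule guess_centre[OF x(1) dp vis])
    finally show "(\<Sum>h'\<in>orders d (Suc L). if guessed e v Z (upd f v h') l then ?u else 0)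
        \<le> (\<Sum>h'\<in>orders d (Suc L). z ^ (h - 1) + s * L)" by (simp add: mult.commute)
  qed
  then show ?thesis unfolding eq by (simp add: mult.commute)
next
  case False
  then have "{f \<in> FS L. guessed e v Z f l} = {}" by (auto simp: guessed_def)
  then show ?thesis by (simp only: card.empty mult_0_right zero_le)
qed

lemma card_samples: "card (samples L) = card ZS * (card (FS L) * card (LS L))"
  by (simp add: samples_def card_cartesian_product)

text \<open>Fubini: a bound for each choice of two coordinates of a sample is a bound for all
  samples. The variants for labels and roots follow.\<close>

lemma card_samples_le:
  assumes "\<And>Z l. Z \<in> ZS \<Longrightarrow> l \<in> LS L \<Longrightarrow> a * card {f \<in> FS L. P Z f l} \<le> b * card (FS L)"
  shows "a * card {(Z, f, l) \<in> samples L. P Z f l} \<le> b * card (samples L)"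
proof -
  have "{(Z, f, l) \<in> samples L. P Z f l} = (\<Union>(Z, l)\<in>ZS \<times> LS L. (\<lambda>f. (Z, f, l)) ` {f \<in> FS L. P Z f l})"
    by (auto simp: samples_def)
  then have "card {(Z, f, l) \<in> samples L. P Z f l}
      \<le> (\<Sum>(Z, l)\<in>ZS \<times> LS L. card ((\<lambda>f. (Z, f, l)) ` {f \<in> FS L. P Z f l}))"
    using card_UN_le[of "ZS \<times> LS L" "\<lambda>(Z, l). (\<lambda>f. (Z, f, l)) ` {f \<in> FS L. P Z f l}"]
    by (simp add: finite_ZS finite_LS case_prod_beta')
  also have "\<dots> \<le> (\<Sum>(Z, l)\<in>ZS \<times> LS L. card {f \<in> FS L. P Z f l})"
    by (intro sum_mono) (auto intro!: card_image_le simp: finite_FS)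
  finally have "a * card {(Z, f, l) \<in> samples L. P Z f l}
      \<le> (\<Sum>(Z, l)\<in>ZS \<times> LS L. a * card {f \<in> FS L. P Z f l})"
    by (simp add: sum_distrib_left[symmetric] case_prod_beta')
  also have "\<dots> \<le> (\<Sum>(Z, l)\<in>ZS \<times> LS L. b * card (FS L))"
    using assms by (intro sum_mono) auto
  also have "\<dots> = b * card (samples L)"
    by (simp add: card_samples card_cartesian_product)
  finally show ?thesis .
qed

lemma card_samples_le_labels:
  assumes "\<And>Z f. Z \<in> ZS \<Longrightarrow> f \<in> FS L \<Longrightarrow> a * card {l \<in> LS L. P Z f l} \<le> b * card (LS L)"
  shows "a * card {(Z, f, l) \<in> samples L. P Z f l} \<le> b * card (samples L)"
proof -
  have "{(Z, f, l) \<in> samples L. P Z f l} = (\<Union>(Z, f)\<in>ZS \<times> FS L. (\<lambda>l. (Z, f, l)) ` {l \<in> LS L. P Z f l})"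
    by (auto simp: samples_def)
  then have "card {(Z, f, l) \<in> samples L. P Z f l}
      \<le> (\<Sum>(Z, f)\<in>ZS \<times> FS L. card ((\<lambda>l. (Z, f, l)) ` {l \<in> LS L. P Z f l}))"
    using card_UN_le[of "ZS \<times> FS L" "\<lambda>(Z, f). (\<lambda>l. (Z, f, l)) ` {l \<in> LS L. P Z f l}"]
    by (simp add: finite_ZS finite_FS case_prod_beta')
  also have "\<dots> \<le> (\<Sum>(Z, f)\<in>ZS \<times> FS L. card {l \<in> LS L. P Z f l})"
    by (intro sum_mono) (auto intro!: card_image_le simp: finite_LS)
  finally have "a * card {(Z, f, l) \<in> samples L. P Z f l}
      \<le> (\<Sum>(Z, f)\<in>ZS \<times> FS L. a * card {l \<in> LS L. P Z f l})"
    by (simp add: sum_distrib_left[symmetric] case_prod_beta')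
  also have "\<dots> \<le> (\<Sum>(Z, f)\<in>ZS \<times> FS L. b * card (LS L))"
    using assms by (intro sum_mono) auto
  also have "\<dots> = b * card (samples L)"
    by (simp add: card_samples card_cartesian_product)
  finally show ?thesis .
qed

lemma card_samples_le_roots:
  assumes "\<And>f l. f \<in> FS L \<Longrightarrow> l \<in> LS L \<Longrightarrow> a * card {Z \<in> ZS. P Z f l} \<le> b * card ZS"
  shows "a * card {(Z, f, l) \<in> samples L. P Z f l} \<le> b * card (samples L)"
proof -
  have "{(Z, f, l) \<in> samples L. P Z f l} = (\<Union>(f, l)\<in>FS L \<times> LS L. (\<lambda>Z. (Z, f, l)) ` {Z \<in> ZS. P Z f l})"
    by (auto simp: samples_def)
  then have "card {(Z, f, l) \<in> samples L. P Z f l}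
      \<le> (\<Sum>(f, l)\<in>FS L \<times> LS L. card ((\<lambda>Z. (Z, f, l)) ` {Z \<in> ZS. P Z f l}))"
    using card_UN_le[of "FS L \<times> LS L" "\<lambda>(f, l). (\<lambda>Z. (Z, f, l)) ` {Z \<in> ZS. P Z f l}"]
    by (simp add: finite_FS finite_LS case_prod_beta')
  also have "\<dots> \<le> (\<Sum>(f, l)\<in>FS L \<times> LS L. card {Z \<in> ZS. P Z f l})"
    by (intro sum_mono) (auto intro!: card_image_le simp: finite_ZS)
  finally have "a * card {(Z, f, l) \<in> samples L. P Z f l}
      \<le> (\<Sum>(f, l)\<in>FS L \<times> LS L. a * card {Z \<in> ZS. P Z f l})"
    by (simp add: sum_distrib_left[symmetric] case_prod_beta')
  also have "\<dots> \<le> (\<Sum>(f, l)\<in>FS L \<times> LS L. b * card ZS)"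
    using assms by (intro sum_mono) auto
  also have "\<dots> = b * card (samples L)"
    by (simp add: card_samples card_cartesian_product)
  finally show ?thesis .
qed

text \<open>The first two terms bound the collisions of labels and of places, the other two a lucky
  guess. All other ideal samples have transcripts on which the centre neighbor of \<open>v\<close>
  is not answered, and the real model produces such transcripts at least as often as the ideal
  one.\<close>

theorem centre_guess_bound:
  fixes S :: strategy
  assumes v: "v < nv" and S: "\<And>\<pi> \<sigma>. \<pi> \<in> labellings \<Longrightarrow> \<sigma> \<in> vorders \<Longrightarrow> query_count (adj \<pi> \<sigma>) S \<le> T"
  defines "L \<equiv> 3 * (d + T)"
  assumes \<kappa>: "1 \<le> \<kappa>" "\<And>w. w \<noteq> [] \<Longrightarrow> reduced w \<Longrightarrow> set w \<subseteq> cs \<Longrightarrow> length w \<le> 2 * L \<Longrightarrow>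
      card {g \<in> Gs. fold act w g = g} \<le> \<kappa>"
  shows "real (card {(\<pi>, \<sigma>) \<in> labellings \<times> vorders. (\<exists>x<N. base (rZ \<pi> v) = U h x) \<and>
      run (adj \<pi> \<sigma>) S = Some (\<pi> (nbr (rZ \<pi> v) (centre_item (base (rZ \<pi> v)))))})
    \<le> (real (L * L) / real nv + real (L * L * \<kappa>) / real (card Gs) + 1 / real s + real L / real (z ^ (h - 1)))
      * real (card (labellings \<times> vorders))"
proof -
  define e where "e = sim (ask v d (trunc S T)) Map.empty"
  let ?I = "samples L" and ?Rl = "labellings \<times> vorders"
  have e: "orderly e Map.empty" "vb e L"
    unfolding e_def L_def
    by (auto intro!: orderly_sim simp: tidy_def)[] (rule vb_sim[OF max_queries_ask[OF max_queries_trunc]])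
  have ports: "okp ob p" if "p \<in> visited e ob" for ob p
    using sim_okp[where mem = Map.empty and ob = ob and p = p and S = "ask v d (trunc S T)"] that by (simp add: e_def)
  have dpL: "depth_le L e" using orderly_depth_le[OF e, of 0] by simp
  have d0: "0 < d" using d2 by simp
  let ?B1 = "{(Z, f, l) \<in> ?I. \<not> inj_on (flab l) (alive e (fob Z f l))}"
  let ?B2 = "{(Z, f, l) \<in> ?I. \<not> inj_on (fplace Z f) (alive e (fob Z f l))}"
  let ?B3 = "{(Z, f, l) \<in> ?I. guessed e v Z f l}"
  define Good where "Good = {(Z, f, l) \<in> ?I. good e Z f l \<and> \<not> guessed e v Z f l}"
  have b1: "nv * card ?B1 \<le> (L * L) * card ?I"
    by (rule card_samples_le_labels) (use label_collisions[OF e] in \<open>simp add: mult.commute\<close>)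
  have b2: "card Gs * card ?B2 \<le> (L * L * \<kappa>) * card ?I"
    by (rule card_samples_le_roots) (use place_collisions[OF e _ ports \<kappa>] in \<open>simp add: mult.commute\<close>)
  have b3: "(z ^ (h - 1) * s) * card ?B3 \<le> (z ^ (h - 1) + s * L) * card ?I"
    by (rule card_samples_le) (rule guessed_count_fixed[OF v dpL e(2)])
  define \<Phi> where "\<Phi> = {(\<pi>, \<sigma>) \<in> ?Rl. (\<exists>x<N. base (rZ \<pi> v) = U h x) \<and>
      run (adj \<pi> \<sigma>) S = Some (\<pi> (nbr (rZ \<pi> v) (centre_item (base (rZ \<pi> v)))))}"
  define Q where "Q = {(\<pi>, \<sigma>) \<in> ?Rl. \<exists>(Z, f, l)\<in>Good. key e (rZ \<pi>) (rf \<pi> \<sigma>) (rl \<pi> \<sigma>) = key e Z f l}"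
  have dom: "card Good * card ?Rl \<le> card Q * card ?I"
    unfolding Q_def by (rule real_dominates_ideal[OF e]) (auto simp: Good_def)
  \<comment> \<open>A real run with the transcript of a good sample gives the same answer as that
    sample. If it were correct at a vertex over \<open>U h x\<close>, the sample would have guessed
    the port of the centre edge.\<close>
  have "Q \<inter> \<Phi> = {}"
  proof (rule ccontr)
    assume "Q \<inter> \<Phi> \<noteq> {}"
    then obtain \<pi> \<sigma> Z f l x where m: "\<pi> \<in> labellings" "\<sigma> \<in> vorders" and g: "(Z, f, l) \<in> Good"
      and k: "key e (rZ \<pi>) (rf \<pi> \<sigma>) (rl \<pi> \<sigma>) = key e Z f l"
      and x: "x < N" "base (rZ \<pi> v) = U h x"
      and run: "run (adj \<pi> \<sigma>) S = Some (\<pi> (nbr (rZ \<pi> v) (centre_item (base (rZ \<pi> v)))))"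
      by (auto simp: Q_def \<Phi>_def)
    have Z: "Z \<in> ZS" "f \<in> FS L" "l \<in> LS L" and gd: "good e Z f l" and ng: "\<not> guessed e v Z f l"
      using g by (auto simp: Good_def samples_def)
    have ZV: "\<And>u. u < nv \<Longrightarrow> Z u \<in> Vs" using ZS_Vs[OF Z(1)] .
    let ?ob = "fob Z f l"
    have bB: "base (Z v) \<in> Bs" using ZV[OF v] by (auto simp: Vs_def)
    have "[v] \<in> visited e ?ob" unfolding e_def by (rule ask_visits_root) (use v d0 in auto)
    then have av: "[v] \<in> alive e ?ob"
      using deg_pos(1)[OF bB] by (simp add: alive_def fob_def fstate_root)
    have Zv: "rZ \<pi> v = Z v" using key_agree_root[OF e k av] .
    have fv: "rf \<pi> \<sigma> [v] = f [v]" using key_agree(2)[OF e k av] by simp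
    have bU: "base (Z v) = U h x" using x Zv by simp
    have dg: "deg (U h x) = d" using deg_pos_depth[of "U h x"] x(1) h1 by simp
    have fst_root: "fst (?ob [v]) = d" using bU dg by (simp add: fob_def fstate_root)
    have child: "fst (?ob [v, k]) \<noteq> 0" if "k < d" for k
    proof -
      have a: "f [v] k < d" using permutes_in_image[OF FS_permutes[OF Z(2)], of "[v]" k] that by simp
      have "fstate Z f [v, k] = ch (fstate Z f [v]) (f [v] k)" using fstate_snoc[of "[v]" Z f k] by simp
      also have "\<dots> = Some (fst (item (U h x) (f [v] k)), Some (U h x, snd (item (U h x) (f [v] k))))"
        unfolding fstate_root bU by (rule ch_Some[OF a]) simp
      finally have "fst (?ob [v, k]) = deg (fst (item (U h x) (f [v] k)))" by (simp add: fob_def)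
      moreover have "fst (item (U h x) (f [v] k)) \<in> Bs"
        using valid_child[of "U h x", OF _ a] x(1) by (simp add: valid_def)
      ultimately show ?thesis using deg_pos(1) by fastforce
    qed
    \<comment> \<open>\<open>ask\<close> visits all ports of \<open>v\<close> unless some child
      bears the label of \<open>v\<close>, and that would collide with the live root.\<close>
    have all: "[v, k] \<in> alive e ?ob" if "k < d" for k
    proof -
      have "(\<forall>k<d. [v, k] \<in> visited e ?ob) \<or> (\<exists>k<d. [v, k] \<in> visited e ?ob \<and> snd (?ob [v, k]) = v)"
        unfolding e_def by (rule ask_visits_ports) (use v fst_root child in auto)
      moreover have False if "k < d" "[v, k] \<in> visited e ?ob" "snd (?ob [v, k]) = v" for k
      proof -
        have "[v, k] \<in> alive e ?ob" using that child by (simp add: alive_def)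
        moreover have "flab l [v, k] = flab l [v]"
          using that child[OF that(1)] by (simp add: fob_def flab_def split: if_splits)
        ultimately show False using gd av unfolding good_def[OF e] inj_on_def by blast
      qed
      ultimately show ?thesis using that child by (auto simp: alive_def)
    qed
    define a where "a = centre_item (U h x)"
    define k' where "k' = inv (f [v]) a"
    have a: "a < d" using centre_item(1)[OF x(1)] by (simp add: a_def)
    have pv: "f [v] permutes {..<d}" using FS_permutes[OF Z(2)] .
    have k': "k' < d" "f [v] k' = a"
      using permutes_in_image[OF permutes_inv[OF pv], of a] a permutes_inverses(1)[OF pv] by (auto simp: k'_def)
    have "rl \<pi> \<sigma> [v, k'] = l [v, k']" using key_agree(2)[OF e k all[OF k'(1)]] by (simp add: flab_def)
    moreover have "rl \<pi> \<sigma> [v, k'] = \<pi> (nbr (rZ \<pi> v) (\<sigma> (rZ \<pi> v) k'))" by (simp add: rl_def)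
    moreover have "\<sigma> (rZ \<pi> v) = f [v]" using fv by (simp add: rf_def)
    ultimately have lk: "l [v, k'] = \<pi> (nbr (rZ \<pi> v) a)" using k'(2) by simp
    have "run (adj \<pi> \<sigma>) S = result e (fob (rZ \<pi>) (rf \<pi> \<sigma>) (rl \<pi> \<sigma>))"
      using run_eq_sim[OF m, of Map.empty "ask v d (trunc S T)"] run_trunc[OF S[OF m]]
      by (simp add: e_def run_ask)
    also have "\<dots> = result e ?ob" by (rule key_result[OF e ZV k])
    finally have res: "result e ?ob = Some (l [v, k'])" using run lk x by (simp add: a_def)
    have "port_of v l (result e ?ob) = k'"
      unfolding port_of_def res
    proof (rule some_equality)
      fix k assume k: "k < d \<and> Some (l [v, k]) = Some (l [v, k'])"
      then have "flab l [v, k] = flab l [v, k']" by (simp add: flab_def)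
      then have "[v, k] = [v, k']" using gd all[of k] all[of k'] k k'(1) unfolding good_def[OF e] inj_on_def by blast
      then show "k = k'" by simp
    qed (use k'(1) in simp)
    then have "guessed e v Z f l" using bU x(1) by (auto simp: guessed_def k'_def a_def)
    then show False using ng by blast
  qed
  moreover have fin: "finite ?Rl" by (rule finite_real[OF e])
  moreover have sub: "Q \<subseteq> ?Rl" "\<Phi> \<subseteq> ?Rl" by (auto simp: Q_def \<Phi>_def)
  ultimately have "card Q + card \<Phi> = card (Q \<union> \<Phi>)"
    using finite_subset by (intro card_Un_disjoint[symmetric]) blast+
  also have "\<dots> \<le> card ?Rl" using fin sub by (intro card_mono) auto
  finally have QP: "card Q + card \<Phi> \<le> card ?Rl" .
  have "?I \<subseteq> Good \<union> (?B1 \<union> (?B2 \<union> ?B3))" by (auto simp: Good_def good_def[OF e])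
  then have "card ?I \<le> card (Good \<union> (?B1 \<union> (?B2 \<union> ?B3)))"
    by (intro card_mono) (auto simp: Good_def intro: finite_subset[OF _ finite_samples])
  also have "\<dots> \<le> card Good + (card ?B1 + (card ?B2 + card ?B3))"
    by (meson add_left_mono card_Un_le order_trans)
  finally have cI: "card ?I \<le> card Good + (card ?B1 + (card ?B2 + card ?B3))" .
  have Ipos: "0 < card ?I"
  proof -
    have "{s. s permutes {..<d}} \<noteq> {}" using permutes_id by blast
    then have "ZS \<noteq> {}" "FS L \<noteq> {}" "LS L \<noteq> {}"
      unfolding ZS_def FS_def LS_def PiE_dflt_empty_iff using nv_pos Gs_ne Bs_ne by (auto simp: Vs_def)
    then show ?thesis using finite_samples by (simp add: card_gt_0_iff samples_def)
  qed
  define i r where "i = real (card ?I)" and "r = real (card ?Rl)"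
  have ip: "0 < i" using Ipos by (simp add: i_def)
  have Gp: "0 < real (card Gs)" using finite_Gs Gs_ne by (simp add: card_gt_0_iff)
  have zp: "0 < real (z ^ (h - 1))" using z(2) by simp
  have sp: "0 < real s" using s1 by simp
  have B1: "real (card ?B1) \<le> real (L * L) / real nv * i"
    using of_nat_mono[OF b1, where 'a = real] nv_pos by (simp add: i_def field_simps)
  have B2: "real (card ?B2) \<le> real (L * L * \<kappa>) / real (card Gs) * i"
    using of_nat_mono[OF b2, where 'a = real] Gp by (simp add: i_def field_simps)
  have B3: "real (card ?B3) \<le> (1 / real s + real L / real (z ^ (h - 1))) * i"
  proof -
    define y where "y = real (z ^ (h - 1))"
    have yp: "0 < y" using zp by (simp only: y_def)
    have "real (z ^ (h - 1) * s * card ?B3) \<le> real ((z ^ (h - 1) + s * L) * card ?I)"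
      using b3 by (rule of_nat_mono)
    then have "y * real s * real (card ?B3) \<le> (y + real s * real L) * i"
      unfolding y_def i_def by (simp only: of_nat_mult of_nat_add)
    then have "real (card ?B3) \<le> ((y + real s * real L) * i) / (y * real s)"
      using yp sp by (simp add: pos_le_divide_eq mult.commute)
    also have "\<dots> = (1 / real s + real L / y) * i" using yp sp by (simp add: field_simps)
    finally show ?thesis unfolding y_def .
  qed
  define \<delta> where "\<delta> = real (L * L) / real nv + real (L * L * \<kappa>) / real (card Gs) + 1 / real s + real L / real (z ^ (h - 1))"
  have "i \<le> real (card Good) + \<delta> * i"
    using of_nat_mono[OF cI, where 'a = real] B1 B2 B3 by (simp add: i_def[symmetric] \<delta>_def distrib_right)
  then have "(1 - \<delta>) * i * r \<le> real (card Good) * r"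
    by (intro mult_right_mono) (auto simp: r_def algebra_simps)
  also have "\<dots> \<le> real (card Q) * i"
    using of_nat_mono[OF dom, where 'a = real] by (simp add: r_def i_def)
  finally have "(1 - \<delta>) * r * i \<le> real (card Q) * i" by (simp add: ac_simps)
  then have "(1 - \<delta>) * r \<le> real (card Q)" using ip by simp
  moreover have "real (card Q) + real (card \<Phi>) \<le> r"
    using of_nat_mono[OF QP, where 'a = real] by (simp add: r_def)
  ultimately have "real (card \<Phi>) \<le> \<delta> * r" by (simp add: algebra_simps)
  then show ?thesis unfolding \<Phi>_def \<delta>_def r_def .
qed

end

subsection \<open>A prime of polynomial size\<close>

text \<open>If \<open>Q\<close> is divisible by all numbers up to \<open>a + b + 1\<close>, then \<open>Q\<close> times the Beta integral
  \<open>\<integral>\<^sub>0\<^sup>1 x\<^sup>a (1 - x)\<^sup>b dx = a! b! / (a + b + 1)!\<close> is an integer.\<close>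

lemma beta_integral_Ints:
  fixes Q :: nat
  assumes "\<And>k. 1 \<le> k \<Longrightarrow> k \<le> N \<Longrightarrow> k dvd Q" "a + b + 1 \<le> N"
  shows "real Q * fact a * fact b / fact (a + b + 1) \<in> \<int>"
  using assms(2)
proof (induction b arbitrary: a)
  case 0
  obtain m where m: "Q = (a + 1) * m" using assms(1)[of "a + 1"] 0 by auto
  have "fact (a + 0 + 1) = real (a + 1) * fact a" "real Q = real (a + 1) * real m"
    unfolding m of_nat_mult by simp_all
  then have "real Q * fact a * fact 0 / fact (a + 0 + 1) = real m" by simp
  then show ?case by simp
next
  case (Suc b)
  let ?r = "\<lambda>a b. real Q * fact a * fact b / fact (a + b + 1)"
  have "?r a (Suc b) = ?r a b - ?r (Suc a) b"
  proof -
    define F M c where "F = (fact (a + b + 1) :: real)" and "M = real (a + b + 2)" and "c = real (Suc a)"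
    have f: "fact (a + Suc b + 1) = M * F" "fact (Suc a + b + 1) = M * F"
      "fact (Suc b) = (M - c) * fact b" "fact (Suc a) = c * fact a"
      by (simp_all add: F_def M_def c_def algebra_simps)
    have "0 < F" "0 < M" by (simp_all add: F_def M_def)
    then show ?thesis unfolding f F_def[symmetric] by (simp add: field_simps)
  qed
  moreover have "?r a b \<in> \<int>" by (rule Suc.IH) (use Suc.prems in simp)
  moreover have "?r (Suc a) b \<in> \<int>" by (rule Suc.IH) (use Suc.prems in simp)
  ultimately show ?case by (simp only: Ints_diff)
qed

text \<open>A positive integer is at least 1, so Q is at least (2 n + 1)! / (n!)^2, which is 2 n + 1
  times the central binomial coefficient; the latter is at least 4 ^ n / (2 n).\<close>

lemma common_multiple_ge:
  fixes Q :: nat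
  assumes Q: "\<And>k. 1 \<le> k \<Longrightarrow> k \<le> 2 * n + 1 \<Longrightarrow> k dvd Q" and "0 < Q" "0 < n"
  shows "4 ^ n \<le> Q"
proof -
  define r where "r = real Q * fact n * fact n / fact (n + n + 1)"
  have "r \<in> \<int>" unfolding r_def by (rule beta_integral_Ints[OF Q]) auto
  moreover have "0 < r" using assms by (simp add: r_def)
  ultimately have "1 \<le> r" by (auto elim!: Ints_cases)
  define F :: real where "F = fact n * fact n"
  have F: "0 < F" by (simp add: F_def)
  have "real ((2 * n) choose n) = fact (2 * n) / F"
    using binomial_fact[of n "2 * n", where 'a = real] by (simp add: F_def)
  moreover have S: "n + n + 1 = Suc (2 * n)" by simp
  ultimately have "real (2 * n + 1) * real ((2 * n) choose n) = fact (n + n + 1) / F"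
    unfolding S fact_Suc by simp
  also have "\<dots> \<le> fact (n + n + 1) / F * r"
    using mult_left_mono[OF \<open>1 \<le> r\<close>, of "fact (n + n + 1) / F"] F by simp
  also have "\<dots> = real Q"
  proof -
    have "0 < (fact (n + n + 1) :: real)" by simp
    moreover have "r = real Q * F / fact (n + n + 1)" by (simp only: r_def F_def mult.assoc)
    ultimately show ?thesis using F by (simp only: times_divide_times_eq) (simp add: field_simps del: fact_Suc)
  qed
  finally have "real (2 * n + 1) * real ((2 * n) choose n) \<le> real Q" .
  moreover have "4 ^ n \<le> real (2 * n + 1) * real ((2 * n) choose n)"
  proof -
    have "4 ^ n / (2 * real n) \<le> real ((2 * n) choose n)"
      using central_binomial_lower_bound[OF assms(3)] by simp
    then have "4 ^ n \<le> 2 * real n * real ((2 * n) choose n)"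
      using assms(3) by (simp add: field_simps)
    also have "\<dots> \<le> real (2 * n + 1) * real ((2 * n) choose n)"
      by (intro mult_right_mono) auto
    finally show ?thesis .
  qed
  ultimately have "(4::real) ^ n \<le> real Q" by linarith
  then have "real (4 ^ n) \<le> real Q" by (simp only: of_nat_power of_nat_numeral)
  then show ?thesis by (simp only: of_nat_le_iff)
qed

text \<open>Otherwise the least common multiple of the numbers up to N = 2 X^2 + 1 has only prime
  factors below X, each contributing a power at most N, and is at most N ^ X. But it is at least 4 ^
  (X^2), whereas N < 4 ^ X.\<close>

lemma prime_between:
  fixes X :: nat
  assumes X: "2 \<le> X"
  shows "\<exists>p. prime p \<and> X \<le> p \<and> p \<le> 2 * X ^ 2 + 1"
proof (rule ccontr)
  assume "\<not> ?thesis"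
  then have no: "p < X" if "prime p" "p \<le> 2 * X ^ 2 + 1" for p using that not_le by blast
  define N where "N = 2 * X ^ 2 + 1"
  define E where "E p = (GREATEST e. p ^ e \<le> N)" for p :: nat
  have bnd: "e \<le> N" if "p ^ e \<le> N" "2 \<le> p" for p e :: nat
  proof -
    have "e < 2 ^ e" by simp
    also have "\<dots> \<le> p ^ e" using that(2) by (rule power_mono) simp
    finally show ?thesis using that(1) by simp
  qed
  have E: "p ^ E p \<le> N" "p ^ e \<le> N \<Longrightarrow> e \<le> E p" if "2 \<le> p" for p e
  proof -
    have "p ^ 0 \<le> N" by (simp add: N_def)
    then show "p ^ E p \<le> N" unfolding E_def by (rule GreatestI_nat[where b = N]) (use bnd that in blast)
    show "p ^ e \<le> N \<Longrightarrow> e \<le> E p" unfolding E_def by (rule Greatest_le_nat[where b = N]) (use bnd that in blast)+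
  qed
  define P where "P = {p. prime p \<and> p < X}"
  define Q where "Q = (\<Prod>p\<in>P. p ^ E p)"
  have finP: "finite P" by (simp add: P_def)
  have dvd: "k dvd Q" if "1 \<le> k" "k \<le> N" for k
  proof -
    have "k = (\<Prod>p\<in>prime_factors k. p ^ multiplicity p k)"
      using that by (intro prime_factorization_nat) simp
    also have "\<dots> dvd Q" unfolding Q_def
    proof (rule prod_dvd_prod_subset2[OF finP])
      show "prime_factors k \<subseteq> P"
      proof
        fix p assume "p \<in> prime_factors k"
        then have p: "prime p" "p dvd k" by auto
        then have "p \<le> N" using that dvd_imp_le[of p k] by simp
        then show "p \<in> P" using no[OF p(1)] p(1) by (simp add: P_def N_def)
      qed
      fix p assume "p \<in> prime_factors k"
      then have p: "prime p" by auto
      have "p ^ multiplicity p k \<le> N"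
        using dvd_imp_le[OF multiplicity_dvd[of p k]] that by simp
      then show "p ^ multiplicity p k dvd p ^ E p"
        using E(2)[of p] prime_ge_2_nat[OF p] by (intro le_imp_power_dvd) auto
    qed
    finally show ?thesis .
  qed
  have "0 < Q" unfolding Q_def by (rule prod_pos) (auto simp: P_def prime_gt_0_nat)
  then have "4 ^ (X ^ 2) \<le> Q"
    using X by (intro common_multiple_ge dvd) (auto simp: N_def)
  also have "Q \<le> (\<Prod>p\<in>P. N)"
    unfolding Q_def by (intro prod_mono) (auto simp: P_def prime_ge_2_nat intro!: E(1))
  also have "\<dots> = N ^ card P" by simp
  also have "\<dots> \<le> N ^ X"
  proof (rule power_increasing)
    have "card P \<le> card {..<X}" by (rule card_mono) (auto simp: P_def)
    then show "card P \<le> X" by simp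
  qed (simp add: N_def)
  finally have "(4 ^ X) ^ X \<le> N ^ X" by (simp add: power2_eq_square power_mult)
  then have "4 ^ X \<le> N" using X by (simp add: power_mono_iff)
  moreover have "N < 4 ^ X"
  proof -
    have two: "2 * X \<le> 2 ^ X" using X
      by (induction X rule: dec_induct) auto
    have "N < (2 * X) ^ 2" using mult_le_mono[OF X X] by (simp add: N_def power2_eq_square)
    also have "\<dots> \<le> (2 ^ X) ^ 2" using two by (rule power_mono) simp
    also have "\<dots> = 4 ^ X" by (simp add: power_mult[symmetric] mult.commute[of X 2]) (simp add: power_mult)
    finally show ?thesis .
  qed
  ultimately show False by simp
qed

subsection \<open>A family of involutions with few short relations\<close>

text \<open>Lagrange's bound for roots in the field with p elements, phrased with integer
  polynomials. Dividing by x - a keeps the leading coefficient, which therefore stays nonzero modulo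
  p.\<close>

lemma poly_roots_mod_prime:
  fixes f :: "int poly" and p :: nat
  assumes "prime p" "\<not> int p dvd lead_coeff f"
  shows "card {q \<in> {0..<int p}. int p dvd poly f q} \<le> degree f"
  using assms(2)
proof (induction "degree f" arbitrary: f)
  case 0
  then obtain c where c: "f = [:c:]" using degree_eq_zeroE[of f] by auto
  then have "{q \<in> {0..<int p}. int p dvd poly f q} = {}" using 0 by auto
  then show ?case by (simp only: card.empty zero_le)
next
  case (Suc n)
  show ?case
  proof (cases "\<exists>a\<in>{0..<int p}. int p dvd poly f a")
    case False
    then have "{q \<in> {0..<int p}. int p dvd poly f q} = {}" by blast
    then show ?thesis by (simp only: card.empty zero_le)
  next
    case True
    then obtain a where a: "a \<in> {0..<int p}" "int p dvd poly f a" by blast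
    define g where "g = synthetic_div f a"
    have eq: "[:- a, 1:] * g + [:poly f a:] = f" unfolding g_def by (rule synthetic_div_correct')
    have dg: "degree g = n" using Suc(2) by (simp add: g_def degree_synthetic_div)
    have gne: "g \<noteq> 0"
    proof
      assume "g = 0"
      then have "f = [:poly f a:]" using eq by simp
      then have "degree f = 0" using degree_pCons_0[of "poly f a"] by simp
      then show False using Suc(2) by simp
    qed
    have "coeff f (Suc n) = lead_coeff g"
    proof -
      have "coeff f (Suc n) = coeff ([:- a, 1:] * g) (Suc n)"
        by (subst eq[symmetric]) (simp add: coeff_pCons)
      also have "\<dots> = coeff g n" using dg by (simp add: coeff_eq_0)
      finally show ?thesis using dg by simp
    qed
    then have "\<not> int p dvd lead_coeff g" using Suc by simp
    then have IH: "card {q \<in> {0..<int p}. int p dvd poly g q} \<le> n" using Suc.hyps(1)[of g] dg by simp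
    have "{q \<in> {0..<int p}. int p dvd poly f q} \<subseteq> insert a {q \<in> {0..<int p}. int p dvd poly g q}"
    proof
      fix q assume q: "q \<in> {q \<in> {0..<int p}. int p dvd poly f q}"
      have "poly f q = (q - a) * poly g q + poly f a"
        by (subst (1) eq[symmetric]) (simp add: algebra_simps)
      then have "int p dvd (q - a) * poly g q"
        using q a(2) dvd_add_left_iff[OF a(2), of "(q - a) * poly g q"] by simp
      then have "int p dvd q - a \<or> int p dvd poly g q"
        using assms(1) by (simp add: prime_dvd_mult_iff)
      moreover have "q = a" if "int p dvd q - a"
      proof -
        have "\<bar>q - a\<bar> < int p" using q a(1) by auto
        then have "q - a = 0" using that zdvd_imp_le[of "int p" "\<bar>q - a\<bar>"] by fastforce
        then show ?thesis by simp
      qed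
      ultimately show "q \<in> insert a {q \<in> {0..<int p}. int p dvd poly g q}" using q by blast
    qed
    then have "card {q \<in> {0..<int p}. int p dvd poly f q} \<le> card (insert a {q \<in> {0..<int p}. int p dvd poly g q})"
      by (rule card_mono[rotated]) (intro finite.insertI finite_subset[of "{q \<in> {0..<int p}. int p dvd poly g q}" "{0..<int p}"] Collect_restrict finite_atLeastLessThan_int)
    also have "\<dots> \<le> Suc n" using IH by (intro card_insert_le_m1) simp_all
    finally show ?thesis using Suc(2) by simp
  qed
qed

text \<open>The involution of colour \<open>t\<close> on the positions with parameter \<open>q\<close> is conjugate to the swap of
  the two coordinates by the shear with slope \<open>q t\<close>.\<close>

definition turn :: "nat \<Rightarrow> nat \<Rightarrow> nat \<times> int \<times> int \<times> int \<Rightarrow> nat \<times> int \<times> int \<times> int" where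
  "turn p t = (\<lambda>(c, q, u, v). (c, q, (q * int t * ((u - q * int t * v) mod int p) + v) mod int p,
     (u - q * int t * v) mod int p))"

text \<open>\<open>c\<close> numbers disjoint copies that fill up the vertex set. The parameter
  \<open>q\<close> is part of the position, so it is averaged over instead of being chosen well.
  Zero is excluded for \<open>q\<close>, where all turns coincide, and for the pair (u, v), which
  every turn would fix.\<close>

definition positions :: "nat \<Rightarrow> nat \<Rightarrow> (nat \<times> int \<times> int \<times> int) set" where
  "positions K p = {..<K} \<times> {1..<int p} \<times> ({0..<int p} \<times> {0..<int p} - {(0, 0)})"

lemma card_positions: "0 < p \<Longrightarrow> card (positions K p) = K * ((p - 1) * (p * p - 1))"
  by (simp add: positions_def card_cartesian_product card_Diff_subset nat_diff_distrib)

lemma zero_mod_small: "0 \<le> x \<Longrightarrow> x < int p \<Longrightarrow> int p dvd x \<Longrightarrow> x = 0"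
  using zdvd_imp_le[of "int p" x] by fastforce

lemma turn_positions:
  assumes "g \<in> positions K p" "0 < p" shows "turn p t g \<in> positions K p"
proof -
  obtain c q u v where g: "g = (c, q, u, v)" by (cases g)
  let ?v' = "(u - q * int t * v) mod int p"
  have *: "0 \<le> u" "u < int p" "0 \<le> v" "v < int p" "(u, v) \<noteq> (0, 0)" using assms by (auto simp: g positions_def)
  have "\<not> (?v' = 0 \<and> (q * int t * ?v' + v) mod int p = 0)"
  proof
    assume h: "?v' = 0 \<and> (q * int t * ?v' + v) mod int p = 0"
    then have v': "?v' = 0" by blast
    have "(q * int t * 0 + v) mod int p = 0" using h v' by metis
    then have "v = 0" using * by simp
    then have "?v' = u" using * by simp
    then have "u = 0" using v' by simp
    then show False using \<open>v = 0\<close> * by simp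
  qed
  moreover define v1 u1 where "v1 = ?v'" and "u1 = (q * int t * ?v' + v) mod int p"
  moreover have "0 \<le> v1" "v1 < int p" "0 \<le> u1" "u1 < int p" using assms(2) by (simp_all add: v1_def u1_def)
  moreover have "turn p t g = (c, q, u1, v1)" by (simp add: g turn_def v1_def u1_def)
  ultimately show ?thesis using assms(1) by (auto simp only: g positions_def mem_Times_iff fst_conv snd_conv
      Diff_iff atLeastLessThan_iff singleton_iff prod.inject)
qed

lemma turn_turn:
  assumes "g \<in> positions K p" shows "turn p t (turn p t g) = g"
proof -
  obtain c q u v where g: "g = (c, q, u, v)" by (cases g)
  have *: "0 \<le> u" "u < int p" "0 \<le> v" "v < int p" using assms by (auto simp: g positions_def)
  let ?a = "q * int t"
  let ?v1 = "(u - ?a * v) mod int p"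
  let ?u1 = "(?a * ?v1 + v) mod int p"
  have v2: "(?u1 - ?a * ?v1) mod int p = v"
  proof -
    have "(?u1 - ?a * ?v1) mod int p = (?a * ?v1 + v - ?a * ?v1) mod int p" by (simp add: mod_diff_left_eq)
    then show ?thesis using * by simp
  qed
  have "(?a * v + ?v1) mod int p = (?a * v + (u - ?a * v)) mod int p" by (simp add: mod_add_right_eq)
  then have u2: "(?a * v + ?v1) mod int p = u" using * by simp
  show ?thesis by (simp add: g turn_def v2 u2)
qed

text \<open>The second coordinates give that p divides q (t - t') v, which settles nonzero v. For v
  = 0 the first coordinates give the same with u, which is then nonzero.\<close>

lemma turn_free:
  assumes "prime p" "g \<in> positions K p" "t < p" "t' < p" "turn p t g = turn p t' g"
  shows "t = t'"
proof -
  obtain c q u v where g: "g = (c, q, u, v)" by (cases g)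
  have *: "0 \<le> u" "u < int p" "0 \<le> v" "v < int p" "(u, v) \<noteq> (0, 0)" "1 \<le> q" "q < int p"
    using assms(2) by (auto simp: g positions_def)
  have pp: "prime (int p)" using assms(1) by simp
  have q: "\<not> int p dvd q" using zero_mod_small[of q p] * by auto
  have e1: "(u - q * int t * v) mod int p = (u - q * int t' * v) mod int p"
    and e2: "(q * int t * ((u - q * int t * v) mod int p) + v) mod int p
      = (q * int t' * ((u - q * int t' * v) mod int p) + v) mod int p"
    using assms(5) unfolding g turn_def prod.case prod.inject by blast+
  have "int p dvd int t - int t'"
  proof (cases "v = 0")
    case False
    have "int p dvd (u - q * int t' * v) - (u - q * int t * v)"
      using e1[symmetric] by (simp only: mod_eq_dvd_iff)
    also have "(u - q * int t' * v) - (u - q * int t * v) = q * ((int t - int t') * v)" by (simp add: algebra_simps)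
    finally show ?thesis using pp q zero_mod_small[of v p] * False by (auto simp: prime_dvd_mult_iff)
  next
    case True
    then have u0: "u \<noteq> 0" using * by simp
    have "int p dvd q * int t * u - q * int t' * u"
      using e2 True * by (simp add: mod_eq_dvd_iff)
    also have "q * int t * u - q * int t' * u = q * ((int t - int t') * u)" by (simp add: algebra_simps)
    finally show ?thesis using pp q zero_mod_small[of u p] * u0 by (auto simp: prime_dvd_mult_iff)
  qed
  then have "int t mod int p = int t' mod int p" by (simp add: mod_eq_dvd_iff)
  then show ?thesis using assms(3,4) by simp
qed

text \<open>After turns of which the last has colour s, the pair is (s q B(q) + A(q), B(q)) modulo
  p. A further turn of colour t replaces A, B by B, A + (s - t) q B, a three-term recursion as for
  the denominators of continued fractions.\<close>

fun continuant :: "int \<Rightarrow> int poly \<Rightarrow> int poly \<Rightarrow> nat list \<Rightarrow> int poly" where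
  "continuant s A B [] = B"
| "continuant s A B (t # w) = continuant (int t) B (A + [:0, s - int t:] * B) w"

lemma fold_turn_continuant:
  assumes "(u - (s * q * poly B q + poly A q)) mod int p = 0" "(v - poly B q) mod int p = 0"
    "fold (turn p) w (c, q, u, v) = (c, q, u', v')"
  shows "(v' - poly (continuant s A B w) q) mod int p = 0"
  using assms
proof (induction w arbitrary: s A B u v)
  case (Cons t w)
  let ?v1 = "(u - q * int t * v) mod int p"
  let ?u1 = "(q * int t * ?v1 + v) mod int p"
  let ?B = "A + [:0, s - int t:] * B"
  have shift: "\<exists>k. a mod int p = a + int p * k" for a
    by (rule exI[of _ "- (a div int p)"]) (simp add: minus_mult_div_eq_mod)
  obtain x where "u - (s * q * poly B q + poly A q) = int p * x"
    using mod_0_imp_dvd[OF Cons.prems(1)] by (elim dvdE)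
  then have x: "u = s * q * poly B q + poly A q + int p * x" by simp
  obtain y where "v - poly B q = int p * y"
    using mod_0_imp_dvd[OF Cons.prems(2)] by (elim dvdE)
  then have y: "v = poly B q + int p * y" by simp
  obtain k where k: "?v1 = u - q * int t * v + int p * k" using shift by blast
  obtain m where m: "?u1 = q * int t * ?v1 + v + int p * m" using shift by blast
  have v1: "?v1 - poly ?B q = int p * (x - q * int t * y + k)"
    unfolding k unfolding x y by (simp add: algebra_simps)
  have u1: "?u1 - (int t * q * poly ?B q + poly B q) = int p * (int t * q * (x - q * int t * y + k) + y + m)"
  proof -
    define b v2 where "b = poly ?B q" and "v2 = ?v1"
    have v2: "v2 = b + int p * (x - q * int t * y + k)" using v1 by (simp only: b_def v2_def diff_eq_eq add.commute)
    show ?thesis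
      unfolding m unfolding b_def[symmetric] v2_def[symmetric] unfolding y unfolding v2
      by (simp add: algebra_simps)
  qed
  show ?case
    unfolding continuant.simps
  proof (rule Cons.IH[of ?u1 "int t" ?B B ?v1])
    show "(?u1 - (int t * q * poly ?B q + poly B q)) mod int p = 0" unfolding u1 by simp
    show "(?v1 - poly ?B q) mod int p = 0" unfolding v1 by simp
    show "fold (turn p) w (c, q, ?u1, ?v1) = (c, q, u', v')" 
    proof -
      have "turn p t (c, q, u, v) = (c, q, ?u1, ?v1)" by (simp add: turn_def)
      then show ?thesis using Cons.prems(3) by simp
    qed
  qed
qed simp

text \<open>In a reduced word consecutive colours differ modulo p. So each step raises the degree by
  one and multiplies the leading coefficient by s - t, a unit modulo p.\<close>

lemma continuant_degree:
  assumes p: "prime p" and "\<not> int p dvd lead_coeff B" "degree A \<le> degree B" "reduced (s # w)" "s < p" "set w \<subseteq> {..<p}"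
  shows "degree (continuant (int s) A B w) = degree B + length w \<and> \<not> int p dvd lead_coeff (continuant (int s) A B w)"
  using assms(2-)
proof (induction w arbitrary: s A B)
  case (Cons t w)
  let ?B = "A + [:0, int s - int t:] * B"
  have st: "s \<noteq> t" "t < p" using Cons.prems by auto
  have B0: "B \<noteq> 0" using Cons.prems(1) by auto
  have st0: "int s - int t \<noteq> 0" using st by simp
  have dB: "degree ([:0, int s - int t:] * B) = Suc (degree B)"
    using B0 st0 by (subst degree_mult_eq) auto
  then have deg: "degree ?B = Suc (degree B)"
    using Cons.prems(2) by (simp only: degree_add_eq_right)
  have lc: "lead_coeff ?B = (int s - int t) * lead_coeff B"
  proof -
    have "lead_coeff ?B = lead_coeff ([:0, int s - int t:] * B)"
      using dB Cons.prems(2) by (intro lead_coeff_add_le) simp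
    also have "\<dots> = lead_coeff [:0, int s - int t:] * lead_coeff B" by (rule lead_coeff_mult)
    finally show ?thesis using st0 by simp
  qed
  have "\<not> int p dvd int s - int t"
  proof
    assume "int p dvd int s - int t"
    then have "int s mod int p = int t mod int p" by (simp add: mod_eq_dvd_iff)
    then show False using st Cons.prems(4) by simp
  qed
  then have "\<not> int p dvd lead_coeff ?B"
    unfolding lc using Cons.prems(1) p by (simp add: prime_dvd_mult_iff)
  from Cons.IH[OF this, of B t] show ?case using deg Cons.prems st by auto
qed auto

text \<open>For a given pair (u, v), each parameter q with a fixed position is a root modulo p of
  the second coordinate minus v. There are at most \<open>length w\<close> of these, and fewer than
  p * p pairs in each of the \<open>K\<close> copies.\<close>

lemma turn_relations:
  assumes p: "prime p" and w: "w \<noteq> []" "reduced w" "set w \<subseteq> {1..<p}"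
  shows "card {g \<in> positions K p. fold (turn p) w g = g} \<le> K * (p * p) * length w"
proof -
  have ws: "set w \<subseteq> {..<p}" using w(3) by auto
  define Bad where "Bad u v = {q \<in> {1..<int p}. \<exists>c u'. fold (turn p) w (c, q, u, v) = (c, q, u', v)}" for u v
  have finB: "finite (Bad u v)" for u v
    by (rule finite_subset[of _ "{1..<int p}"]) (auto simp: Bad_def)
  have bad: "card (Bad u v) \<le> length w"
    if uv: "0 \<le> u" "u < int p" "0 \<le> v" "v < int p" "(u, v) \<noteq> (0, 0)" for u v
  proof -
    define F where "F = continuant 0 [:u:] [:v:] w"
    have root: "int p dvd poly (F - [:v:]) q" if q: "q \<in> Bad u v" for q
    proof -
      obtain c u' where cu: "fold (turn p) w (c, q, u, v) = (c, q, u', v)" using q by (auto simp: Bad_def)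
      have "(v - poly F q) mod int p = 0"
        unfolding F_def by (rule fold_turn_continuant[OF _ _ cu]) auto
      then have "int p dvd v - poly F q" by (rule mod_0_imp_dvd)
      then show ?thesis by (simp add: dvd_diff_commute)
    qed
    have "\<not> int p dvd lead_coeff (F - [:v:]) \<and> degree (F - [:v:]) \<le> length w"
    proof (cases "v = 0")
      case False
      have "\<not> int p dvd lead_coeff [:v:]" using zero_mod_small[of v p] uv False by auto
      \<comment> \<open>The initial pair (u, v) has the form of the recursion with s = 0. As 0 is
        excluded from the colours, the degree grows already at the first letter.\<close>
      moreover have "reduced (0 # w)" using w by (cases w) auto
      ultimately have F: "degree F = length w" "\<not> int p dvd lead_coeff F"
        using continuant_degree[OF p, of "[:v:]" "[:u:]" 0 w] prime_gt_0_nat[OF p] ws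
        by (auto simp: F_def)
      have "degree [:- v:] < degree F" using F(1) w(1) by simp
      then have lt: "degree ([:- v:] + F) = degree F" "lead_coeff ([:- v:] + F) = lead_coeff F"
        by (rule degree_add_eq_right, rule lead_coeff_add_le)
      have eq: "F - [:v:] = [:- v:] + F" by simp
      show ?thesis unfolding eq unfolding lt(2) unfolding lt(1) using F by (simp only: le_refl not_False_eq_True simp_thms)
    next
      \<comment> \<open>For v = 0 the first letter turns B into the constant u whatever its colour,
        and the degree is counted from there on.\<close>
      case True
      then have u0: "u \<noteq> 0" using uv by simp
      obtain t w' where tw: "w = t # w'" using w(1) by (cases w) auto
      have "\<not> int p dvd lead_coeff [:u:]" using zero_mod_small[of u p] uv u0 by auto
      then have "degree (continuant (int t) 0 [:u:] w') = length w'"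
        "\<not> int p dvd lead_coeff (continuant (int t) 0 [:u:] w')"
        using continuant_degree[OF p, of "[:u:]" 0 t w'] w ws tw by auto
      then show ?thesis using True by (simp add: F_def tw)
    qed
    moreover have "card (Bad u v) \<le> card {q \<in> {0..<int p}. int p dvd poly (F - [:v:]) q}"
    proof (rule card_mono)
      show "finite {q \<in> {0..<int p}. int p dvd poly (F - [:v:]) q}"
        by (rule finite_subset[of _ "{0..<int p}"]) auto
      show "Bad u v \<subseteq> {q \<in> {0..<int p}. int p dvd poly (F - [:v:]) q}"
      proof
        fix q assume q: "q \<in> Bad u v"
        then have "q \<in> {1..<int p}" unfolding Bad_def by blast
        then have "q \<in> {0..<int p}" by simp
        then show "q \<in> {q \<in> {0..<int p}. int p dvd poly (F - [:v:]) q}" using root[OF q] by blast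
      qed
    qed
    ultimately show ?thesis
      using poly_roots_mod_prime[OF p, of "F - [:v:]"] by simp
  qed
  let ?UV = "{0..<int p} \<times> {0..<int p} - {(0, 0)}"
  have "{g \<in> positions K p. fold (turn p) w g = g}
      \<subseteq> (\<Union>(c, uv)\<in>{..<K} \<times> ?UV. (\<lambda>q. (c, q, uv)) ` Bad (fst uv) (snd uv))"
    by (force simp: positions_def Bad_def)
  then have "card {g \<in> positions K p. fold (turn p) w g = g}
      \<le> card (\<Union>(c, uv)\<in>{..<K} \<times> ?UV. (\<lambda>q. (c, q, uv)) ` Bad (fst uv) (snd uv))"
    by (rule card_mono[rotated]) (auto simp: finB)
  also have "\<dots> \<le> (\<Sum>(c, uv)\<in>{..<K} \<times> ?UV. card ((\<lambda>q. (c, q, uv)) ` Bad (fst uv) (snd uv)))"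
    using card_UN_le[of "{..<K} \<times> ?UV" "\<lambda>(c, uv). (\<lambda>q. (c, q, uv)) ` Bad (fst uv) (snd uv)"]
    by (simp add: case_prod_beta')
  also have "\<dots> \<le> (\<Sum>(c, uv)\<in>{..<K} \<times> ?UV. length w)"
  proof (intro sum_mono)
    fix x assume x: "x \<in> {..<K} \<times> ?UV"
    obtain c u v where xx: "x = (c, u, v)" by (cases x)
    have "finite (Bad u v)" by (rule finB)
    then have "card ((\<lambda>q. (c, q, u, v)) ` Bad u v) \<le> card (Bad u v)" by (rule card_image_le)
    also have "\<dots> \<le> length w" using x by (intro bad) (auto simp: xx)
    finally show "(case x of (c, uv) \<Rightarrow> card ((\<lambda>q. (c, q, uv)) ` Bad (fst uv) (snd uv)))
        \<le> (case x of (c, uv) \<Rightarrow> length w)" by (simp add: xx)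
  qed
  also have "\<dots> = K * card ?UV * length w" by (simp add: card_cartesian_product case_prod_beta')
  also have "\<dots> \<le> K * (p * p) * length w"
    using card_mono[of "{0..<int p} \<times> {0..<int p}" ?UV]
    by (intro mult_le_mono1 mult_le_mono2) (simp add: card_cartesian_product)
  finally show ?thesis .
qed

subsection \<open>The hard graph\<close>

lemma card_Union_pairs:
  assumes "disjoint M" "finite M" "\<And>e. e \<in> M \<Longrightarrow> card e = 2"
  shows "card (\<Union>M) = 2 * card M"
proof -
  have "card (\<Union>M) = (\<Sum>e\<in>M. card e)"
    using assms by (intro card_Union_disjoint) (auto intro: card_ge_0_finite)
  then show ?thesis using assms(3) by simp
qed

text \<open>Partner in the matching made of the single edges between consecutive layers and of the
  centre edges. Connectors stay unmatched, so their value is arbitrary.\<close>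

fun mate_base :: "nat \<Rightarrow> vertex \<Rightarrow> vertex" where
  "mate_base h (U j x) = (if j = h then U h x else W (Suc j) x)"
| "mate_base h (W j x) = U (j - 1) x"
| "mate_base h (C i) = C i"

context gadget_lift
begin

definition graph_of :: "('g \<times> bool \<times> vertex \<Rightarrow> nat) \<Rightarrow> nat set set" where
  "graph_of \<pi> = {{\<pi> v, \<pi> (nbr v a)} | v a. v \<in> Vs \<and> a < d}"

lemma item_surj: assumes "b \<in> Bs" "it \<in> items b" obtains a where "a < d" "item b a = it"
proof -
  have "\<exists>a<d. item b a = it"
  proof (cases "deg b = d")
    case True
    then show ?thesis using item_ex[OF True assms(2)] by metis
  next
    case False
    then have "deg b = 1" using deg_cases'[OF assms(1)] by blast
    then obtain y where "items b = {y}" unfolding deg_def by (auto simp: card_1_singleton_iff)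
    moreover have "item b 0 \<in> items b" "0 < d" using item_in[OF assms(1), of 0] d2 by auto
    ultimately show ?thesis using assms(2) by auto
  qed
  then show ?thesis using that by blast
qed

lemma nbr_cong: "item (base v) a = item (base v) a' \<Longrightarrow> nbr v a = nbr v a'"
  by (simp add: nbr_def)

lemma nbr_item_eq:
  assumes "v \<in> Vs" "a < d" "a' < d" "nbr v a = nbr v a'"
  shows "item (base v) a = item (base v) a'"
proof -
  have b: "base v \<in> Bs" "fst v \<in> Gs" using assms(1) by (auto simp: Vs_def)
  have i: "item (base v) a \<in> items (base v)" "item (base v) a' \<in> items (base v)"
    using item_in[OF b(1)] assms by auto
  have "act (col (base v) (item (base v) a)) (fst v) = act (col (base v) (item (base v) a')) (fst v)"
    using assms(4) by (simp add: nbr_def)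
  then have "col (base v) (item (base v) a) = col (base v) (item (base v) a')"
    using act_free[OF b(2)] col_in[OF b(1)] i by blast
  then show ?thesis using inj_onD[OF col_inj[OF b(1)]] i by blast
qed

lemma nbr_sym:
  assumes "v \<in> Vs" "a < d" obtains a' where "a' < d" "nbr (nbr v a) a' = v"
proof -
  have b: "base v \<in> Bs" using assms(1) by (auto simp: Vs_def)
  let ?it = "item (base v) a"
  have "fst ?it \<in> Bs" "(base v, snd ?it) \<in> items (fst ?it)"
    using items_sym[OF b, of "fst ?it" "snd ?it"] item_in[OF b assms(2)] by auto
  then obtain a' where a': "a' < d" "item (fst ?it) a' = (base v, snd ?it)" by (rule item_surj)
  have "nbr (nbr v a) a' = v" by (rule nbr_back[OF assms]) (simp add: nbr_def a')
  then show ?thesis using that a' by blast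
qed

context
  fixes \<pi> assumes \<pi>: "\<pi> \<in> labellings"
begin

lemma bij: "bij_betw \<pi> Vs {..<nv}"
  using \<pi> by (simp add: labellings_def)

lemma rZ_Vs: "w < nv \<Longrightarrow> rZ \<pi> w \<in> Vs" "w < nv \<Longrightarrow> \<pi> (rZ \<pi> w) = w"
  using bij by (auto simp: rZ_def bij_betw_def inv_into_into f_inv_into_f)

lemma rZ_lab: "v \<in> Vs \<Longrightarrow> rZ \<pi> (\<pi> v) = v" "v \<in> Vs \<Longrightarrow> \<pi> v < nv"
  using bij by (auto simp: rZ_def bij_betw_def)

lemma lab_inj: "v \<in> Vs \<Longrightarrow> w \<in> Vs \<Longrightarrow> \<pi> v = \<pi> w \<Longrightarrow> v = w"
  using bij by (auto simp: bij_betw_def inj_on_def)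

lemma graph_edge:
  assumes "e \<in> graph_of \<pi>" "w \<in> e"
  obtains v a where "v \<in> Vs" "a < d" "w = \<pi> v" "e = {\<pi> v, \<pi> (nbr v a)}"
proof -
  obtain v a where va: "v \<in> Vs" "a < d" "e = {\<pi> v, \<pi> (nbr v a)}" using assms(1) by (auto simp: graph_of_def)
  show ?thesis
  proof (cases "w = \<pi> v")
    case False
    then have w: "w = \<pi> (nbr v a)" using va assms(2) by auto
    obtain a' where a': "a' < d" "nbr (nbr v a) a' = v" using nbr_sym[OF va(1,2)] .
    show ?thesis by (rule that[OF nbr_Vs[OF va(1,2)] a'(1) w]) (use va a' in auto)
  qed (use va that in blast)
qed

lemma edge_in_graph: "v \<in> Vs \<Longrightarrow> a < d \<Longrightarrow> {\<pi> v, \<pi> (nbr v a)} \<in> graph_of \<pi>"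
  by (auto simp: graph_of_def)

lemma lab_nbr_ne: "v \<in> Vs \<Longrightarrow> a < d \<Longrightarrow> \<pi> v \<noteq> \<pi> (nbr v a)"
  using lab_inj[of v "nbr v a"] nbr_Vs[of v a] by (auto simp: nbr_def prod_eq_iff)

lemma card_edge: "e \<in> graph_of \<pi> \<Longrightarrow> card e = 2"
  using lab_nbr_ne by (auto simp: graph_of_def)

lemma edge_subset: assumes "e \<in> graph_of \<pi>" shows "e \<subseteq> {..<nv}"
proof -
  obtain v a where "v \<in> Vs" "a < d" "e = {\<pi> v, \<pi> (nbr v a)}" using assms unfolding graph_of_def by blast
  then show ?thesis using rZ_lab(2)[of v] rZ_lab(2)[OF nbr_Vs[of v a]] by simp
qed

lemma neighbors_graph:
  "w < nv \<Longrightarrow> neighbors (graph_of \<pi>) w = (\<lambda>a. \<pi> (nbr (rZ \<pi> w) a)) ` {..<d}"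
proof (intro equalityI subsetI)
  fix u assume w: "w < nv" and u: "u \<in> neighbors (graph_of \<pi>) w"
  then have "{w, u} \<in> graph_of \<pi>" by (simp add: neighbors_def)
  then obtain v a where va: "v \<in> Vs" "a < d" "w = \<pi> v" "{w, u} = {\<pi> v, \<pi> (nbr v a)}"
    using graph_edge[of "{w, u}" w] by blast
  then have "u = \<pi> (nbr v a)" using lab_nbr_ne by (auto simp: doubleton_eq_iff)
  then show "u \<in> (\<lambda>a. \<pi> (nbr (rZ \<pi> w) a)) ` {..<d}" using va rZ_lab(1) by auto
next
  fix u assume "w < nv" "u \<in> (\<lambda>a. \<pi> (nbr (rZ \<pi> w) a)) ` {..<d}"
  then show "u \<in> neighbors (graph_of \<pi>) w"
    using edge_in_graph[OF rZ_Vs(1)] rZ_Vs(2) by (auto simp: neighbors_def)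
qed

lemma neighbors_isolated: "nv \<le> w \<Longrightarrow> neighbors (graph_of \<pi>) w = {}"
  using edge_subset by (fastforce simp: neighbors_def)

lemma card_neighbors_le: "card (neighbors (graph_of \<pi>) w) \<le> d"
  using card_image_le[of "{..<d}" "\<lambda>a. \<pi> (nbr (rZ \<pi> w) a)"]
  by (cases "w < nv") (simp_all add: neighbors_graph neighbors_isolated)

text \<open>At degree \<open>d\<close> the order permutes \<open>d\<close> distinct neighbors. At
  degree 1 every port leads to the same neighbor, so a list of length 1 is complete for any
  order.\<close>

lemma adjacency_lists_graph:
  assumes \<sigma>: "\<sigma> \<in> vorders" and n: "nv \<le> n"
  shows "adjacency_lists n (graph_of \<pi>) (adj \<pi> \<sigma>)"
  unfolding adjacency_lists_def
proof (intro conjI allI impI)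
  fix w assume "n \<le> w" then show "adj \<pi> \<sigma> w = []" using n by (simp add: adj_def)
next
  fix w assume "w < n"
  show "distinct (adj \<pi> \<sigma> w)"
  proof (cases "w < nv")
    case True
    let ?v = "rZ \<pi> w"
    have b: "base ?v \<in> Bs" using rZ_Vs[OF True] by (auto simp: Vs_def)
    have "inj_on (\<lambda>k. \<pi> (nbr ?v (\<sigma> ?v k))) {0..<deg (base ?v)}"
    proof (cases "deg (base ?v) = d")
      case dd: True
      have s: "\<sigma> ?v k < d" if "k < d" for k
        using permutes_in_image[OF vorders_permutes[OF \<sigma>], of ?v k] that by simp
      show ?thesis
      proof (rule inj_onI)
        fix k k' assume k: "k \<in> {0..<deg (base ?v)}" "k' \<in> {0..<deg (base ?v)}"
          "\<pi> (nbr ?v (\<sigma> ?v k)) = \<pi> (nbr ?v (\<sigma> ?v k'))"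
        have kd: "k < d" "k' < d" using k dd by auto
        have "nbr ?v (\<sigma> ?v k) = nbr ?v (\<sigma> ?v k')"
          using lab_inj k(3) nbr_Vs[OF rZ_Vs(1)[OF True]] s kd by blast
        then have "item (base ?v) (\<sigma> ?v k) = item (base ?v) (\<sigma> ?v k')"
          by (intro nbr_item_eq[OF rZ_Vs(1)[OF True]] s kd)
        then have "\<sigma> ?v k = \<sigma> ?v k'" using item_inj[OF dd] s kd by blast
        then show "k = k'" by (rule injD[OF permutes_inj[OF vorders_permutes[OF \<sigma>]]])
      qed
    next
      case False
      then have "deg (base ?v) = 1" using deg_cases'[OF b] by blast
      then show ?thesis by (simp add: inj_on_def)
    qed
    then show ?thesis using True by (simp add: adj_def distinct_map)
  qed (simp add: adj_def)
  show "set (adj \<pi> \<sigma> w) = neighbors (graph_of \<pi>) w"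
  proof (cases "w < nv")
    case True
    let ?v = "rZ \<pi> w"
    have b: "base ?v \<in> Bs" using rZ_Vs[OF True] by (auto simp: Vs_def)
    have "(\<lambda>k. nbr ?v (\<sigma> ?v k)) ` {0..<deg (base ?v)} = nbr ?v ` {..<d}"
    proof (cases "deg (base ?v) = d")
      case dd: True
      have "\<sigma> ?v ` {..<d} = {..<d}" by (rule permutes_image[OF vorders_permutes[OF \<sigma>]])
      then show ?thesis
        using image_image[of "nbr ?v" "\<sigma> ?v" "{..<d}"] by (simp add: dd atLeast0LessThan)
    next
      case False
      then have d1: "deg (base ?v) = 1" using deg_cases'[OF b] by blast
      have "nbr ?v a = nbr ?v 0" for a by (rule nbr_cong) (rule item_leaf[OF d1])
      then have c: "nbr ?v = (\<lambda>_. nbr ?v 0)" by blast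
      have "0 \<in> {..<d}" using d2 by simp
      then have "{0..<deg (base ?v)} \<noteq> {}" "{..<d} \<noteq> {}" using d1 by (simp, blast)
      then show ?thesis by (subst (1 2) c) (simp add: image_constant_conv)
    qed
    then have "\<pi> ` (\<lambda>k. nbr ?v (\<sigma> ?v k)) ` {0..<deg (base ?v)} = \<pi> ` nbr ?v ` {..<d}" by (rule arg_cong)
    then show ?thesis using True neighbors_graph[OF True] by (simp add: adj_def image_image)
  qed (simp add: adj_def neighbors_isolated)
qed

lemma simple_graph_of: "nv \<le> n \<Longrightarrow> simple_graph n (graph_of \<pi>)"
  using edge_subset card_edge unfolding simple_graph_def by fastforce

lemma bipartite_graph_of:
  assumes n: "nv \<le> n" shows "bipartite n (graph_of \<pi>)"
  unfolding bipartite_def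
proof (intro exI conjI ballI)
  \<comment> \<open>The isolated vertices from \<open>nv\<close> on go to the other side.\<close>
  let ?L = "{w. w < n \<and> w < nv \<and> fst (snd (rZ \<pi> w))}"
  show "?L \<union> ({..<n} - ?L) = {..<n}" "?L \<inter> ({..<n} - ?L) = {}" by auto
  fix e assume "e \<in> graph_of \<pi>"
  then obtain v a where va: "v \<in> Vs" "a < d" "e = {\<pi> v, \<pi> (nbr v a)}" by (auto simp: graph_of_def)
  note nV = nbr_Vs[OF va(1,2)]
  have sd: "fst (snd (nbr v a)) \<longleftrightarrow> \<not> fst (snd v)" by (simp add: nbr_def)
  have lt: "\<pi> v < nv" "\<pi> (nbr v a) < nv" using rZ_lab(2) va nV by auto
  have r: "rZ \<pi> (\<pi> v) = v" "rZ \<pi> (\<pi> (nbr v a)) = nbr v a" using rZ_lab(1) va nV by auto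
  show "\<exists>u\<in>?L. \<exists>w\<in>{..<n} - ?L. e = {u, w}"
  proof (cases "fst (snd v)")
    case True
    have "\<pi> v \<in> ?L" "\<pi> (nbr v a) \<in> {..<n} - ?L" using True sd lt r n by auto
    then show ?thesis using va(3) by (intro bexI[where x = "\<pi> v"] bexI[where x = "\<pi> (nbr v a)"])
  next
    case False
    have "\<pi> (nbr v a) \<in> ?L" "\<pi> v \<in> {..<n} - ?L" using False sd lt r n by auto
    moreover have "e = {\<pi> (nbr v a), \<pi> v}" unfolding va(3) by (rule insert_commute)
    ultimately show ?thesis by (intro bexI[where x = "\<pi> (nbr v a)"] bexI[where x = "\<pi> v"])
  qed
qed

lemma max_degree_graph_of:
  assumes n: "nv \<le> n" shows "max_degree n (graph_of \<pi>) = d"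
proof -
  obtain g where g: "g \<in> Gs" using Gs_ne by blast
  have b: "U h 0 \<in> Bs" using N1 by simp
  let ?v = "(g, True, U h 0)"
  have v: "?v \<in> Vs" using g b by (simp add: Vs_def)
  have dg: "deg (U h 0) = d" using deg_pos_depth[OF b] h1 by simp
  have "inj_on (\<lambda>a. \<pi> (nbr ?v a)) {..<d}"
  proof (rule inj_onI)
    fix a a' assume a: "a \<in> {..<d}" "a' \<in> {..<d}" "\<pi> (nbr ?v a) = \<pi> (nbr ?v a')"
    then have "nbr ?v a = nbr ?v a'" using lab_inj nbr_Vs[OF v] by simp
    then have "item (U h 0) a = item (U h 0) a'" using nbr_item_eq[OF v, of a a'] a by simp
    then show "a = a'" using item_inj[OF dg] a by simp
  qed
  then have "card (neighbors (graph_of \<pi>) (\<pi> ?v)) = d"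
    using neighbors_graph[OF rZ_lab(2)[OF v]] rZ_lab(1)[OF v] by (simp add: card_image)
  moreover have "\<pi> ?v < n" using rZ_lab(2)[OF v] n by simp
  ultimately show ?thesis
    unfolding max_degree_def
    by (intro Max_eqI) (auto simp: card_neighbors_le intro!: image_eqI[where x = "\<pi> ?v"])
qed

lemma finite_graph_of: "finite (graph_of \<pi>)"
  by (rule finite_subset[of _ "Pow {..<nv}"]) (use edge_subset in auto)

section \<open>Matchings of the lifted graph\<close>

definition "mate_item b = (SOME a. a < d \<and> item b a = (mate_base h b, 0))"
definition "mate v = nbr v (mate_item (base v))"

lemma mate_item:
  assumes "b \<in> Bs" "\<And>i. b \<noteq> C i"
  shows "mate_item b < d" "item b (mate_item b) = (mate_base h b, 0)"
proof -
  have "(mate_base h b, 0) \<in> items b"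
    using assms by (cases b) (auto simp: mem_items)
  then obtain a where "a < d" "item b a = (mate_base h b, 0)" by (rule item_surj[OF assms(1)])
  then have "mate_item b < d \<and> item b (mate_item b) = (mate_base h b, 0)"
    unfolding mate_item_def by (intro someI[where P = "\<lambda>a. a < d \<and> item b a = (mate_base h b, 0)"]) simp
  then show "mate_item b < d" "item b (mate_item b) = (mate_base h b, 0)" by auto
qed

lemma mate_props:
  assumes "v \<in> Vs" "\<And>i. base v \<noteq> C i"
  shows "mate v \<in> Vs" "\<And>i. base (mate v) \<noteq> C i" "mate (mate v) = v"
proof -
  have b: "base v \<in> Bs" using assms(1) by (auto simp: Vs_def)
  note m = mate_item[OF b assms(2)]
  show V: "mate v \<in> Vs" unfolding mate_def by (rule nbr_Vs[OF assms(1) m(1)])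
  have bm: "base (mate v) = mate_base h (base v)" using m by (simp add: mate_def nbr_def)
  show nC: "base (mate v) \<noteq> C i" for i unfolding bm using assms(2) by (cases "base v") auto
  have b': "base (mate v) \<in> Bs" using V by (auto simp: Vs_def)
  have "mate_base h (mate_base h (base v)) = base v"
    using b assms(2) by (cases "base v") auto
  then have "item (base (mate v)) (mate_item (base (mate v))) = (base v, snd (item (base v) (mate_item (base v))))"
    using mate_item(2)[OF b' nC] m bm by simp
  then show "mate (mate v) = v"
    unfolding mate_def[of "mate v"] unfolding mate_def by (rule nbr_back[OF assms(1) m(1)])
qed

lemma card_typed: "card {v \<in> Vs. P (base v)} = 2 * card Gs * card {b \<in> Bs. P b}"
proof -
  have "{v \<in> Vs. P (base v)} = Gs \<times> (UNIV \<times> {b \<in> Bs. P b})" by (auto simp: Vs_def)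
  then show ?thesis by (simp add: card_cartesian_product)
qed

lemma card_not_C: "card {b \<in> Bs. \<forall>i. b \<noteq> C i} = N * (2 * h + 1)"
proof -
  have "{b \<in> Bs. \<forall>i. b \<noteq> C i} = (\<lambda>(j, x). U j x) ` ({..h} \<times> {..<N}) \<union> (\<lambda>(j, x). W j x) ` ({1..h} \<times> {..<N})"
    by (auto simp: gadget_vertices_def)
  moreover have "card ((\<lambda>(j, x). U j x) ` ({..h} \<times> {..<N})) = Suc h * N"
    "card ((\<lambda>(j, x). W j x) ` ({1..h} \<times> {..<N})) = h * N"
    by (subst card_image; auto simp: inj_on_def card_cartesian_product)+
  moreover have "(\<lambda>(j, x). U j x) ` ({..h} \<times> {..<N}) \<inter> (\<lambda>(j, x). W j x) ` ({1..h} \<times> {..<N}) = {}" by auto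
  ultimately show ?thesis by (simp add: card_Un_disjoint algebra_simps)
qed

lemma card_not_U: "card {b \<in> Bs. \<forall>j x. b \<noteq> U j x} = h * N + h"
proof -
  have "{b \<in> Bs. \<forall>j x. b \<noteq> U j x} = (\<lambda>(j, x). W j x) ` ({1..h} \<times> {..<N}) \<union> C ` {..<h}"
    by (auto simp: gadget_vertices_def)
  moreover have "card ((\<lambda>(j, x). W j x) ` ({1..h} \<times> {..<N})) = h * N" "card (C ` {..<h}) = h"
    by (subst card_image; auto simp: inj_on_def card_cartesian_product)+
  moreover have "(\<lambda>(j, x). W j x) ` ({1..h} \<times> {..<N}) \<inter> C ` {..<h} = {}" by auto
  ultimately show ?thesis by (simp add: card_Un_disjoint)
qed

text \<open>Pairing each vertex with its partner covers all 2 * card Gs * N * (2 h + 1) vertices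
  that do not lie over connectors.\<close>

lemma matching_number_ge: "card Gs * (N * (2 * h + 1)) \<le> matching_number (graph_of \<pi>)"
proof -
  define A where "A = {v \<in> Vs. \<forall>i. base v \<noteq> C i}"
  define M where "M = (\<lambda>v. {\<pi> v, \<pi> (mate v)}) ` A"
  have A: "v \<in> Vs" "mate v \<in> A" "mate (mate v) = v" "mate_item (base v) < d" if "v \<in> A" for v
    using that mate_props[of v] mate_item(1)[of "base v"] by (auto simp: A_def Vs_def)
  have ME: "M \<subseteq> graph_of \<pi>"
    using A edge_in_graph by (auto simp: M_def mate_def[abs_def])
  have dis: "disjoint M"
  proof (rule disjointI)
    fix e e' assume e: "e \<in> M" "e' \<in> M" "e \<noteq> e'"
    obtain v v' where v: "v \<in> A" "e = {\<pi> v, \<pi> (mate v)}" "v' \<in> A" "e' = {\<pi> v', \<pi> (mate v')}"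
      using e(1,2) unfolding M_def by blast
    show "e \<inter> e' = {}"
    proof (rule ccontr)
      assume "e \<inter> e' \<noteq> {}"
      then have "v = v' \<or> v = mate v' \<or> mate v = v' \<or> mate v = mate v'"
      proof -
        obtain i where "i \<in> {\<pi> v, \<pi> (mate v)}" "i \<in> {\<pi> v', \<pi> (mate v')}"
          using \<open>e \<inter> e' \<noteq> {}\<close> v by blast
        moreover have "v \<in> Vs" "v' \<in> Vs" "mate v \<in> Vs" "mate v' \<in> Vs"
          using A(1) A(2) v by blast+
        ultimately show ?thesis using lab_inj by blast
      qed
      then have "v = v' \<or> v = mate v'" using A(3)[OF v(1)] A(3)[OF v(3)] by metis
      then show False using e(3) v(2,4) A(3)[OF v(3)] by (auto simp: insert_commute)
    qed
  qed
  have "finite M" using ME finite_graph_of finite_subset by blast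
  then have "card (\<Union>M) = 2 * card M" using dis ME card_edge by (intro card_Union_pairs) auto
  moreover have "\<Union>M = \<pi> ` A" using A(2) by (auto simp: M_def)
  moreover have "card (\<pi> ` A) = card A"
    using lab_inj by (intro card_image) (auto simp: A_def inj_on_def)
  moreover have "card A = 2 * card Gs * (N * (2 * h + 1))"
    unfolding A_def using card_typed[where P = "\<lambda>b. \<forall>i. b \<noteq> C i"] by (simp only: card_not_C)
  ultimately have cM: "card M = card Gs * (N * (2 * h + 1))" by simp
  have fin: "finite {M. matching (graph_of \<pi>) M}"
    by (rule finite_subset[of _ "Pow (graph_of \<pi>)"]) (auto simp: matching_def finite_graph_of)
  have "matching (graph_of \<pi>) M" using ME dis by (simp add: matching_def)
  then have "card M \<le> matching_number (graph_of \<pi>)"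
    unfolding matching_number_def by (intro Max_ge finite_imageI[OF fin] imageI) simp
  then show ?thesis by (simp add: cM)
qed

text \<open>The vertices over \<open>W\<close> and \<open>C\<close> meet every edge except the lifts
  of the centre edges, so a matching has at most as many edges of the former kind as there are such
  vertices. Every remaining edge of the matching contributes both its ends to the labels
  counted.\<close>

lemma centre_labels_ge:
  assumes M: "matching (graph_of \<pi>) M"
  shows "2 * card M \<le> card {w \<in> {..<nv}. (\<exists>x<N. base (rZ \<pi> w) = U h x) \<and>
      {w, \<pi> (nbr (rZ \<pi> w) (centre_item (base (rZ \<pi> w))))} \<in> M} + 2 * (2 * card Gs * (h * N + h))"
proof -
  define Q where "Q = {v \<in> Vs. \<forall>j x. base v \<noteq> U j x}"
  define NC where "NC = {e \<in> M. \<exists>v\<in>Q. \<pi> v \<in> e}"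
  let ?W = "{w \<in> {..<nv}. (\<exists>x<N. base (rZ \<pi> w) = U h x) \<and>
      {w, \<pi> (nbr (rZ \<pi> w) (centre_item (base (rZ \<pi> w))))} \<in> M}"
  have ME: "M \<subseteq> graph_of \<pi>" and dis: "disjoint M" using M by (auto simp: matching_def)
  have finM: "finite M" using ME finite_graph_of finite_subset by blast
  have "\<forall>e\<in>NC. \<exists>v\<in>Q. \<pi> v \<in> e" by (simp add: NC_def)
  then obtain f where f: "\<And>e. e \<in> NC \<Longrightarrow> f e \<in> Q \<and> \<pi> (f e) \<in> e" by metis
  have "inj_on f NC"
  proof (rule inj_onI)
    fix e e' assume e: "e \<in> NC" "e' \<in> NC" "f e = f e'"
    then have "\<pi> (f e) \<in> e \<inter> e'" using f[of e] f[of e'] by simp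
    then show "e = e'" using dis e(1,2) unfolding NC_def disjoint_def by blast
  qed
  moreover have "f ` NC \<subseteq> Q" using f by auto
  moreover have "finite Q" using finite_Vs by (simp add: Q_def)
  ultimately have "card NC \<le> card Q" by (rule card_inj_on_le)
  also have "card Q = 2 * card Gs * (h * N + h)" 
    unfolding Q_def using card_typed[where P = "\<lambda>b. \<forall>j x. b \<noteq> U j x"] by (simp only: card_not_U)
  finally have NC: "card NC \<le> 2 * card Gs * (h * N + h)" .
  have "w \<in> ?W" if e: "e \<in> M - NC" "w \<in> e" for e w
  proof -
    have "e \<in> graph_of \<pi>" using e ME by blast
    then obtain v a where va: "v \<in> Vs" "a < d" "w = \<pi> v" "e = {\<pi> v, \<pi> (nbr v a)}"
      using graph_edge[OF _ e(2)] by blast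
    have "v \<notin> Q" "nbr v a \<notin> Q" using e va by (auto simp: NC_def)
    then obtain j x i y where bs: "base v = U j x" "base (nbr v a) = U i y"
      using va nbr_Vs[OF va(1,2)] by (auto simp: Q_def)
    have b: "U j x \<in> Bs" using va(1) bs by (auto simp: Vs_def)
    have "item (U j x) a \<in> items (U j x)" using item_in[OF b va(2)] .
    moreover have "fst (item (U j x) a) = U i y" using bs by (simp add: nbr_def)
    ultimately have "snd (item (U j x) a) < mlt (U j x) (U i y)"
      using mem_items[of "U i y" "snd (item (U j x) a)" "U j x"] by (metis prod.collapse)
    then have jx: "j = h" "i = h" "x = y" "snd (item (U j x) a) = 0" by (auto split: if_splits)
    have xN: "x < N" using b by simp
    have "item (U h x) a = (U h x, 0)"
      using jx \<open>fst (item (U j x) a) = U i y\<close> by (simp add: prod_eq_iff)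
    then have "nbr v (centre_item (base v)) = nbr v a"
      using bs jx centre_item(2)[OF xN] by (intro nbr_cong) simp
    then show ?thesis
      using va rZ_lab[OF va(1)] bs jx xN e by auto
  qed
  then have "\<Union>(M - NC) \<subseteq> ?W" by blast
  then have "card (\<Union>(M - NC)) \<le> card ?W" by (intro card_mono) auto
  moreover have "card (\<Union>(M - NC)) = 2 * card (M - NC)"
  proof (rule card_Union_pairs)
    show "disjoint (M - NC)" using dis unfolding disjoint_def by blast
  qed (use finM ME card_edge in auto)
  moreover have "card M = card (M - NC) + card NC"
    using finM by (subst card_Diff_subset) (auto simp: NC_def card_mono intro: finite_subset)
  ultimately show ?thesis using NC by linarith
qed

end

text \<open>Undoing \<open>\<pi>0\<close> and applying \<open>\<pi>\<close> is the isomorphism; the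
  isolated vertices from \<open>nv\<close> on stay in place.\<close>

lemma presentation_graph_of:
  assumes \<pi>0: "\<pi>0 \<in> labellings" and \<pi>: "\<pi> \<in> labellings" and \<sigma>: "\<sigma> \<in> vorders" and n: "nv \<le> n"
  shows "presentation n (graph_of \<pi>0) (graph_of \<pi>) (adj \<pi> \<sigma>)"
proof -
  define \<rho> where "\<rho> w = (if w < nv then \<pi> (rZ \<pi>0 w) else w)" for w
  have r: "\<rho> (\<pi>0 v) = \<pi> v" if "v \<in> Vs" for v
    using rZ_lab[OF \<pi>0 that] by (simp add: \<rho>_def)
  have inj: "inj_on \<rho> {..<n}"
  proof (rule inj_onI)
    fix w w' assume eq: "\<rho> w = \<rho> w'"
    have lt: "\<rho> u < nv \<longleftrightarrow> u < nv" for u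
    proof (cases "u < nv")
      case True
      have "\<rho> u = \<pi> (rZ \<pi>0 u)" using True by (simp only: \<rho>_def if_True)
      then show ?thesis using rZ_lab(2)[OF \<pi> rZ_Vs(1)[OF \<pi>0 True]] True by (simp only: simp_thms)
    next
      case False
      then have "\<rho> u = u" by (simp only: \<rho>_def if_False)
      then show ?thesis by (simp only: simp_thms)
    qed
    show "w = w'"
    proof (cases "w < nv")
      case True
      then have w': "w' < nv" using lt[of w] lt[of w'] eq by (simp only:)
      then have "rZ \<pi>0 w = rZ \<pi>0 w'"
        using eq True w' lab_inj[OF \<pi> rZ_Vs(1)[OF \<pi>0 True] rZ_Vs(1)[OF \<pi>0 w']]
        by (simp only: \<rho>_def if_True)
      then show ?thesis using rZ_Vs(2)[OF \<pi>0 True] rZ_Vs(2)[OF \<pi>0 w'] by metis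
    next
      case False
      then have "\<not> w' < nv" using lt[of w] lt[of w'] eq by (simp only: simp_thms)
      then show ?thesis using eq False by (simp only: \<rho>_def if_False)
    qed
  qed
  have "\<rho> u < n" if "u < n" for u
  proof (cases "u < nv")
    case True
    have "\<rho> u = \<pi> (rZ \<pi>0 u)" using True by (simp only: \<rho>_def if_True)
    then show ?thesis using rZ_lab(2)[OF \<pi> rZ_Vs(1)[OF \<pi>0 True]] n by linarith
  next
    case False
    then have "\<rho> u = u" by (simp only: \<rho>_def if_False)
    then show ?thesis using that by (simp only:)
  qed
  then have "\<rho> ` {..<n} \<subseteq> {..<n}" by auto
  then have "bij_betw \<rho> {..<n} {..<n}"
    using inj by (simp add: bij_betw_def endo_inj_surj)
  moreover have "graph_of \<pi> = (\<lambda>e. \<rho> ` e) ` graph_of \<pi>0"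
  proof -
    have im: "\<rho> ` {\<pi>0 v, \<pi>0 (nbr v a)} = {\<pi> v, \<pi> (nbr v a)}" if "v \<in> Vs" "a < d" for v a
      using r[OF that(1)] r[OF nbr_Vs[OF that]] by simp
    show ?thesis
    proof (intro equalityI subsetI)
      fix e assume "e \<in> graph_of \<pi>"
      then obtain v a where "v \<in> Vs" "a < d" "e = {\<pi> v, \<pi> (nbr v a)}" by (auto simp: graph_of_def)
      then show "e \<in> (\<lambda>e. \<rho> ` e) ` graph_of \<pi>0"
        using im edge_in_graph[OF \<pi>0] by (metis imageI)
    next
      fix e assume "e \<in> (\<lambda>e. \<rho> ` e) ` graph_of \<pi>0"
      then obtain v a where "v \<in> Vs" "a < d" "e = \<rho> ` {\<pi>0 v, \<pi>0 (nbr v a)}" by (auto simp: graph_of_def)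
      then show "e \<in> graph_of \<pi>" using im edge_in_graph[OF \<pi>] by metis
    qed
  qed
  ultimately show ?thesis
    using adjacency_lists_graph[OF \<pi> \<sigma> n] unfolding presentation_def graph_iso_def by blast
qed

text \<open>Pairs of a vertex and a presentation are counted twice. Some tape succeeds on a fraction
  0.51 of the presentations, and there at least card Gs (N - 2 h) - \<epsilon> n centre edges have
  to be answered at both ends. On the other hand each vertex answers its centre edge in at most a
  fraction \<delta> of the presentations.\<close>

theorem query_tradeoff:
  assumes \<pi>0: "\<pi>0 \<in> labellings" and n: "nv \<le> n"
    and comp: "computes_approx_matching n \<epsilon> (graph_of \<pi>0) 0.51 A"
    and nq: "\<not> makes_queries n (graph_of \<pi>0) A (real T)"
    and \<delta>: "\<And>v S. v < nv \<Longrightarrow> (\<And>\<pi> \<sigma>. \<pi> \<in> labellings \<Longrightarrow> \<sigma> \<in> vorders \<Longrightarrow> query_count (adj \<pi> \<sigma>) S \<le> T) \<Longrightarrow>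
      real (card {(\<pi>, \<sigma>) \<in> labellings \<times> vorders. (\<exists>x<N. base (rZ \<pi> v) = U h x) \<and>
        run (adj \<pi> \<sigma>) S = Some (\<pi> (nbr (rZ \<pi> v) (centre_item (base (rZ \<pi> v)))))})
      \<le> \<delta> * real (card (labellings \<times> vorders))"
  shows "0.51 * (2 * (real (card Gs) * real N - 2 * real (card Gs) * real h - \<epsilon> * real n)) \<le> real nv * \<delta>"
proof -
  let ?R = "labellings \<times> vorders"
  interpret P: prob_space random_tape
    unfolding random_tape_def by (rule prob_space.prob_space_stream_space) (rule prob_space_measure_pmf)
  have finR: "finite ?R"
  proof -
    have "finite labellings"
      by (rule finite_subset[of _ "PiE Vs (\<lambda>_. {..<nv})"])
        (auto simp: labellings_def PiE_def bij_betw_def finite_PiE[unfolded PiE_def] finite_Vs)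
    moreover have "finite vorders" unfolding vorders_def
      by (intro finite_PiE_dflt finite_Vs) (simp add: finite_permutations)
    ultimately show ?thesis by simp
  qed
  have "(\<lambda>_. id) \<in> vorders" by (simp add: vorders_def PiE_dflt_def permutes_id)
  then have neR: "?R \<noteq> {}" using \<pi>0 by auto
  define r where "r = real (card ?R)"
  have rpos: "0 < r" using finR neR by (simp add: r_def card_gt_0_iff)
  define Suc' where "Suc' x = {t \<in> space random_tape. \<exists>M. approx_max_matching n \<epsilon> (graph_of (fst x)) M
      \<and> answers_matching n (adj (fst x) (snd x)) (A t) M}" for x
  have ms: "0.51 \<le> measure random_tape (Suc' x)" if "x \<in> ?R" for x
    using comp presentation_graph_of[OF \<pi>0 _ _ n, of "fst x" "snd x"] that
    unfolding computes_approx_matching_def Suc'_def by auto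
  \<comment> \<open>A set that is not measurable would have measure 0, less than 0.51.\<close>
  have sets: "Suc' x \<in> sets random_tape" if "x \<in> ?R" for x
    using ms[OF that] measure_notin_sets[of "Suc' x" random_tape] by force
  have "\<exists>t\<in>space random_tape. 0.51 * r \<le> (\<Sum>x\<in>?R. indicator (Suc' x) t)"
  proof (rule ccontr)
    assume "\<not> ?thesis"
    then have less: "\<And>t. t \<in> space random_tape \<Longrightarrow> (\<Sum>x\<in>?R. indicator (Suc' x) t) < 0.51 * r" by force
    have int: "integrable random_tape (\<lambda>t. \<Sum>x\<in>?R. indicator (Suc' x) t :: real)"
      using sets by (intro Bochner_Integration.integrable_sum integrable_real_indicator)
        (auto simp: P.emeasure_finite less_top[symmetric])
    have "P.expectation (\<lambda>t. \<Sum>x\<in>?R. indicator (Suc' x) t :: real) < 0.51 * r"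
      by (rule P.expectation_less[OF int]) (use less in auto)
    moreover have "P.expectation (\<lambda>t. \<Sum>x\<in>?R. indicator (Suc' x) t :: real) = (\<Sum>x\<in>?R. measure random_tape (Suc' x))"
      using sets by (subst Bochner_Integration.integral_sum)
        (auto simp: P.emeasure_finite less_top[symmetric] intro!: integrable_real_indicator sum.cong)
    moreover have "0.51 * r \<le> (\<Sum>x\<in>?R. measure random_tape (Suc' x))"
      using sum_bounded_below[of ?R "0.51 :: real" "\<lambda>x. measure random_tape (Suc' x)"] ms
      by (simp add: r_def mult.commute)
    ultimately show False by simp
  qed
  then obtain t where t: "t \<in> space random_tape" "0.51 * r \<le> (\<Sum>x\<in>?R. indicator (Suc' x) t)" by blast
  define \<phi> where "\<phi> v x \<longleftrightarrow> (\<exists>y<N. base (rZ (fst x) v) = U h y) \<and>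
    run (adj (fst x) (snd x)) (A t v) = Some (fst x (nbr (rZ (fst x) v) (centre_item (base (rZ (fst x) v)))))" for v x
  define m where "m = 2 * (real (card Gs) * real N - 2 * real (card Gs) * real h - \<epsilon> * real n)"
  have many: "m \<le> real (card {v \<in> {..<nv}. \<phi> v x})" if x: "x \<in> ?R" "t \<in> Suc' x" for x
  proof -
    obtain M where M: "approx_max_matching n \<epsilon> (graph_of (fst x)) M"
      "answers_matching n (adj (fst x) (snd x)) (A t) M" using x(2) by (auto simp: Suc'_def)
    have \<pi>: "fst x \<in> labellings" using x(1) by auto
    have mat: "matching (graph_of (fst x)) M"
      and cM: "real (matching_number (graph_of (fst x))) - \<epsilon> * real n \<le> real (card M)"
      using M(1) by (auto simp: approx_max_matching_def)
    let ?W = "{w \<in> {..<nv}. (\<exists>y<N. base (rZ (fst x) w) = U h y) \<and>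
      {w, fst x (nbr (rZ (fst x) w) (centre_item (base (rZ (fst x) w))))} \<in> M}"
    have "?W \<subseteq> {v \<in> {..<nv}. \<phi> v x}"
      using M(2) n unfolding answers_matching_def \<phi>_def by auto
    then have "card ?W \<le> card {v \<in> {..<nv}. \<phi> v x}" by (intro card_mono) auto
    moreover note centre_labels_ge[OF \<pi> mat] matching_number_ge[OF \<pi>]
    ultimately have "2 * card M \<le> card {v \<in> {..<nv}. \<phi> v x} + 2 * (2 * card Gs * (h * N + h))"
      and mn: "card Gs * (N * (2 * h + 1)) \<le> matching_number (graph_of (fst x))" by linarith+
    then have "2 * real (card M) \<le> real (card {v \<in> {..<nv}. \<phi> v x}) + real (2 * (2 * card Gs * (h * N + h)))"
      by linarith
    moreover have "real (card Gs * (N * (2 * h + 1))) - \<epsilon> * real n \<le> real (card M)"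
      using cM mn by linarith
    ultimately show ?thesis unfolding m_def by (simp add: algebra_simps)
  qed
  have few: "real (card {x \<in> ?R. \<phi> v x}) \<le> \<delta> * r" if "v < nv" for v
  proof -
    have "query_count (adj \<pi> \<sigma>) (A t v) \<le> T" if "\<pi> \<in> labellings" "\<sigma> \<in> vorders" for \<pi> \<sigma>
    proof (rule ccontr)
      assume "\<not> ?thesis"
      then have "real T \<le> real (query_count (adj \<pi> \<sigma>) (A t v))" by simp
      then show False
        using nq presentation_graph_of[OF \<pi>0 that n] t(1) \<open>v < nv\<close> n unfolding makes_queries_def
        by (meson order_less_le_trans)
    qed
    from \<delta>[OF that this] show ?thesis by (simp add: r_def \<phi>_def case_prod_beta' mem_Times_iff conj_assoc)
  qed
  have "0.51 * r * m \<le> (\<Sum>x\<in>?R. real (card {v \<in> {..<nv}. \<phi> v x}))"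
  proof (cases "0 \<le> m")
    case True
    have "0.51 * r * m \<le> (\<Sum>x\<in>?R. indicator (Suc' x) t) * m" using t(2) True by (rule mult_right_mono)
    also have "\<dots> = (\<Sum>x\<in>?R. indicator (Suc' x) t * m)" by (rule sum_distrib_right)
    also have "\<dots> \<le> (\<Sum>x\<in>?R. real (card {v \<in> {..<nv}. \<phi> v x}))"
      using many by (intro sum_mono) (auto simp: indicator_def)
    finally show ?thesis .
  next
    case False
    then have "0.51 * r * m \<le> 0" using rpos by (intro mult_nonneg_nonpos) auto
    also have "0 \<le> (\<Sum>x\<in>?R. real (card {v \<in> {..<nv}. \<phi> v x}))" by (intro sum_nonneg) auto
    finally show ?thesis .
  qed
  also have "\<dots> = (\<Sum>x\<in>?R. \<Sum>v<nv. if \<phi> v x then 1 else 0)"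
    by (intro sum.cong refl) (simp add: sum.inter_filter[symmetric])
  also have "\<dots> = (\<Sum>v<nv. \<Sum>x\<in>?R. if \<phi> v x then 1 else 0)" by (rule sum.swap)
  also have "\<dots> = (\<Sum>v<nv. real (card {x \<in> ?R. \<phi> v x}))"
    using finR by (intro sum.cong refl) (simp add: sum.inter_filter[symmetric])
  also have "\<dots> \<le> (\<Sum>v<nv. \<delta> * r)" using few by (intro sum_mono) auto
  also have "\<dots> = real nv * \<delta> * r" by simp
  finally have "0.51 * m * r \<le> real nv * \<delta> * r" by (simp add: ac_simps)
  then show ?thesis using rpos unfolding m_def by simp
qed

end

subsection \<open>Choice of the parameters\<close>

text \<open>A code in base \<open>B\<close> for the unordered pair of ends and the number among the
  parallel edges, symmetric in the ends. The shift by 1 avoids the colour 0, which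
  \<open>turn_relations\<close> excludes.\<close>

definition colour :: "nat \<Rightarrow> ('b \<Rightarrow> nat) \<Rightarrow> 'b \<Rightarrow> 'b \<times> nat \<Rightarrow> nat" where
  "colour B \<nu> b it = 1 + (snd it * B + max (\<nu> b) (\<nu> (fst it))) * B + min (\<nu> b) (\<nu> (fst it))"

lemma colour_sym: "colour B \<nu> c (b, r) = colour B \<nu> b (c, r)"
  by (simp add: colour_def max.commute min.commute)

text \<open>The digits recover the parallel number and the maximum and minimum of the two vertex
  numbers. One of these belongs to the known end \<open>b\<close>, so the other determines the far
  end.\<close>

lemma colour_inj:
  assumes \<nu>: "inj_on \<nu> Bs" "\<nu> ` Bs \<subseteq> {..<B}" and b: "b \<in> Bs" "c \<in> Bs" "c' \<in> Bs"
    and eq: "colour B \<nu> b (c, r) = colour B \<nu> b (c', r')"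
  shows "(c, r) = (c', r')"
proof -
  let ?M = "max (\<nu> b) (\<nu> c)" and ?M' = "max (\<nu> b) (\<nu> c')"
  let ?m = "min (\<nu> b) (\<nu> c)" and ?m' = "min (\<nu> b) (\<nu> c')"
  have lt: "\<nu> b < B" "\<nu> c < B" "\<nu> c' < B" using \<nu>(2) b by auto
  have mlt: "?m < B" "?m' < B" "?M < B" "?M' < B" using lt by auto
  have e: "(r * B + ?M) * B + ?m = (r' * B + ?M') * B + ?m'" using eq by (simp add: colour_def)
  have "((r * B + ?M) * B + ?m) mod B = ?m" "((r' * B + ?M') * B + ?m') mod B = ?m'"
    using mlt by simp_all
  then have m: "?m = ?m'" using e by metis
  then have e2: "r * B + ?M = r' * B + ?M'" using e lt by simp
  have "(r * B + ?M) mod B = ?M" "(r' * B + ?M') mod B = ?M'" using mlt by simp_all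
  then have M: "?M = ?M'" using e2 by metis
  then have r: "r = r'" using e2 lt by simp
  have "\<nu> c = \<nu> c'" using m M by (auto simp: min_def max_def split: if_splits)
  then have "c = c'" using \<nu>(1) b by (auto dest: inj_onD)
  then show ?thesis using r by simp
qed

lemma colour_less:
  assumes "\<nu> b < B" "\<nu> (fst it) < B" "snd it < D"
  shows "colour B \<nu> b it < 1 + D * (B * B)"
proof -
  have "snd it * B + max (\<nu> b) (\<nu> (fst it)) < (snd it + 1) * B" using assms by (simp add: algebra_simps)
  also have "\<dots> \<le> D * B" using assms(3) by (intro mult_le_mono1) simp
  finally have "snd it * B + max (\<nu> b) (\<nu> (fst it)) + 1 \<le> D * B" by simp
  then have "(snd it * B + max (\<nu> b) (\<nu> (fst it)) + 1) * B \<le> D * B * B" by (rule mult_le_mono1)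
  then show ?thesis using assms unfolding colour_def by (simp add: algebra_simps)
qed

context gadget
begin

lemma card_Bs: "card Bs = N * (2 * h + 1) + h"
proof -
  have "card Bs = (\<Sum>b\<in>Bs. 1)" by simp
  also have "\<dots> = N * (2 * h + 1) + h" unfolding sum_gadget by (simp add: algebra_simps)
  finally show ?thesis .
qed

lemma gadget_lift_positions:
  assumes p: "prime p" "d * (card Bs * card Bs) < p" and K: "0 < K"
    and z: "even z" "2 \<le> z" "60 * z \<le> s - 2"
  shows "\<exists>\<nu>. gadget_lift h N s d (positions K p) (turn p) (colour (card Bs) \<nu>) {1..<p} z"
proof -
  have "\<exists>\<nu>. bij_betw \<nu> Bs {0..<card Bs}" using ex_bij_betw_finite_nat[OF finite_Bs] .
  then obtain \<nu> where "bij_betw \<nu> Bs {0..<card Bs}" by blast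
  then have \<nu>: "inj_on \<nu> Bs" "\<nu> ` Bs \<subseteq> {..<card Bs}" by (auto simp: bij_betw_def)
  have p0: "0 < p" "2 \<le> p" using prime_gt_0_nat[OF p(1)] prime_ge_2_nat[OF p(1)] by auto
  have it: "c \<in> Bs" "r < d" if "b \<in> Bs" "(c, r) \<in> items b" for b c r
  proof -
    show c: "c \<in> Bs" using that by (simp add: mem_items)
    have "{c} \<times> {..<mlt b c} \<subseteq> items b" using c by (auto simp: mem_items)
    then have "card ({c} \<times> {..<mlt b c}) \<le> card (items b)" by (rule card_mono[OF finite_items])
    then have "mlt b c \<le> deg b" by (simp add: deg_def card_cartesian_product)
    then show "r < d" using that deg_cases'[of b] d2 by (auto simp: mem_items)
  qed
  have "gadget_lift h N s d (positions K p) (turn p) (colour (card Bs) \<nu>) {1..<p} z"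
  proof unfold_locales
    show "finite (positions K p)" by (simp add: positions_def)
    have "(0, 1, 1, 0) \<in> positions K p" using K p0 by (auto simp: positions_def)
    then show "positions K p \<noteq> {}" by blast
    have "C 0 \<in> Bs" using h1 by simp
    then show "Bs \<noteq> {}" by blast
    show "turn p t g \<in> positions K p" if "g \<in> positions K p" for t g
      using turn_positions[OF that p0(1)] .
    show "turn p t (turn p t g) = g" if "g \<in> positions K p" for t g using turn_turn[OF that] .
    show "colour (card Bs) \<nu> b i \<in> {1..<p}" if "b \<in> Bs" "i \<in> items b" for b i
    proof -
      obtain c r where i: "i = (c, r)" by (cases i)
      have "colour (card Bs) \<nu> b i < 1 + d * (card Bs * card Bs)"
        using it[of b c r] that \<nu>(2) i by (intro colour_less) auto
      then show ?thesis using p(2) by (simp add: colour_def)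
    qed
    show "colour (card Bs) \<nu> c (b, r) = colour (card Bs) \<nu> b (c, r)" for b c r by (rule colour_sym)
    show "inj_on (colour (card Bs) \<nu> b) (items b)" if "b \<in> Bs" for b
    proof (rule inj_onI)
      fix i i' assume i: "i \<in> items b" "i' \<in> items b" "colour (card Bs) \<nu> b i = colour (card Bs) \<nu> b i'"
      obtain c r c' r' where ii: "i = (c, r)" "i' = (c', r')" by (cases i, cases i') auto
      show "i = i'" unfolding ii
        by (rule colour_inj[OF \<nu> that]) (use it[OF that] i ii in auto)
    qed
    show "t = t'" if "g \<in> positions K p" "t \<in> {1..<p}" "t' \<in> {1..<p}" "turn p t g = turn p t' g" for g t t'
      using turn_free[OF p(1) that(1) _ _ that(4)] that(2,3) by simp
  qed (rule z)+
  then show ?thesis by blast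
qed

end

theorem hard_graph:
  fixes h N s D K p z n T :: nat
  assumes par: "1 \<le> h" "1 \<le> N" "1 \<le> s" "(2 * h * N + h) * s < D"
    and p: "prime p" "D * ((N * (2 * h + 1) + h) * (N * (2 * h + 1) + h)) < p" and K: "0 < K"
    and z: "even z" "2 \<le> z" "60 * z \<le> s - 2"
  defines "G \<equiv> K * ((p - 1) * (p * p - 1))" and "L \<equiv> 3 * (D + T)"
  defines "V \<equiv> 2 * G * (N * (2 * h + 1) + h)"
  assumes n: "V \<le> n"
    and small: "real V * (real (L * L) / real V + real (L * L * (K * (p * p) * (2 * L))) / real G + 1 / real s + real L / real (z ^ (h - 1)))
      < 0.51 * (2 * (real G * real N - 2 * real G * real h - \<epsilon> * real n))"
  shows "\<exists>E. simple_graph n E \<and> bipartite n E \<and> max_degree n E = D \<and>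
    (\<forall>A. computes_approx_matching n \<epsilon> E 0.51 A \<longrightarrow> makes_queries n E A (real T))"
proof -
  interpret g: gadget h N s D by unfold_locales (rule par)+
  have cB: "card (gadget_vertices h N) = N * (2 * h + 1) + h" by (rule g.card_Bs)
  obtain \<nu> where "gadget_lift h N s D (positions K p) (turn p) (colour (card (gadget_vertices h N)) \<nu>) {1..<p} z"
    using g.gadget_lift_positions[OF p(1) _ K z] p(2) unfolding cB by blast
  then interpret l: gadget_lift h N s D "positions K p" "turn p" "colour (card (gadget_vertices h N)) \<nu>" "{1..<p}" z .
  have p0: "0 < p" using prime_gt_0_nat[OF p(1)] .
  have cG: "card (positions K p) = G" unfolding G_def by (rule card_positions[OF p0])
  have nV: "l.nv = V" unfolding l.nv_def l.Vs_def V_def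
    by (simp add: card_cartesian_product cG cB)
  have "\<exists>\<pi>. \<pi> \<in> l.labellings"
  proof -
    obtain f where "bij_betw f l.Vs {0..<card l.Vs}" using ex_bij_betw_finite_nat[OF l.finite_Vs] by blast
    then have "bij_betw f l.Vs {..<l.nv}" by (simp add: l.nv_def atLeast0LessThan)
    then have "bij_betw (restrict f l.Vs) l.Vs {..<l.nv}" by (subst bij_betw_cong[of _ _ f]) auto
    then show ?thesis by (intro exI[of _ "restrict f l.Vs"]) (simp add: l.labellings_def)
  qed
  then obtain \<pi> where \<pi>: "\<pi> \<in> l.labellings" by blast
  have n': "l.nv \<le> n" using n nV by simp
  \<comment> \<open>Two paths of length at most L give a word of length at most 2 * L, to which
    \<open>turn_relations\<close> applies.\<close>
  define \<kappa> where "\<kappa> = K * (p * p) * (2 * L)"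
  have \<kappa>1: "1 \<le> \<kappa>" using K p0 g.d2 by (simp add: \<kappa>_def L_def)
  have \<kappa>2: "card {g \<in> positions K p. fold (turn p) w g = g} \<le> \<kappa>"
    if "w \<noteq> []" "reduced w" "set w \<subseteq> {1..<p}" "length w \<le> 2 * (3 * (D + T))" for w
  proof -
    have "card {g \<in> positions K p. fold (turn p) w g = g} \<le> K * (p * p) * length w"
      by (rule turn_relations[OF p(1) that(1-3)])
    also have "\<dots> \<le> \<kappa>" unfolding \<kappa>_def L_def using that(4) by (rule mult_le_mono2)
    finally show ?thesis .
  qed
  have "makes_queries n (l.graph_of \<pi>) A (real T)" if A: "computes_approx_matching n \<epsilon> (l.graph_of \<pi>) 0.51 A" for A
  proof (rule ccontr)
    assume nq: "\<not> ?thesis"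
    have "0.51 * (2 * (real (card (positions K p)) * real N - 2 * real (card (positions K p)) * real h - \<epsilon> * real n))
      \<le> real l.nv * (real (L * L) / real l.nv + real (L * L * \<kappa>) / real (card (positions K p)) + 1 / real s + real L / real (z ^ (h - 1)))"
      unfolding L_def
      by (rule l.query_tradeoff[OF \<pi> n' A nq], rule l.centre_guess_bound) (use \<kappa>1 \<kappa>2 in auto)
    then show False using small unfolding cG nV \<kappa>_def by linarith
  qed
  then show ?thesis
    using l.simple_graph_of[OF \<pi> n'] l.bipartite_graph_of[OF \<pi> n'] l.max_degree_graph_of[OF \<pi> n'] by blast
qed

section \<open>Numerical estimates\<close>

lemma large_n:
  "eventually (\<lambda>n::nat. 1 < real n \<and> 6 \<le> ln (ln (real n)) \<and>
     real n powr 0.01 * ln (real n) ^ 4 < real n powr 0.1 \<and>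
     13718 * real n powr 0.6 * ln (real n) ^ 2 \<le> real n / 20 \<and>
     100 * real n powr 0.02 / real n + 5832 * real n powr 0.03 / real n powr 0.1
       + 1 / (258 * ln (real n) ^ 2) + 9 / ln (real n) ^ 4 \<le> 2 / ln (real n)) sequentially"
  by (intro eventually_conj; real_asymp)

lemma nat_ceiling_le:
  fixes x :: real
  assumes "0 \<le> x"
  shows "real (nat \<lceil>x\<rceil>) \<le> x + 1"
proof -
  have "0 \<le> \<lceil>x\<rceil>" using assms by linarith
  then have "real (nat \<lceil>x\<rceil>) = of_int \<lceil>x\<rceil>" by (rule of_nat_nat)
  then show ?thesis by linarith
qed

text \<open>In units of w = G H: the centre edges needed beyond the cover amount to 14 w, the
  permitted loss \<epsilon> x to at most 11.6 w because \<epsilon> H \<le> 1 / 6, and V \<delta> to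
  less than w.\<close>

lemma budget:
  fixes G H B V \<delta> \<epsilon> x :: real
  assumes G: "0 < G" and H: "15 \<le> H" and \<epsilon>: "0 < \<epsilon>" "\<epsilon> \<le> 0.01" "\<epsilon> * H \<le> 1 / 6"
    and B: "B = 32 * (H * H) + 17 * H" and V: "V = 2 * G * B" and x: "0.95 * x \<le> V"
    and \<delta>: "144 * (H * \<delta>) \<le> 2"
  shows "V * \<delta> < 0.51 * (2 * (G * (16 * H) - 2 * G * H - \<epsilon> * x))"
proof -
  define w where "w = G * H"
  have w: "0 < w" using G H by (simp add: w_def)
  have "\<epsilon> * (0.95 * x) \<le> \<epsilon> * V" using x \<epsilon>(1) by (intro mult_left_mono) auto
  also have "\<dots> = 64 * (w * (\<epsilon> * H)) + 34 * (w * \<epsilon>)" unfolding V B w_def by (simp add: algebra_simps)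
  also have "\<dots> \<le> 64 * (w * (1 / 6)) + 34 * (w * 0.01)"
    using w \<epsilon> by (intro add_mono mult_left_mono) auto
  finally have "0.95 * (\<epsilon> * x) \<le> 11.01 * w" using w by simp
  moreover have "(0.95::real) = 95 / 100" "(11.01::real) = 1101 / 100" and c: "(0.51::real) = 51 / 100"
    by simp_all
  ultimately have "95 / 100 * (\<epsilon> * x) \<le> 1101 / 100 * w" by (simp only:)
  then have 1: "95 * (\<epsilon> * x) \<le> 1101 * w" by linarith
  have "V * \<delta> = 2 * w * ((32 + 17 / H) * (H * \<delta>))"
    unfolding V B w_def using H by (simp add: field_simps)
  also have "\<dots> \<le> 2 * w * ((32 + 17 / H) * (1 / 72))"
    using w H \<delta> by (intro mult_left_mono) auto
  also have "\<dots> \<le> 2 * w * (34 * (1 / 72))"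
    using w H by (intro mult_left_mono mult_right_mono) (auto simp: field_simps)
  finally have 2: "V * \<delta> \<le> 2 * w * (34 * (1 / 72))" .
  have 3: "G * (16 * H) - 2 * G * H = 14 * w" by (simp add: w_def)
  have "2 * w * (34 * (1 / 72)) < 51 / 50 * (14 * w) - 51 / 50 * (\<epsilon> * x)" using 1 w by linarith
  also have "\<dots> = 51 / 100 * (2 * (14 * w - \<epsilon> * x))" by (simp add: algebra_simps)
  finally show ?thesis unfolding 3 c using 2 by linarith
qed

text \<open>For P at least 2 each factor of the denominator is at least half of P and P * P
  respectively. This costs a factor 4 beside the 2 of 2 * L.\<close>

lemma labelling_ratio_le:
  fixes L P K :: real
  assumes "0 \<le> L" "2 \<le> P" "0 < K"
  shows "L * L * (K * (P * P) * (2 * L)) / (K * ((P - 1) * (P * P - 1))) \<le> 8 * L ^ 3 / P"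
proof -
  define Q where "Q = (P - 1) * (P * P - 1)"
  have "P * P * P \<le> 4 * Q"
  proof -
    have "(P / 2) * (P * P / 2) \<le> (P - 1) * (P * P - 1)"
      using assms(2) mult_mono[of 2 P 2 P] by (intro mult_mono) auto
    then show ?thesis by (simp add: Q_def)
  qed
  then have "L ^ 3 * (P * P * P) * 2 \<le> L ^ 3 * (4 * Q) * 2"
    using assms(1) by (intro mult_right_mono mult_left_mono) auto
  then have "2 * L ^ 3 * (P * P) * P \<le> 8 * L ^ 3 * Q" by (simp add: mult.assoc mult.left_commute)
  then have "2 * L ^ 3 * (P * P) \<le> 8 * L ^ 3 / P * Q"
    using assms(2) by (simp only: times_divide_eq_left) (subst pos_le_divide_eq; linarith)
  moreover have "0 < Q" unfolding Q_def
    using assms(2) mult_mono[of 2 P 2 P] by (intro mult_pos_pos) auto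
  ultimately have "2 * L ^ 3 * (P * P) / Q \<le> 8 * L ^ 3 / P"
    by (simp only: pos_divide_le_eq)
  moreover have "L * L * (K * (P * P) * (2 * L)) / (K * ((P - 1) * (P * P - 1))) =
      2 * L ^ 3 * (P * P) / Q"
    unfolding Q_def using assms(3) by (simp add: power3_eq_cube)
  ultimately show ?thesis by simp
qed

text \<open>With \<open>h \<approx> 1 / (6 \<epsilon>)\<close> layers, \<open>16 h\<close> parallel copies and \<open>s \<approx> \<Delta> / (80 h\<^sup>2)\<close>, the matching must
  use a constant fraction of the centre edges.\<close>

lemma parameters:
  fixes n \<Delta> :: nat and \<epsilon> :: real
  assumes big: "1 < real n" "6 \<le> ln (ln (real n))"
     "real n powr 0.01 * ln (real n) ^ 4 < real n powr 0.1"
     "13718 * real n powr 0.6 * ln (real n) ^ 2 \<le> real n / 20"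
     "100 * real n powr 0.02 / real n + 5832 * real n powr 0.03 / real n powr 0.1
       + 1 / (258 * ln (real n) ^ 2) + 9 / ln (real n) ^ 4 \<le> 2 / ln (real n)"
    and \<epsilon>: "0 < \<epsilon>" "\<epsilon> \<le> 0.01" and \<Delta>: "ln (real n) ^ 4 \<le> real \<Delta>" "real \<Delta> \<le> real n powr \<epsilon>"
  obtains h N s K p z T :: nat where
    "1 \<le> h" "1 \<le> N" "1 \<le> s" "(2 * h * N + h) * s < \<Delta>"
    "prime p" "\<Delta> * ((N * (2 * h + 1) + h) * (N * (2 * h + 1) + h)) < p" "0 < K"
    "even z" "2 \<le> z" "60 * z \<le> s - 2"
    "2 * (K * ((p - 1) * (p * p - 1))) * (N * (2 * h + 1) + h) \<le> n"
    "real (2 * (K * ((p - 1) * (p * p - 1))) * (N * (2 * h + 1) + h)) *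
      (real (3 * (\<Delta> + T) * (3 * (\<Delta> + T))) / real (2 * (K * ((p - 1) * (p * p - 1))) * (N * (2 * h + 1) + h))
        + real (3 * (\<Delta> + T) * (3 * (\<Delta> + T)) * (K * (p * p) * (2 * (3 * (\<Delta> + T))))) / real (K * ((p - 1) * (p * p - 1)))
        + 1 / real s + real (3 * (\<Delta> + T)) / real (z ^ (h - 1)))
      < 0.51 * (2 * (real (K * ((p - 1) * (p * p - 1))) * real N - 2 * real (K * ((p - 1) * (p * p - 1))) * real h - \<epsilon> * real n))"
    "real \<Delta> powr (1 / 1000 / \<epsilon>) \<le> real T"
proof -
  define l where "l = ln (real n)"
  define D where "D = real \<Delta>"
  have ll: "6 \<le> ln l" using big(2) by (simp add: l_def)
  have lpos: "0 < l" using big(1) by (simp add: l_def)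
  have l7: "7 \<le> l"
  proof -
    have "ln l \<le> l - 1" using lpos by (rule ln_le_minus_one)
    then show ?thesis using ll by linarith
  qed
  have l2: "49 \<le> l ^ 2" using power_mono[OF l7, of 2] by simp
  have l4: "1 \<le> l ^ 4" using power_mono[of 1 l 4] l7 by simp
  have Dl: "l ^ 4 \<le> D" "D \<le> real n powr \<epsilon>" using \<Delta> by (simp_all add: l_def D_def)
  have D1: "1 \<le> D" using Dl(1) l4 by linarith
  \<comment> \<open>The window for \<Delta> enters here: ln n ^ 4 \<le> \<Delta> \<le> n powr
    \<epsilon> gives 4 ln l \<le> \<epsilon> l, so 1 / \<epsilon>, and with it h, is small against
    l.\<close>
  have el: "24 \<le> \<epsilon> * l"
  proof -
    have "4 * ln l = ln (l ^ 4)" using lpos by (simp add: ln_realpow)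
    also have "\<dots> \<le> ln D" using Dl(1) lpos by (intro ln_mono) auto
    also have "\<dots> \<le> ln (real n powr \<epsilon>)" using Dl(2) D1 by (intro ln_mono) auto
    also have "\<dots> = \<epsilon> * l" using big(1) by (simp add: ln_powr l_def)
    finally show ?thesis using ll by linarith
  qed
  \<comment> \<open>The lift has about 64 G h^2 vertices and 14 G h centre edges beyond the cover,
    where G is the number of positions. With \<epsilon> h \<le> 1 / 6 the permitted loss stays below
    this surplus.\<close>
  define h where "h = nat \<lfloor>1 / (6 * \<epsilon>)\<rfloor>"
  define H where "H = real h"
  have i6: "16 \<le> 1 / (6 * \<epsilon>)" using \<epsilon> by (simp add: field_simps)
  have "0 \<le> \<lfloor>1 / (6 * \<epsilon>)\<rfloor>" using i6 by linarith
  then have Hfl: "H = of_int \<lfloor>1 / (6 * \<epsilon>)\<rfloor>" unfolding H_def h_def by (rule of_nat_nat)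
  have Hle: "H \<le> 1 / (6 * \<epsilon>)" unfolding Hfl by (rule of_int_floor_le)
  have Hge: "1 / (6 * \<epsilon>) - 1 \<le> H" unfolding Hfl by linarith
  have H15: "15 \<le> H" using Hge i6 by linarith
  have h1: "1 \<le> h" using H15 by (simp add: H_def)
  have eH: "\<epsilon> * H \<le> 1 / 6"
    using mult_left_mono[OF Hle, of \<epsilon>] \<epsilon> by simp
  have Hl: "144 * H \<le> l"
  proof -
    have "H * 24 \<le> H * (\<epsilon> * l)" using el H15 by (intro mult_left_mono) auto
    also have "\<dots> = (\<epsilon> * H) * l" by simp
    also have "\<dots> \<le> 1 / 6 * l" using eH lpos by (intro mult_right_mono) auto
    finally show ?thesis by linarith
  qed
  \<comment> \<open>As h * h is at most sqrt \<Delta> / 20736, dividing \<Delta> by 80 h^2 still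
    leaves a multiple of sqrt \<Delta>. Hence s and z exceed q, at the price of half the
    exponent.\<close>
  define q where "q = sqrt D"
  have qq: "q * q = D" and q0: "0 \<le> q" using D1 by (simp_all add: q_def)
  have ql: "l ^ 2 \<le> q"
  proof -
    have "(l ^ 2) ^ 2 \<le> D" using Dl(1) by (simp flip: power_mult)
    then show ?thesis unfolding q_def by (intro real_le_rsqrt)
  qed
  have q49: "49 \<le> q" using ql l2 by linarith
  have HH: "20736 * (H * H) \<le> q"
  proof -
    have "(144 * H) * (144 * H) \<le> l * l" using Hl H15 by (intro mult_mono) auto
    then show ?thesis using ql by (simp add: power2_eq_square)
  qed
  have HHpos: "0 < H * H" using H15 by simp
  \<comment> \<open>The factor 80 exceeds what 2 h N + h = 32 h^2 + h demands for the degrees of the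
    connectors.\<close>
  define s where "s = \<Delta> div (80 * (h * h))"
  define S where "S = real s"
  have sle: "80 * (h * h) * s \<le> \<Delta>" unfolding s_def by simp
  have hh: "0 < 80 * (h * h)" using h1 by simp
  have Sge: "258 * q \<le> S"
  proof -
    have "\<Delta> < 80 * (h * h) * s + 80 * (h * h)"
      unfolding s_def using mult_div_mod_eq[of "80 * (h * h)" \<Delta>] mod_less_divisor[OF hh, of \<Delta>] by linarith
    then have "real \<Delta> < real (80 * (h * h) * s + 80 * (h * h))" by (simp only: of_nat_less_iff)
    then have "q * q < 80 * (H * H) * (S + 1)" by (simp add: qq D_def H_def S_def algebra_simps)
    also have "\<dots> \<le> 80 * (q / 20736) * (S + 1)"
      using HH by (intro mult_right_mono mult_left_mono) (auto simp: S_def)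
    finally have "q * q < q * (80 / 20736 * (S + 1))" by (simp add: algebra_simps)
    then have "q < 80 / 20736 * (S + 1)" using q49 by simp
    then show ?thesis using q49 by (simp add: field_simps)
  qed
  have s1: "1 \<le> s" using Sge q49 by (simp add: S_def)
  define N where "N = 16 * h"
  have c4: "(2 * h * N + h) * s < \<Delta>"
  proof -
    have "2 * h * N + h < 80 * (h * h)"
    proof -
      have "h * 1 \<le> h * h" using h1 by (intro mult_left_mono) auto
      moreover have "2 * h * N + h = 32 * (h * h) + h" by (simp add: N_def)
      ultimately show ?thesis using hh by linarith
    qed
    then have "(2 * h * N + h) * s < 80 * (h * h) * s" using s1 by simp
    then show ?thesis using sle by linarith
  qed
  define z where "z = 2 * ((s - 2) div 120)"
  have z60: "60 * z \<le> s - 2" unfolding z_def by simp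
  have zq: "q \<le> real z"
  proof -
    have "s - 2 < 120 * ((s - 2) div 120) + 120"
      using mult_div_mod_eq[of 120 "s - 2"] mod_less_divisor[of 120 "s - 2"] by linarith
    then have "s < 60 * z + 122" unfolding z_def by linarith
    then have "S < 60 * real z + 122" unfolding S_def by linarith
    then show ?thesis using Sge q49 by linarith
  qed
  have zev: "even z" by (simp add: z_def)
  have z2: "2 \<le> z" using zq q49 by linarith
  \<comment> \<open>An intermediate scale: at least \<Delta>, at most n powr 0.01, and with a square
    below z ^ (h - 1), so that L / z ^ (h - 1) is at most of order 1 / y.\<close>
  define y where "y = D powr (0.01 / \<epsilon>)"
  have Dy: "D \<le> y"
  proof -
    have "D powr 1 \<le> D powr (0.01 / \<epsilon>)" using D1 \<epsilon> by (intro powr_mono) (auto simp: field_simps)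
    then show ?thesis using D1 by (simp add: y_def)
  qed
  have y1: "1 \<le> y" using Dy D1 by linarith
  have yn: "y \<le> real n powr 0.01"
  proof -
    have "y \<le> (real n powr \<epsilon>) powr (0.01 / \<epsilon>)" unfolding y_def using Dl(2) D1 \<epsilon> by (intro powr_mono2) auto
    also have "\<dots> = real n powr 0.01" using \<epsilon> by (simp add: powr_powr)
    finally show ?thesis .
  qed
  \<comment> \<open>The exponent 1 / 1000 does not exceed 0.01, so T stays within the scale y, up to
    rounding.\<close>
  define T where "T = nat \<lceil>D powr (1 / 1000 / \<epsilon>)\<rceil>"
  have T: "D powr (1 / 1000 / \<epsilon>) \<le> real T" unfolding T_def by (rule real_nat_ceiling_ge)
  have Ty: "real T \<le> 2 * y"
  proof -
    have "D powr (1 / 1000 / \<epsilon>) \<le> y" unfolding y_def using D1 \<epsilon> by (intro powr_mono divide_right_mono) auto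
    moreover have "real T \<le> D powr (1 / 1000 / \<epsilon>) + 1" unfolding T_def by (rule nat_ceiling_le) simp
    ultimately show ?thesis using y1 by linarith
  qed
  define L where "L = 3 * (D + real T)"
  have L0: "0 \<le> L" using D1 by (simp add: L_def)
  have Ly: "L \<le> 9 * y" using Dy Ty by (simp add: L_def)
  have zy: "y * y \<le> real z ^ (h - 1)"
  proof -
    have "q = D powr (1 / 2)" using D1 by (simp add: q_def powr_half_sqrt)
    then have "q ^ (h - 1) = D powr (1 / 2 * real (h - 1))" using D1 by (simp add: powr_powr flip: powr_realpow)
    moreover have "0.02 / \<epsilon> \<le> 1 / 2 * real (h - 1)"
    proof -
      have "real (h - 1) = H - 1" using h1 by (simp add: H_def of_nat_diff)
      moreover have "1 / (6 * \<epsilon>) - 2 \<ge> 0.04 / \<epsilon>" using \<epsilon> by (simp add: field_simps)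
      moreover have "0.02 / \<epsilon> = 1 / 2 * (0.04 / \<epsilon>)" by simp
      ultimately show ?thesis using Hge by linarith
    qed
    ultimately have "D powr (0.02 / \<epsilon>) \<le> q ^ (h - 1)" using D1 by (simp add: powr_mono)
    also have "\<dots> \<le> real z ^ (h - 1)" using zq q0 by (rule power_mono)
    also have "D powr (0.02 / \<epsilon>) = y * y" unfolding y_def by (simp flip: powr_add add: add_divide_distrib[symmetric])
    finally show ?thesis .
  qed
  have part4: "L / real (z ^ (h - 1)) \<le> 9 / l ^ 4"
  proof -
    have "L / real (z ^ (h - 1)) \<le> (9 * y) / (y * y)"
      using Ly L0 zy y1 by (intro frac_le) auto
    also have "\<dots> = 9 / y" using y1 by simp
    also have "\<dots> \<le> 9 / l ^ 4" using Dy Dl(1) l4 by (intro divide_left_mono mult_pos_pos) auto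
    finally show ?thesis .
  qed
  have part3: "1 / S \<le> 1 / (258 * l ^ 2)"
    using Sge ql l2 by (intro divide_left_mono mult_pos_pos) auto
  define r where "r = real n powr 0.1"
  have r1: "1 \<le> r" unfolding r_def using big(1) by (intro ge_one_powr_ge_zero) auto
  \<comment> \<open>A prime of at least n powr 0.1 exceeds the number of colours and outweighs L ^
    3. Being at most quadratic in X, it leaves about n powr 0.6 positions in a copy, few enough for
    many copies to fit into n vertices.\<close>
  define X where "X = nat \<lceil>r\<rceil> + 1"
  have X2: "2 \<le> X" and Xr: "r \<le> real X" and Xr2: "real X \<le> 3 * r"
  proof -
    show "r \<le> real X" using real_nat_ceiling_ge[of r] by (simp add: X_def)
    have "real (nat \<lceil>r\<rceil>) \<le> r + 1" using r1 by (intro nat_ceiling_le) simp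
    moreover have "real X = real (nat \<lceil>r\<rceil>) + 1" by (simp only: X_def of_nat_add of_nat_1)
    ultimately show "real X \<le> 3 * r" using r1 by linarith
    have "1 \<le> real (nat \<lceil>r\<rceil>)" using real_nat_ceiling_ge[of r] r1 by linarith
    then have "1 \<le> nat \<lceil>r\<rceil>" by linarith
    then show "2 \<le> X" by (simp add: X_def)
  qed
  obtain p where p: "prime p" "X \<le> p" "p \<le> 2 * X ^ 2 + 1" using prime_between[OF X2] by blast
  define P where "P = real p"
  have Pr: "r \<le> P" using Xr p(2) by (simp add: P_def)
  have P2: "2 \<le> P" using X2 p(2) by (simp add: P_def)
  have P19: "P \<le> 19 * r ^ 2"
  proof -
    have "P \<le> real (2 * X ^ 2 + 1)" unfolding P_def using p(3) by (simp only: of_nat_le_iff)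
    also have "\<dots> = 2 * real X ^ 2 + 1" by simp
    also have "\<dots> \<le> 2 * (3 * r) ^ 2 + r ^ 2"
      using Xr2 r1 by (intro add_mono mult_left_mono power_mono) auto
    also have "\<dots> = 19 * r ^ 2" by (simp add: power_mult_distrib)
    finally show ?thesis .
  qed
  define B where "B = N * (2 * h + 1) + h"
  define G1 where "G1 = (p - 1) * (p * p - 1)"
  define V1 where "V1 = 2 * G1 * B"
  \<comment> \<open>The copies fill the n vertices up to a remainder below V1 \<le> n / 20, whose
    vertices stay isolated.\<close>
  define K where "K = n div V1"
  define G where "G = K * G1"
  define V where "V = 2 * G * B"
  have p2: "2 \<le> p" using P2 by (simp add: P_def)
  have p4: "2 * 2 \<le> p * p" using p2 by (intro mult_le_mono)
  have BH: "real B = 32 * (H * H) + 17 * H" by (simp add: B_def N_def H_def algebra_simps)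
  have B0: "0 < real B" unfolding BH using HHpos H15 by linarith
  have Bl: "real B \<le> l ^ 2"
  proof -
    have "15 * H \<le> H * H" using H15 by (intro mult_right_mono) auto
    then have "real B \<le> 20736 * (H * H)" unfolding BH using H15 by linarith
    also have "\<dots> \<le> l ^ 2" using mult_mono[OF Hl Hl] H15 lpos by (simp add: power2_eq_square)
    finally show ?thesis .
  qed
  have cp: "\<Delta> * (B * B) < p"
  proof -
    have "real B * real B \<le> l ^ 2 * l ^ 2" using Bl B0 by (intro mult_mono) auto
    then have "D * (real B * real B) \<le> real n powr 0.01 * l ^ 4"
      using Dy yn D1 by (intro mult_mono) (auto simp: power2_eq_square power4_eq_xxxx mult.assoc)
    also have "\<dots> < r" using big(3) by (simp add: l_def r_def)
    finally have "D * (real B * real B) < P" using Pr by linarith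
    then have "real (\<Delta> * (B * B)) < real p" by (simp add: D_def P_def)
    then show ?thesis by (simp only: of_nat_less_iff)
  qed
  have G1r: "real G1 = (P - 1) * (P * P - 1)"
    using p2 p4 by (simp add: G1_def P_def of_nat_diff)
  have G10: "0 < G1" using p2 p4 by (simp add: G1_def)
  have V10: "0 < V1" using G10 B0 by (simp add: V1_def)
  have V1n: "real V1 \<le> real n / 20"
  proof -
    have "real G1 \<le> P * (P * P)" unfolding G1r using P2 mult_mono[of 1 P 1 P] by (intro mult_mono) auto
    also have "\<dots> = P ^ 3" by (simp add: power3_eq_cube)
    also have "\<dots> \<le> (19 * r ^ 2) ^ 3" using P19 P2 by (intro power_mono) auto
    also have "\<dots> = 6859 * r ^ 6" by (simp add: power_mult_distrib flip: power_mult)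
    also have "r ^ 6 = real n powr 0.6"
    proof -
      have "r ^ 6 = r powr real 6" using r1 by (subst powr_realpow) auto
      then show ?thesis by (simp add: r_def powr_powr)
    qed
    finally have "real G1 * real B \<le> 6859 * real n powr 0.6 * l ^ 2"
      using Bl by (intro mult_mono) auto
    then have "2 * (real G1 * real B) \<le> 2 * (6859 * real n powr 0.6 * l ^ 2)" by (rule mult_left_mono) simp
    moreover have "real V1 = 2 * (real G1 * real B)" by (simp only: V1_def of_nat_mult of_nat_numeral mult.assoc)
    ultimately have "real V1 \<le> 13718 * real n powr 0.6 * l ^ 2" by simp
    then show ?thesis using big(4) by (simp add: l_def)
  qed
  have VK: "V = K * V1" by (simp add: V_def G_def V1_def)
  have Vn: "V \<le> n" unfolding VK K_def by simp
  have nV': "95 / 100 * real n \<le> real V"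
  proof -
    have "n < V + V1"
      unfolding VK K_def using dividend_less_times_div[OF V10, of n] by (simp add: ac_simps)
    then have "real n < real V + real V1" by linarith
    then show ?thesis using V1n by linarith
  qed
  then have nV: "0.95 * real n \<le> real V" by simp
  have Vpos: "0 < real V" using nV' big(1) by linarith
  have K0: "0 < K" using Vpos unfolding VK by (cases "K = 0") auto
  have G0: "0 < real G" using K0 G10 by (simp add: G_def)
  have y3: "L ^ 3 \<le> 729 * real n powr 0.03"
  proof -
    have "L ^ 3 \<le> (9 * real n powr 0.01) ^ 3" using Ly yn L0 by (intro power_mono) auto
    also have "\<dots> = 729 * (real n powr 0.01) ^ 3" by (simp add: power_mult_distrib)
    also have "(real n powr 0.01) ^ 3 = real n powr 0.03"
      using big(1) by (simp add: power3_eq_cube flip: powr_add)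
    finally show ?thesis .
  qed
  have part1: "L * L / real V \<le> 100 * real n powr 0.02 / real n"
  proof -
    have "L * L \<le> (9 * real n powr 0.01) * (9 * real n powr 0.01)"
      using Ly yn L0 by (intro mult_mono) auto
    also have "\<dots> = 81 * real n powr 0.02" using big(1) by (simp flip: powr_add)
    finally have "L * L / real V \<le> 81 * real n powr 0.02 / (95 / 100 * real n)"
      using nV' big(1) by (intro frac_le) auto
    also have "\<dots> \<le> 100 * real n powr 0.02 / real n" using big(1) by (simp add: field_simps)
    finally show ?thesis .
  qed
  have part2: "L * L * (real K * (P * P) * (2 * L)) / real G \<le> 5832 * real n powr 0.03 / r"
  proof -
    have "L * L * (real K * (P * P) * (2 * L)) / real G \<le> 8 * L ^ 3 / P"
      using labelling_ratio_le[OF L0 P2, of "real K"] K0 by (simp add: G_def G1r)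
    also have "\<dots> \<le> (8 * (729 * real n powr 0.03)) / r"
      using y3 L0 Pr r1 by (intro frac_le mult_left_mono) auto
    finally show ?thesis by simp
  qed
  define \<delta> where "\<delta> = L * L / real V + L * L * (real K * (P * P) * (2 * L)) / real G + 1 / S + L / real (z ^ (h - 1))"
  have "\<delta> \<le> 100 * real n powr 0.02 / real n + 5832 * real n powr 0.03 / r + 1 / (258 * l ^ 2) + 9 / l ^ 4"
    unfolding \<delta>_def by (intro add_mono part1 part2 part3 part4)
  also have "\<dots> \<le> 2 / l" using big(5) by (simp only: r_def l_def)
  finally have "l * \<delta> \<le> 2" using lpos by (simp add: field_simps)
  moreover have "0 \<le> \<delta>" unfolding \<delta>_def using L0 P2 by (intro add_nonneg_nonneg divide_nonneg_nonneg mult_nonneg_nonneg) (auto simp: S_def)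
  then have "144 * H * \<delta> \<le> l * \<delta>" using Hl by (intro mult_right_mono)
  ultimately have Hd: "144 * (H * \<delta>) \<le> 2" by simp
  have "real V * \<delta> < 0.51 * (2 * (real G * (16 * H) - 2 * real G * H - \<epsilon> * real n))"
    by (rule budget[OF G0 H15 \<epsilon> eH BH _ nV Hd]) (simp add: V_def)
  moreover have "\<delta> = real (3 * (\<Delta> + T) * (3 * (\<Delta> + T))) / real V
        + real (3 * (\<Delta> + T) * (3 * (\<Delta> + T)) * (K * (p * p) * (2 * (3 * (\<Delta> + T))))) / real G
        + 1 / real s + real (3 * (\<Delta> + T)) / real (z ^ (h - 1))"
  proof -
    have "real (3 * (\<Delta> + T)) = L" by (simp add: L_def D_def)
    then show ?thesis unfolding \<delta>_def S_def P_def by (simp only: of_nat_mult of_nat_numeral)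
  qed
  moreover have "16 * H = real N" by (simp add: N_def H_def)
  ultimately have final: "real V * (real (3 * (\<Delta> + T) * (3 * (\<Delta> + T))) / real V
        + real (3 * (\<Delta> + T) * (3 * (\<Delta> + T)) * (K * (p * p) * (2 * (3 * (\<Delta> + T))))) / real G
        + 1 / real s + real (3 * (\<Delta> + T)) / real (z ^ (h - 1)))
      < 0.51 * (2 * (real G * real N - 2 * real G * real h - \<epsilon> * real n))"
    by (simp only: H_def)
  have N1: "1 \<le> N" using h1 by (simp add: N_def)
  show ?thesis
    by (rule that[OF h1 N1 s1 c4 p(1) cp[unfolded B_def] K0 zev z2 z60
          Vn[unfolded V_def G_def G1_def B_def] final[unfolded V_def G_def G1_def B_def] T[unfolded D_def]])
qed

theorem theorem1p1:
  "\<exists>c::real. c > 0 \<and> (\<exists>n\<^sub>0::nat. \<forall>n\<ge>n\<^sub>0. \<forall>(\<epsilon>::real) (\<Delta>::nat).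
     0 < \<epsilon> \<and> \<epsilon> \<le> 0.01 \<and> ln (real n) ^ 4 \<le> real \<Delta> \<and> real \<Delta> \<le> real n powr \<epsilon> \<longrightarrow>
     (\<exists>E. simple_graph n E \<and> bipartite n E \<and> max_degree n E = \<Delta> \<and>
        (\<forall>A::lca. computes_approx_matching n \<epsilon> E 0.51 A \<longrightarrow>
           makes_queries n E A (real \<Delta> powr (c / \<epsilon>)))))"
proof -
  obtain n\<^sub>0 where n\<^sub>0: "\<And>n. n\<^sub>0 \<le> n \<Longrightarrow> 1 < real n \<and> 6 \<le> ln (ln (real n)) \<and>
     real n powr 0.01 * ln (real n) ^ 4 < real n powr 0.1 \<and>
     13718 * real n powr 0.6 * ln (real n) ^ 2 \<le> real n / 20 \<and>
     100 * real n powr 0.02 / real n + 5832 * real n powr 0.03 / real n powr 0.1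
       + 1 / (258 * ln (real n) ^ 2) + 9 / ln (real n) ^ 4 \<le> 2 / ln (real n)"
    using large_n unfolding eventually_sequentially by blast
  have "\<exists>E. simple_graph n E \<and> bipartite n E \<and> max_degree n E = \<Delta> \<and>
        (\<forall>A::lca. computes_approx_matching n \<epsilon> E 0.51 A \<longrightarrow>
           makes_queries n E A (real \<Delta> powr (1 / 1000 / \<epsilon>)))"
    if n: "n\<^sub>0 \<le> n" and hyp: "0 < \<epsilon>" "\<epsilon> \<le> 0.01" "ln (real n) ^ 4 \<le> real \<Delta>" "real \<Delta> \<le> real n powr \<epsilon>"
    for n \<Delta> :: nat and \<epsilon> :: real
  proof -
    have big: "1 < real n" "6 \<le> ln (ln (real n))"
        "real n powr 0.01 * ln (real n) ^ 4 < real n powr 0.1"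
        "13718 * real n powr 0.6 * ln (real n) ^ 2 \<le> real n / 20"
        "100 * real n powr 0.02 / real n + 5832 * real n powr 0.03 / real n powr 0.1
          + 1 / (258 * ln (real n) ^ 2) + 9 / ln (real n) ^ 4 \<le> 2 / ln (real n)"
      using n\<^sub>0[OF n] by blast+
    obtain h N s K p z T where
      par: "1 \<le> h" "1 \<le> N" "1 \<le> s" "(2 * h * N + h) * s < \<Delta>"
        "prime p" "\<Delta> * ((N * (2 * h + 1) + h) * (N * (2 * h + 1) + h)) < p" "0 < K"
        "even z" "2 \<le> z" "60 * z \<le> s - 2"
        "2 * (K * ((p - 1) * (p * p - 1))) * (N * (2 * h + 1) + h) \<le> n"
        "real (2 * (K * ((p - 1) * (p * p - 1))) * (N * (2 * h + 1) + h)) *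
          (real (3 * (\<Delta> + T) * (3 * (\<Delta> + T))) / real (2 * (K * ((p - 1) * (p * p - 1))) * (N * (2 * h + 1) + h))
            + real (3 * (\<Delta> + T) * (3 * (\<Delta> + T)) * (K * (p * p) * (2 * (3 * (\<Delta> + T))))) / real (K * ((p - 1) * (p * p - 1)))
            + 1 / real s + real (3 * (\<Delta> + T)) / real (z ^ (h - 1)))
          < 0.51 * (2 * (real (K * ((p - 1) * (p * p - 1))) * real N - 2 * real (K * ((p - 1) * (p * p - 1))) * real h - \<epsilon> * real n))"
      and T: "real \<Delta> powr (1 / 1000 / \<epsilon>) \<le> real T"
      by (rule parameters[OF big hyp])
    have mono: "makes_queries n E A (real \<Delta> powr (1 / 1000 / \<epsilon>))" if "makes_queries n E A (real T)" for E A
      using that T unfolding makes_queries_def by (meson order_trans)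
    obtain E where "simple_graph n E" "bipartite n E" "max_degree n E = \<Delta>"
        "\<And>A. computes_approx_matching n \<epsilon> E 0.51 A \<Longrightarrow> makes_queries n E A (real T)"
      using hard_graph[OF par] by blast
    then show ?thesis using mono by blast
  qed
  then show ?thesis by (intro exI[of _ "1 / 1000"] conjI exI[of _ n\<^sub>0]) auto
qed

end
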